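(* Let $(M,g)$ be a Lorentzian manifold, $H\subset M$ a null hypersurface, $L$ a local null-geodesic vector field on $H$, $S$ a local space-like cross-section for $H$, and $\varphi$ a positive $C^1$ transverse function on $H$. Then $$\widetilde{\mathrm{vol}}_{\varphi L}^S=\frac1\varphi\,\widetilde{\mathrm{vol}}_L^S .$$
   Context: Lorentzian manifolds $(M,g)$ are smooth of dimension $n\ge3$, with $g$ of class $C^2$ and signature $(-,+,\dots,+)$, time-oriented; hypersurfaces and submanifolds are of class $C^2$. A hypersurface $H\subset M$ is null if $g|_{TH}$ is degenerate; then $\mathscr N H=\{v\in TM|_H: g(v,w)=0\ \forall w\in TH\}$ is a line sub-bundle of $TH$. A null-geodesic vector field on (an open subset of) $H$ is a nowhere vanishing future-directed $C^1$ section $L$ of $\mathscr NH$ with $\nabla_LL=0$. A function $\varphi:H\to\mathbb R$ is transverse if for all $x\in H$ and $v\in\mathscr N_xH\setminus\{0\}$ the composition $\varphi\circ\gamma$ is constant, where $\gamma$ is the geodesic contained in $H$ with $\gamma_0=x$, $\dot\gamma_0=v$; if $\varphi$ is moreover $C^1$ and positive then $\varphi L$ is again a null-geodesic vector field. A local space-like cross-section is an $(n-2)$-dimensional submanifold $S\subset H$ on which $g$ is positive definite. $\Psi_L(z,t)=\exp_z(tL(z))$ whenever defined and in $H$. For a local cross-section $S$, let $\overline{L^S}$ be the unique vector field along $S$ with $g(\overline{L^S},X)=0$ for $X\in TS$, $g(\overline{L^S},L)=-1$, $g(\overline{L^S},\overline{L^S})=0$, extended by parallel transport along $t\mapsto\Psi_L(z,t)$,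 $z\in S$. Let $\mathcal V\subset S\times\mathbb R$ be open, containing $S\times\{0\}$, with $\{t:(z,t)\in\mathcal V\}$ an interval for each $z$, on which $\Psi_L$ is a diffeomorphism onto its open image $\Omega_S\subset H$. On $\Omega_S$ put $\alpha(v)=-g(\overline{L^S},v)$, $v\in TH$; $\widetilde{\mathrm{vol}}_L^S$ is the volume measure on $\Omega_S$ of the Riemannian metric $g|_{TH}+\alpha\otimes\alpha$. For $\varphi L$ the same open set $\Omega_S$ is used. *)

theory Defs
  imports "HOL-Analysis.Analysis"
begin

section \<open>Smooth manifolds and tangent vectors\<close>

text \<open>\<open>C\<^sup>k\<close> on an open set of a Euclidean space; all directional derivatives of a total derivative
  being \<open>C\<^sup>k\<close> is the same as the partial derivatives being \<open>C\<^sup>k\<close>.\<close>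

primrec Ck_on :: "nat \<Rightarrow> ('a::euclidean_space \<Rightarrow> 'b::real_normed_vector) \<Rightarrow> 'a set \<Rightarrow> bool" where
  "Ck_on 0 f U \<longleftrightarrow> continuous_on U f"
| "Ck_on (Suc k) f U \<longleftrightarrow>
     (\<exists>f'. (\<forall>x\<in>U. (f has_derivative f' x) (at x)) \<and> (\<forall>v. Ck_on k (\<lambda>x. f' x v) U))"

type_synonym ('m, 'n) chart = "'m set \<times> ('m \<Rightarrow> (real, 'n) vec)"

definition chart_inv :: "('m, 'n) chart \<Rightarrow> (real, 'n) vec \<Rightarrow> 'm" where
  "chart_inv c = inv_into (fst c) (snd c)"

definition carrier :: "('m, 'n) chart set \<Rightarrow> 'm set" where
  "carrier A = (\<Union>c\<in>A. fst c)"

definition smooth_atlas ::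
  "('m::{t2_space, second_countable_topology}, 'n::finite) chart set \<Rightarrow> bool" where
  "smooth_atlas A \<longleftrightarrow>
     (\<forall>c\<in>A. open (fst c) \<and> open (snd c ` fst c) \<and>
        homeomorphism (fst c) (snd c ` fst c) (snd c) (chart_inv c)) \<and>
     (\<forall>c\<in>A. \<forall>d\<in>A. \<forall>k. Ck_on k (snd d \<circ> chart_inv c) (snd c ` (fst c \<inter> fst d)))"

text \<open>A tangent vector at \<open>p\<close> is the family of its components in all charts around \<open>p\<close>, related by
  the Jacobians of the chart changes; the entries of all other charts are set to \<open>0\<close>.\<close>

type_synonym ('m, 'n) tvec = "('m, 'n) chart \<Rightarrow> (real, 'n) vec"

definition tangent_space :: "('m, 'n::finite) chart set \<Rightarrow> 'm \<Rightarrow> ('m, 'n) tvec set" where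
  "tangent_space A p = {v.
     (\<forall>c\<in>A. \<forall>d\<in>A. p \<in> fst c \<longrightarrow> p \<in> fst d \<longrightarrow>
        v d = frechet_derivative (snd d \<circ> chart_inv c) (at (snd c p)) (v c)) \<and>
     (\<forall>c. c \<notin> A \<or> p \<notin> fst c \<longrightarrow> v c = 0)}"

definition tscale :: "real \<Rightarrow> ('m, 'n::finite) tvec \<Rightarrow> ('m, 'n) tvec" where
  "tscale a v = (\<lambda>c. a *\<^sub>R v c)"

definition Ck_into :: "('m::topological_space, 'n::finite) chart set \<Rightarrow> nat \<Rightarrow>
    ('a::euclidean_space \<Rightarrow> 'm) \<Rightarrow> 'a set \<Rightarrow> bool" where
  "Ck_into A k f W \<longleftrightarrow> open W \<and> continuous_on W f \<and> f ` W \<subseteq> carrier A \<and>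
     (\<forall>c\<in>A. Ck_on k (snd c \<circ> f) (W \<inter> f -` fst c))"

text \<open>The differential at \<open>x\<close> of a map \<open>f\<close> into the manifold, applied to \<open>u\<close>.\<close>

definition dmap :: "('m, 'n::finite) chart set \<Rightarrow> ('a::euclidean_space \<Rightarrow> 'm) \<Rightarrow> 'a \<Rightarrow> 'a \<Rightarrow>
    ('m, 'n) tvec" where
  "dmap A f x u =
     (\<lambda>c. if c \<in> A \<and> f x \<in> fst c then frechet_derivative (snd c \<circ> f) (at x) u else 0)"

definition velocity :: "('m, 'n::finite) chart set \<Rightarrow> (real \<Rightarrow> 'm) \<Rightarrow> real \<Rightarrow> ('m, 'n) tvec" where
  "velocity A \<gamma> t = dmap A \<gamma> t 1"

text \<open>The tangent vector at the point with coordinates \<open>x\<close> whose components in the chart \<open>c\<close>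
  are \<open>u\<close>.\<close>

definition coord_vec :: "('m, 'n::finite) chart set \<Rightarrow> ('m, 'n) chart \<Rightarrow> real^'n \<Rightarrow> real^'n \<Rightarrow>
    ('m, 'n) tvec" where
  "coord_vec A c x u = dmap A (chart_inv c) x u"

section \<open>Lorentzian metrics, parallel transport and geodesics\<close>

type_synonym ('m, 'n) metric = "'m \<Rightarrow> ('m, 'n) tvec \<Rightarrow> ('m, 'n) tvec \<Rightarrow> real"

definition gcomp :: "('m, 'n::finite) chart set \<Rightarrow> ('m, 'n) metric \<Rightarrow> ('m, 'n) chart \<Rightarrow>
    real^'n \<Rightarrow> real^'n \<Rightarrow> real^'n \<Rightarrow> real" where
  "gcomp A g c x u v = g (chart_inv c x) (coord_vec A c x u) (coord_vec A c x v)"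

text \<open>The signature condition makes \<open>g\<close> linearly isometric, at every point, to the Minkowski form;
  this contains bilinearity and symmetry.\<close>

definition lorentzian_manifold ::
  "('m::{t2_space, second_countable_topology}, 'n::finite) chart set \<Rightarrow> ('m, 'n) metric \<Rightarrow> bool" where
  "lorentzian_manifold A g \<longleftrightarrow> smooth_atlas A \<and> CARD('n) \<ge> 3 \<and>
     (\<forall>c\<in>A. \<forall>x\<in>snd c ` fst c. \<exists>(f :: real^'n \<Rightarrow> real^'n) i0. linear f \<and> bij f \<and>
        (\<forall>u v. gcomp A g c x (f u) (f v) =
           (\<Sum>i\<in>UNIV. (if i = i0 then - 1 else 1) * (u $ i) * (v $ i)))) \<and>
     (\<forall>c\<in>A. \<forall>u v. Ck_on 2 (\<lambda>x. gcomp A g c x u v) (snd c ` fst c))"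

definition time_orientation ::
  "('m::topological_space, 'n::finite) chart set \<Rightarrow> ('m, 'n) metric \<Rightarrow> ('m \<Rightarrow> ('m, 'n) tvec) \<Rightarrow> bool" where
  "time_orientation A g T \<longleftrightarrow>
     (\<forall>p\<in>carrier A. T p \<in> tangent_space A p \<and> g p (T p) (T p) < 0) \<and>
     (\<forall>c\<in>A. continuous_on (fst c) (\<lambda>p. T p c))"

definition future_directed ::
  "('m, 'n::finite) metric \<Rightarrow> ('m \<Rightarrow> ('m, 'n) tvec) \<Rightarrow> 'm \<Rightarrow> ('m, 'n) tvec \<Rightarrow> bool" where
  "future_directed g T p v \<longleftrightarrow> v \<noteq> (\<lambda>_. 0) \<and> g p v v \<le> 0 \<and> g p (T p) v < 0"

text \<open>The Christoffel symbols of the Levi-Civita connection, as the bilinear map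
  \<open>(u, v) \<mapsto> \<Gamma>\<^sup>k\<^sub>i\<^sub>j u\<^sup>i v\<^sup>j\<close>.\<close>

definition christoffel :: "('m, 'n::finite) chart set \<Rightarrow> ('m, 'n) metric \<Rightarrow> ('m, 'n) chart \<Rightarrow>
    real^'n \<Rightarrow> real^'n \<Rightarrow> real^'n \<Rightarrow> real^'n" where
  "christoffel A g c x u v =
     matrix_inv (\<chi> k l. gcomp A g c x (axis k 1) (axis l 1)) *v
     (\<chi> l. (frechet_derivative (\<lambda>y. gcomp A g c y v (axis l 1)) (at x) u
           + frechet_derivative (\<lambda>y. gcomp A g c y u (axis l 1)) (at x) v
           - frechet_derivative (\<lambda>y. gcomp A g c y u v) (at x) (axis l 1)) / 2)"

text \<open>Covariant derivative at \<open>t\<close> of a vector field \<open>X\<close> along the curve \<open>\<gamma>\<close>.\<close>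

definition cov_deriv :: "('m, 'n::finite) chart set \<Rightarrow> ('m, 'n) metric \<Rightarrow> (real \<Rightarrow> 'm) \<Rightarrow>
    (real \<Rightarrow> ('m, 'n) tvec) \<Rightarrow> real \<Rightarrow> ('m, 'n) tvec" where
  "cov_deriv A g \<gamma> X t = (\<lambda>c. if c \<in> A \<and> \<gamma> t \<in> fst c
     then vector_derivative (\<lambda>s. X s c) (at t)
          + christoffel A g c (snd c (\<gamma> t)) (velocity A \<gamma> t c) (X t c)
     else 0)"

definition parallel_along :: "('m, 'n::finite) chart set \<Rightarrow> ('m, 'n) metric \<Rightarrow> (real \<Rightarrow> 'm) \<Rightarrow>
    (real \<Rightarrow> ('m, 'n) tvec) \<Rightarrow> real set \<Rightarrow> bool" where
  "parallel_along A g \<gamma> X I \<longleftrightarrow> (\<forall>t\<in>I. X t \<in> tangent_space A (\<gamma> t) \<and>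
     (\<forall>c\<in>A. \<gamma> t \<in> fst c \<longrightarrow> (\<lambda>s. X s c) differentiable (at t)) \<and>
     cov_deriv A g \<gamma> X t = (\<lambda>_. 0))"

definition geodesic :: "('m::topological_space, 'n::finite) chart set \<Rightarrow> ('m, 'n) metric \<Rightarrow>
    (real \<Rightarrow> 'm) \<Rightarrow> real set \<Rightarrow> bool" where
  "geodesic A g \<gamma> I \<longleftrightarrow> open I \<and> is_interval I \<and> Ck_into A 1 \<gamma> I \<and>
     parallel_along A g \<gamma> (velocity A \<gamma>) I"

definition exp_witness :: "('m::topological_space, 'n::finite) chart set \<Rightarrow> ('m, 'n) metric \<Rightarrow>
    'm \<Rightarrow> ('m, 'n) tvec \<Rightarrow> 'm \<Rightarrow> bool" where
  "exp_witness A g z v q \<longleftrightarrow> (\<exists>\<gamma> I. geodesic A g \<gamma> I \<and> {0..1} \<subseteq> I \<and>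
     \<gamma> 0 = z \<and> velocity A \<gamma> 0 = v \<and> \<gamma> 1 = q)"

definition exp_defined :: "('m::topological_space, 'n::finite) chart set \<Rightarrow> ('m, 'n) metric \<Rightarrow>
    'm \<Rightarrow> ('m, 'n) tvec \<Rightarrow> bool" where
  "exp_defined A g z v \<longleftrightarrow> (\<exists>q. exp_witness A g z v q)"

definition exp_map :: "('m::topological_space, 'n::finite) chart set \<Rightarrow> ('m, 'n) metric \<Rightarrow>
    'm \<Rightarrow> ('m, 'n) tvec \<Rightarrow> 'm" where
  "exp_map A g z v = (THE q. exp_witness A g z v q)"

section \<open>Submanifolds and null hypersurfaces\<close>

text \<open>Inverse charts of an embedded \<open>C\<^sup>2\<close> submanifold \<open>N\<close>; the dimension of \<open>N\<close> is that of the
  parameter space \<open>'a\<close>.\<close>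

definition local_param :: "('m::topological_space, 'n::finite) chart set \<Rightarrow> 'm set \<Rightarrow>
    'a::euclidean_space set \<Rightarrow> ('a \<Rightarrow> 'm) \<Rightarrow> bool" where
  "local_param A N W \<psi> \<longleftrightarrow> Ck_into A 2 \<psi> W \<and> (\<forall>x\<in>W. inj (dmap A \<psi> x)) \<and>
     openin (top_of_set N) (\<psi> ` W) \<and> (\<exists>\<kappa>. homeomorphism W (\<psi> ` W) \<psi> \<kappa>)"

definition submanifold :: "'a::euclidean_space itself \<Rightarrow>
    ('m::topological_space, 'n::finite) chart set \<Rightarrow> 'm set \<Rightarrow> bool" where
  "submanifold _ A N \<longleftrightarrow> N \<subseteq> carrier A \<and>
     (\<forall>p\<in>N. \<exists>W (\<psi> :: 'a \<Rightarrow> 'm). local_param A N W \<psi> \<and> p \<in> \<psi> ` W)"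

definition curve_in_from :: "('m::topological_space, 'n::finite) chart set \<Rightarrow> 'm set \<Rightarrow> 'm \<Rightarrow>
    (real \<Rightarrow> 'm) \<Rightarrow> bool" where
  "curve_in_from A N p \<gamma> \<longleftrightarrow> (\<exists>\<epsilon>>0. Ck_into A 1 \<gamma> {- \<epsilon><..<\<epsilon>} \<and> \<gamma> ` {- \<epsilon><..<\<epsilon>} \<subseteq> N) \<and> \<gamma> 0 = p"

definition tangent_sub :: "('m::topological_space, 'n::finite) chart set \<Rightarrow> 'm set \<Rightarrow> 'm \<Rightarrow>
    ('m, 'n) tvec set" where
  "tangent_sub A N p = {velocity A \<gamma> 0 |\<gamma>. curve_in_from A N p \<gamma>}"

definition null_hypersurface :: "'h::finite itself \<Rightarrow>
    ('m::topological_space, 'n::finite) chart set \<Rightarrow> ('m, 'n) metric \<Rightarrow> 'm set \<Rightarrow> bool" where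
  "null_hypersurface _ A g H \<longleftrightarrow> CARD('h) + 1 = CARD('n) \<and> submanifold TYPE(real^'h) A H \<and>
     (\<forall>p\<in>H. \<exists>v\<in>tangent_sub A H p. v \<noteq> (\<lambda>_. 0) \<and> (\<forall>w\<in>tangent_sub A H p. g p v w = 0))"

definition null_bundle :: "('m::topological_space, 'n::finite) chart set \<Rightarrow> ('m, 'n) metric \<Rightarrow>
    'm set \<Rightarrow> 'm \<Rightarrow> ('m, 'n) tvec set" where
  "null_bundle A g H p = {v \<in> tangent_space A p. \<forall>w\<in>tangent_sub A H p. g p v w = 0}"

text \<open>A null-geodesic vector field defined on the open subset \<open>D\<close> of \<open>H\<close>. The covariant derivative of
  \<open>L\<close> in the direction \<open>L p\<close> is computed along curves in \<open>D\<close> with velocity \<open>L p\<close>.\<close>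

definition null_geodesic_field :: "'h::finite itself \<Rightarrow>
    ('m::topological_space, 'n::finite) chart set \<Rightarrow> ('m, 'n) metric \<Rightarrow> ('m \<Rightarrow> ('m, 'n) tvec) \<Rightarrow>
    'm set \<Rightarrow> 'm set \<Rightarrow> ('m \<Rightarrow> ('m, 'n) tvec) \<Rightarrow> bool" where
  "null_geodesic_field _ A g T H D L \<longleftrightarrow> openin (top_of_set H) D \<and>
     (\<forall>p\<in>D. L p \<in> null_bundle A g H p \<and> L p \<noteq> (\<lambda>_. 0) \<and> future_directed g T p (L p)) \<and>
     (\<forall>W (\<psi> :: real^'h \<Rightarrow> 'm). local_param A D W \<psi> \<longrightarrow>
        (\<forall>c\<in>A. Ck_on 1 (\<lambda>x. L (\<psi> x) c) (W \<inter> \<psi> -` fst c))) \<and>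
     (\<forall>p\<in>D. \<forall>\<gamma>. curve_in_from A D p \<gamma> \<longrightarrow> velocity A \<gamma> 0 = L p \<longrightarrow>
        cov_deriv A g \<gamma> (\<lambda>t. L (\<gamma> t)) 0 = (\<lambda>_. 0))"

definition C1_function_on :: "'h::finite itself \<Rightarrow>
    ('m::topological_space, 'n::finite) chart set \<Rightarrow> 'm set \<Rightarrow> ('m \<Rightarrow> real) \<Rightarrow> bool" where
  "C1_function_on _ A N \<phi> \<longleftrightarrow>
     (\<forall>W (\<psi> :: real^'h \<Rightarrow> 'm). local_param A N W \<psi> \<longrightarrow> Ck_on 1 (\<phi> \<circ> \<psi>) W)"

definition transverse :: "('m::topological_space, 'n::finite) chart set \<Rightarrow> ('m, 'n) metric \<Rightarrow>
    'm set \<Rightarrow> ('m \<Rightarrow> real) \<Rightarrow> bool" where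
  "transverse A g H \<phi> \<longleftrightarrow> (\<forall>x\<in>H. \<forall>v\<in>null_bundle A g H x - {\<lambda>_. 0}. \<forall>\<gamma> I.
     geodesic A g \<gamma> I \<longrightarrow> 0 \<in> I \<longrightarrow> \<gamma> ` I \<subseteq> H \<longrightarrow> \<gamma> 0 = x \<longrightarrow> velocity A \<gamma> 0 = v \<longrightarrow>
     (\<forall>t\<in>I. \<phi> (\<gamma> t) = \<phi> x))"

definition spacelike_cross_section :: "'s::finite itself \<Rightarrow>
    ('m::topological_space, 'n::finite) chart set \<Rightarrow> ('m, 'n) metric \<Rightarrow> 'm set \<Rightarrow> 'm set \<Rightarrow> bool" where
  "spacelike_cross_section _ A g H S \<longleftrightarrow> S \<subseteq> H \<and>
     CARD('s) + 2 = CARD('n) \<and> submanifold TYPE(real^'s) A S \<and>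
     (\<forall>p\<in>S. \<forall>v\<in>tangent_sub A S p. v \<noteq> (\<lambda>_. 0) \<longrightarrow> g p v v > 0)"

section \<open>The measure associated with a cross-section\<close>

definition null_flow :: "('m::topological_space, 'n::finite) chart set \<Rightarrow> ('m, 'n) metric \<Rightarrow>
    ('m \<Rightarrow> ('m, 'n) tvec) \<Rightarrow> 'm \<times> real \<Rightarrow> 'm" where
  "null_flow A g L = (\<lambda>(z, t). exp_map A g z (tscale t (L z)))"

text \<open>\<open>V\<close> is an admissible domain of \<open>\<Psi> = null_flow A g L\<close> with image \<open>\<Omega>\<close>. As \<open>L\<close> is only \<open>C\<^sup>1\<close>,
  diffeomorphisms are of class \<open>C\<^sup>1\<close>. Since \<open>S\<close> and \<open>H\<close> are embedded, differentiability of \<open>\<Psi>\<close> and of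
  the \<open>S\<close>-component of its inverse can be tested as maps into the ambient manifold.\<close>

definition flow_domain :: "'h::finite itself \<Rightarrow> 's::finite itself \<Rightarrow>
    ('m::topological_space, 'n::finite) chart set \<Rightarrow> ('m, 'n) metric \<Rightarrow> 'm set \<Rightarrow>
    ('m \<Rightarrow> ('m, 'n) tvec) \<Rightarrow> 'm set \<Rightarrow> ('m \<times> real) set \<Rightarrow> 'm set \<Rightarrow> bool" where
  "flow_domain _ _ A g H L S V \<Omega> \<longleftrightarrow>
     openin (top_of_set (S \<times> UNIV)) V \<and> S \<times> {0} \<subseteq> V \<and>
     (\<forall>z\<in>S. is_interval {t. (z, t) \<in> V}) \<and>
     (\<forall>(z, t)\<in>V. exp_defined A g z (tscale t (L z)) \<and> null_flow A g L (z, t) \<in> H) \<and>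
     inj_on (null_flow A g L) V \<and> \<Omega> = null_flow A g L ` V \<and> openin (top_of_set H) \<Omega> \<and>
     (\<forall>W (\<sigma> :: real^'s \<Rightarrow> 'm). local_param A S W \<sigma> \<longrightarrow>
        Ck_into A 1 (\<lambda>(x, t). null_flow A g L (\<sigma> x, t)) {(x, t). x \<in> W \<and> (\<sigma> x, t) \<in> V}) \<and>
     (\<forall>W (\<psi> :: real^'h \<Rightarrow> 'm). local_param A \<Omega> W \<psi> \<longrightarrow>
        Ck_into A 1 (\<lambda>y. fst (inv_into V (null_flow A g L) (\<psi> y))) W \<and>
        Ck_on 1 (\<lambda>y. snd (inv_into V (null_flow A g L) (\<psi> y))) W)"

text \<open>\<open>K\<close> is the normalised transversal null field along \<open>S\<close>, extended to
  the image of \<open>V\<close> by parallel transport along the generators.\<close>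

definition transversal_field :: "('m::topological_space, 'n::finite) chart set \<Rightarrow> ('m, 'n) metric \<Rightarrow>
    ('m \<Rightarrow> ('m, 'n) tvec) \<Rightarrow> 'm set \<Rightarrow> ('m \<times> real) set \<Rightarrow> ('m \<Rightarrow> ('m, 'n) tvec) \<Rightarrow> bool" where
  "transversal_field A g L S V K \<longleftrightarrow>
     (\<forall>z\<in>S. K z \<in> tangent_space A z \<and> (\<forall>X\<in>tangent_sub A S z. g z (K z) X = 0) \<and>
        g z (K z) (L z) = - 1 \<and> g z (K z) (K z) = 0) \<and>
     (\<forall>z\<in>S. parallel_along A g (\<lambda>t. null_flow A g L (z, t)) (\<lambda>t. K (null_flow A g L (z, t)))
        {t. (z, t) \<in> V})"

text \<open>\<open>\<mu>\<close> is the (Borel) volume measure on the submanifold \<open>N\<close> of the metric \<open>q\<close> on its tangent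
  bundle: \<open>sqrt (det (q\<^sub>i\<^sub>j)) dx\<close> in every local parametrisation.\<close>

definition is_volume_measure :: "'h::finite itself \<Rightarrow>
    ('m::topological_space, 'n::finite) chart set \<Rightarrow> 'm set \<Rightarrow> ('m, 'n) metric \<Rightarrow> 'm measure \<Rightarrow> bool" where
  "is_volume_measure _ A N q \<mu> \<longleftrightarrow> sets \<mu> = sets (restrict_space borel N) \<and>
     (\<forall>W (\<psi> :: real^'h \<Rightarrow> 'm). local_param A N W \<psi> \<longrightarrow> (\<forall>B\<in>sets borel. B \<subseteq> W \<longrightarrow>
        emeasure \<mu> (\<psi> ` B) =
        (\<integral>\<^sup>+ x\<in>B. ennreal (sqrt (det (\<chi> i j.
           q (\<psi> x) (dmap A \<psi> x (axis i 1)) (dmap A \<psi> x (axis j 1))))) \<partial>lborel)))"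

text \<open>\<open>\<mu>\<close> is the volume measure on \<open>\<Omega>\<close> of \<open>g + \<alpha> \<otimes> \<alpha>\<close>, where \<open>\<alpha> v = - g(K, v)\<close> and \<open>K\<close> is the
  transversal field of \<open>S\<close> and \<open>L\<close>.\<close>

definition is_tilde_vol :: "'h::finite itself \<Rightarrow> 's::finite itself \<Rightarrow>
    ('m::topological_space, 'n::finite) chart set \<Rightarrow> ('m, 'n) metric \<Rightarrow> 'm set \<Rightarrow>
    ('m \<Rightarrow> ('m, 'n) tvec) \<Rightarrow> 'm set \<Rightarrow> 'm set \<Rightarrow> 'm measure \<Rightarrow> bool" where
  "is_tilde_vol _ _ A g H L S \<Omega> \<mu> \<longleftrightarrow> (\<exists>V K.
     flow_domain TYPE('h) TYPE('s) A g H L S V \<Omega> \<and> transversal_field A g L S V K \<and>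
     is_volume_measure TYPE('h) A \<Omega>
       (\<lambda>p v w. g p v w + (- g p (K p) v) * (- g p (K p) w)) \<mu>)"

end

theory Submission
  imports Defs
begin

text \<open>
  Write \<open>L' = \<phi> L\<close>. The fields \<open>L\<close> and \<open>L'\<close> have the same generators, run through at different
  constant speeds: the flow line of \<open>L'\<close> from \<open>z\<close> at time \<open>s\<close> is at the point which the flow line of
  \<open>L\<close> reaches at time \<open>\<phi> z * s\<close>. Along \<open>S\<close> the conditions that determine the transversal null field
  are the same for both, except that the normalisation \<open>g (K, L) = - 1\<close> forces \<open>K' = K / \<phi>\<close>
  (\<open>transversal_vector_unique\<close>). Parallel transport is linear and compatible with changes of speed,
  so \<open>K' = K / \<phi> z\<close> on the whole generator through \<open>z\<close>; as \<open>\<phi>\<close> is transverse, \<open>\<phi> z\<close> is the value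
  of \<open>\<phi>\<close> at every point of it. Hence \<open>\<alpha>' = \<alpha> / \<phi>\<close> on \<open>\<Omega>\<close> (\<open>transversal_field_scaled\<close>).

  Since \<open>g\<close> is degenerate on \<open>H\<close>, the determinant of \<open>g + s \<alpha> \<otimes> \<alpha>\<close> is not merely affine but linear
  in \<open>s\<close> (\<open>det_rank_one_update\<close>): it is \<open>s\<close> times the determinant for \<open>s = 1\<close>. Taking \<open>s = 1 / \<phi>\<^sup>2\<close>
  and extracting the root gives the factor \<open>1 / \<phi>\<close> between the two volume densities
  (\<open>volume_density_scaled\<close>).

  Three points of this sketch carry most of the work.

  The exponential map is a definite description, so the flow lines are geodesics only because
  geodesics are determined by their initial data. This, and the uniqueness of parallel fields, follow
  from a Gronwall estimate, the Christoffel symbols of a \<open>C\<^sup>2\<close> metric being locally Lipschitz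
  (\<open>parallel_unique\<close>, \<open>geodesic_unique\<close>).

  A generator may meet \<open>S\<close> more than once, so a point of \<open>\<Omega>\<close> could conceivably be attached to
  different points of \<open>S\<close> by the two flows. On a flow line of \<open>L\<close> in \<open>\<Omega>\<close>, the set of points which
  both flows attach to the same \<open>z\<close> is open and, by continuity of the inverse of the second flow,
  closed; hence it is the whole line (\<open>flow_line_in_scaled_domain\<close>).

  The transversal field is given by parallel transport along each single generator, so the volume
  densities are a priori arbitrary functions on the parameter space and their integrals are lower
  integrals. The conclusion is therefore drawn from the two-sided bounds between \<open>\<mu>\<close> and \<open>\<nu>\<close> on
  sets where \<open>1 / \<phi>\<close> is nearly constant (\<open>density_eq_of_local_bounds\<close>).
\<close>

section \<open>Continuously differentiable and locally Lipschitz maps\<close>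

lemma Ck_on_Suc_imp: "Ck_on (Suc k) f U \<Longrightarrow> Ck_on k f U"
proof (induction k arbitrary: f)
  case 0
  then show ?case
    by (auto intro!: continuous_at_imp_continuous_on dest!: has_derivative_continuous)
next
  case (Suc k)
  then obtain f' where "\<forall>x\<in>U. (f has_derivative f' x) (at x)" "\<And>v. Ck_on (Suc k) (\<lambda>x. f' x v) U"
    by auto
  then show ?case using Suc.IH by auto
qed

lemma Ck_on_subset: "Ck_on k f U \<Longrightarrow> V \<subseteq> U \<Longrightarrow> Ck_on k f V"
proof (induction k arbitrary: f)
  case 0
  then show ?case by (auto intro: continuous_on_subset)
next
  case (Suc k)
  then obtain f' where "\<forall>x\<in>U. (f has_derivative f' x) (at x)" "\<And>v. Ck_on k (\<lambda>x. f' x v) U"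
    by auto
  then show ?case using Suc by (auto intro!: exI[of _ f'])
qed

text \<open>The derivative in the definition of \<open>C\<^sup>k\<close> is existentially quantified; on the open sets used
  here it is unique, so it can be traded for the Frechet derivative.\<close>

lemma Ck_on_frechet:
  assumes "Ck_on (Suc k) f U"
  shows "x \<in> U \<Longrightarrow> (f has_derivative frechet_derivative f (at x)) (at x)"
    and "x \<in> U \<Longrightarrow> f differentiable (at x)"
    and "\<exists>f'. (\<forall>x\<in>U. f' x = frechet_derivative f (at x)) \<and> (\<forall>v. Ck_on k (\<lambda>x. f' x v) U)"
proof -
  obtain f' where f': "\<forall>x\<in>U. (f has_derivative f' x) (at x)" "\<And>v. Ck_on k (\<lambda>x. f' x v) U"
    using assms by auto
  then have eq: "f' x = frechet_derivative f (at x)" if "x \<in> U" for x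
    using frechet_derivative_at that by blast
  show "x \<in> U \<Longrightarrow> (f has_derivative frechet_derivative f (at x)) (at x)" using f' eq by metis
  then show "x \<in> U \<Longrightarrow> f differentiable (at x)" by (rule differentiableI)
  show "\<exists>f'. (\<forall>x\<in>U. f' x = frechet_derivative f (at x)) \<and> (\<forall>v. Ck_on k (\<lambda>x. f' x v) U)"
    using f' eq by blast
qed

lemma Ck_on_1_continuous_frechet:
  assumes "Ck_on 1 f U"
  shows "continuous_on U (\<lambda>x. frechet_derivative f (at x) v)"
proof -
  from Ck_on_frechet(3)[of 0 f U] assms
  obtain f' where "\<forall>x\<in>U. f' x = frechet_derivative f (at x)" "\<forall>v. continuous_on U (\<lambda>x. f' x v)"
    by auto
  then show ?thesis by (metis (mono_tags, lifting) continuous_on_cong)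
qed

lemma Ck_on_1_I:
  assumes "\<And>x. x \<in> U \<Longrightarrow> (f has_derivative f' x) (at x)" "\<And>v. continuous_on U (\<lambda>x. f' x v)"
  shows "Ck_on 1 f U"
  using assms by auto

text \<open>Local Lipschitz continuity at a point is the regularity that survives all constructions leading
  from a \<open>C\<^sup>2\<close> metric to the geodesic equation, including the inversion of a matrix of functions, and
  that suffices for uniqueness of solutions.\<close>

definition lipschitz_near :: "'a::metric_space \<Rightarrow> ('a \<Rightarrow> 'b::metric_space) \<Rightarrow> bool" where
  "lipschitz_near z f \<longleftrightarrow> (\<exists>e>0. \<exists>C. C-lipschitz_on (ball z e) f)"

lemma lipschitz_near_common:
  assumes "lipschitz_near z f" "lipschitz_near z g"
  obtains e C D where "e > 0" "C-lipschitz_on (ball z e) f" "D-lipschitz_on (ball z e) g"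
proof -
  obtain d e C D where *: "d > 0" "e > 0" "C-lipschitz_on (ball z d) f" "D-lipschitz_on (ball z e) g"
    using assms by (auto simp: lipschitz_near_def)
  have "C-lipschitz_on (ball z (min d e)) f" "D-lipschitz_on (ball z (min d e)) g"
    using lipschitz_on_subset[OF *(3) subset_ball[of "min d e" d]]
      lipschitz_on_subset[OF *(4) subset_ball[of "min d e" e]]
    by auto
  then show ?thesis using that[of "min d e" C D] * by auto
qed

lemma lipschitz_near_const: "lipschitz_near z (\<lambda>_. c)"
  unfolding lipschitz_near_def by (rule exI[of _ 1]) (auto intro!: exI lipschitz_on_constant)

lemma lipschitz_near_linear:
  assumes "bounded_linear f" shows "lipschitz_near z f"
proof -
  obtain K where "K-lipschitz_on UNIV f" using bounded_linear.lipschitz_boundE[OF assms] by blast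
  then show ?thesis unfolding lipschitz_near_def
    by (meson lipschitz_on_subset subset_UNIV zero_less_one)
qed

lemma lipschitz_near_add:
  fixes f g :: "'a::metric_space \<Rightarrow> 'b::real_normed_vector"
  assumes "lipschitz_near z f" "lipschitz_near z g"
  shows "lipschitz_near z (\<lambda>x. f x + g x)"
  using lipschitz_near_common[OF assms] unfolding lipschitz_near_def by (metis lipschitz_on_add)

lemma lipschitz_near_minus:
  fixes f :: "'a::metric_space \<Rightarrow> 'b::real_normed_vector"
  assumes "lipschitz_near z f"
  shows "lipschitz_near z (\<lambda>x. - f x)"
  using assms unfolding lipschitz_near_def by (metis lipschitz_on_minus)

lemma lipschitz_near_sum:
  fixes f :: "'i \<Rightarrow> 'a::metric_space \<Rightarrow> 'b::real_normed_vector"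
  assumes "\<And>i. i \<in> I \<Longrightarrow> lipschitz_near z (f i)"
  shows "lipschitz_near z (\<lambda>x. \<Sum>i\<in>I. f i x)"
  using assms by (induction I rule: infinite_finite_induct) (auto intro: lipschitz_near_const lipschitz_near_add)

text \<open>Near \<open>z\<close> both factors are bounded, so the increment of the product is bounded by splitting it as
  \<open>p (f x) (g x - g y) + p (f x - f y) (g y)\<close>.\<close>

lemma lipschitz_near_bilinear:
  fixes f :: "'a::metric_space \<Rightarrow> 'b::real_normed_vector" and g :: "'a \<Rightarrow> 'c::real_normed_vector"
    and p :: "'b \<Rightarrow> 'c \<Rightarrow> 'd::real_normed_vector"
  assumes p: "bounded_bilinear p" and "lipschitz_near z f" "lipschitz_near z g"
  shows "lipschitz_near z (\<lambda>x. p (f x) (g x))"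
proof -
  interpret bounded_bilinear p by fact
  obtain e C D where e: "e > 0" "C-lipschitz_on (ball z e) f" "D-lipschitz_on (ball z e) g"
    using lipschitz_near_common[OF assms(2,3)] .
  obtain K where K: "K \<ge> 0" "\<And>a b. norm (p a b) \<le> norm a * norm b * K" using nonneg_bounded by blast
  have C0: "C \<ge> 0" "D \<ge> 0" using e lipschitz_on_nonneg by blast+
  define F where "F = norm (f z) + C * e"
  define G where "G = norm (g z) + D * e"
  have F: "norm (f x) \<le> F" if "x \<in> ball z e" for x
  proof -
    have "dist (f x) (f z) \<le> C * dist x z" using lipschitz_onD[OF e(2) that] e by simp
    also have "\<dots> \<le> C * e" using that C0 by (intro mult_left_mono) (auto simp: dist_commute)
    finally show ?thesis unfolding F_def dist_norm using norm_triangle_sub[of "f x" "f z"] by simp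
  qed
  have G: "norm (g x) \<le> G" if "x \<in> ball z e" for x
  proof -
    have "dist (g x) (g z) \<le> D * dist x z" using lipschitz_onD[OF e(3) that] e by simp
    also have "\<dots> \<le> D * e" using that C0 by (intro mult_left_mono) (auto simp: dist_commute)
    finally show ?thesis unfolding G_def dist_norm using norm_triangle_sub[of "g x" "g z"] by simp
  qed
  have FG: "F \<ge> 0" "G \<ge> 0" using C0 e by (auto simp: F_def G_def)
  have "((F * D + C * G) * K)-lipschitz_on (ball z e) (\<lambda>x. p (f x) (g x))"
  proof (rule lipschitz_onI)
    fix x y assume xy: "x \<in> ball z e" "y \<in> ball z e"
    have "dist (p (f x) (g x)) (p (f y) (g y)) = norm (p (f x) (g x - g y) + p (f x - f y) (g y))"
      by (simp add: dist_norm diff_left diff_right)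
    also have "\<dots> \<le> norm (f x) * norm (g x - g y) * K + norm (f x - f y) * norm (g y) * K"
      by (intro norm_triangle_le add_mono K)
    also have "\<dots> \<le> F * (D * dist x y) * K + (C * dist x y) * G * K"
      using lipschitz_onD[OF e(2) xy] lipschitz_onD[OF e(3) xy] F[OF xy(1)] G[OF xy(2)] K C0 FG
      by (intro add_mono mult_right_mono mult_mono) (auto simp: dist_norm)
    finally show "dist (p (f x) (g x)) (p (f y) (g y)) \<le> ((F * D + C * G) * K) * dist x y"
      by (simp add: algebra_simps)
  qed (use C0 FG K in auto)
  then show ?thesis using e unfolding lipschitz_near_def by blast
qed

lemma lipschitz_near_compose:
  assumes "lipschitz_near z f" "lipschitz_near (f z) g"
  shows "lipschitz_near z (\<lambda>x. g (f x))"
proof -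
  obtain d C where d: "d > 0" "C-lipschitz_on (ball z d) f" using assms by (auto simp: lipschitz_near_def)
  obtain e D where e: "e > 0" "D-lipschitz_on (ball (f z) e) g" using assms by (auto simp: lipschitz_near_def)
  have C0: "C \<ge> 0" using d lipschitz_on_nonneg by blast
  define r where "r = min d (e / (C + 1))"
  have r: "r > 0" "r \<le> d" using d e C0 by (auto simp: r_def)
  have "f ` ball z r \<subseteq> ball (f z) e"
  proof (intro image_subsetI)
    fix x assume x: "x \<in> ball z r"
    have "dist (f x) (f z) \<le> C * dist x z" using lipschitz_onD[OF d(2), of x z] x r d by auto
    also have "\<dots> \<le> (C + 1) * dist x z" by (simp add: mult_right_mono)
    also have "\<dots> < (C + 1) * (e / (C + 1))"
      using x C0 by (intro mult_strict_left_mono) (auto simp: r_def dist_commute)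
    finally show "f x \<in> ball (f z) e" using C0 by (simp add: dist_commute)
  qed
  then have "(D * C)-lipschitz_on (ball z r) (\<lambda>x. g (f x))"
    using lipschitz_on_compose2[of C "ball z r" f D g] d(2) e(2) r lipschitz_on_subset
    by (metis subset_ball)
  then show ?thesis using r unfolding lipschitz_near_def by blast
qed

text \<open>On a small closed ball the partial derivatives are bounded by compactness, hence so is the
  operator norm of the derivative, and the mean value inequality applies.\<close>

lemma Ck_on_1_lipschitz_near:
  fixes f :: "'a::euclidean_space \<Rightarrow> 'b::real_normed_vector"
  assumes "Ck_on 1 f U" "open U" "z \<in> U"
  shows "lipschitz_near z f"
proof -
  let ?f' = "\<lambda>x. frechet_derivative f (at x)"
  have c: "continuous_on U (\<lambda>x. \<Sum>b\<in>Basis. norm (?f' x b))"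
    using Ck_on_1_continuous_frechet[OF assms(1)] by (intro continuous_intros)
  obtain e0 where e0: "e0 > 0" "cball z e0 \<subseteq> U" using assms open_contains_cball by blast
  then have "compact ((\<lambda>x. \<Sum>b\<in>Basis. norm (?f' x b)) ` cball z e0)"
    using c continuous_on_subset by (intro compact_continuous_image) auto
  then have "bdd_above ((\<lambda>x. \<Sum>b\<in>Basis. norm (?f' x b)) ` cball z e0)"
    by (intro bounded_imp_bdd_above compact_imp_bounded)
  then obtain C where C: "\<forall>x\<in>cball z e0. (\<Sum>b\<in>Basis. norm (?f' x b)) \<le> C"
    unfolding bdd_above_def by auto
  have "0 \<le> (\<Sum>b\<in>Basis. norm (?f' z b))" by (intro sum_nonneg) auto
  also have "\<dots> \<le> C" using C e0 by auto
  finally have C0: "C \<ge> 0" .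
  have on: "norm (?f' x v) \<le> C * norm v" if x: "x \<in> ball z e0" for x v
  proof -
    have lin: "linear (?f' x)" using e0(2) x assms Ck_on_frechet(2)[of 0 f U x] mem_ball_imp_mem_cball[OF x]
      by (intro linear_frechet_derivative) (metis One_nat_def subsetD)
    have "?f' x v = ?f' x (\<Sum>b\<in>Basis. (v \<bullet> b) *\<^sub>R b)" by (simp add: euclidean_representation)
    also have "\<dots> = (\<Sum>b\<in>Basis. (v \<bullet> b) *\<^sub>R ?f' x b)"
      by (simp add: linear_sum[OF lin] linear_scale[OF lin])
    also have "norm \<dots> \<le> (\<Sum>b\<in>Basis. norm v * norm (?f' x b))"
      by (intro sum_norm_le) (simp add: mult_right_mono Basis_le_norm)
    also have "\<dots> = norm v * (\<Sum>b\<in>Basis. norm (?f' x b))" by (simp add: sum_distrib_left)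
    also have "\<dots> \<le> norm v * C" using C x by (intro mult_left_mono) auto
    finally show ?thesis by (simp add: mult.commute)
  qed
  have "norm (f x - f y) \<le> C * norm (x - y)" if "x \<in> ball z e0" "y \<in> ball z e0" for x y
  proof (rule differentiable_bound[of "ball z e0" f ?f'])
    fix w assume w: "w \<in> ball z e0"
    then show "(f has_derivative ?f' w) (at w within ball z e0)"
      using Ck_on_frechet(1)[of 0 f U w] assms(1) e0 has_derivative_at_withinI by (auto simp: subset_iff)
    show "onorm (?f' w) \<le> C" using on[OF w] C0 by (intro onorm_bound) auto
  qed (use that in auto)
  with C0 have "C-lipschitz_on (ball z e0) f" by (intro lipschitz_onI) (auto simp: dist_norm)
  then show ?thesis using e0 unfolding lipschitz_near_def by blast
qed

lemma lipschitz_near_imp_isCont: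
  assumes "lipschitz_near z f" shows "isCont f z"
  using assms unfolding lipschitz_near_def
  by (metis at_within_open centre_in_ball lipschitz_on_continuous_within open_ball)

lemma bounded_bilinear_matrix_vector:
  "bounded_bilinear ((*v) :: real^'n^'m \<Rightarrow> real^'n \<Rightarrow> real^'m)"
  unfolding bilinear_conv_bounded_bilinear[symmetric] bilinear_def
  by (auto intro!: linearI simp: matrix_vector_mult_add_rdistrib matrix_vector_right_distrib
      matrix_vector_mult_scaleR matrix_scaleR_vector_ac scaleR_matrix_vector_assoc)

lemma lipschitz_near_cart:
  fixes f :: "'a::metric_space \<Rightarrow> 'b::euclidean_space^'n"
  assumes "\<And>i. lipschitz_near z (\<lambda>x. f x $ i)"
  shows "lipschitz_near z f"
proof -
  have lin: "bounded_linear (axis i :: 'b \<Rightarrow> 'b^'n)" for i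
    by (subst linear_conv_bounded_linear[symmetric], rule linearI)
       (auto simp: axis_def vec_eq_iff)
  have "lipschitz_near z (\<lambda>x. \<Sum>i\<in>UNIV. axis i (f x $ i))"
    by (intro lipschitz_near_sum lipschitz_near_compose[OF assms] lipschitz_near_linear lin)
  moreover have "(\<lambda>x. \<Sum>i\<in>UNIV. axis i (f x $ i)) = f"
    by (auto simp: vec_eq_iff axis_def if_distrib cong: if_cong)
  ultimately show ?thesis by simp
qed

text \<open>Solutions of a regular linear system inherit the Lipschitz property of its coefficients. This is
  the step from the metric to its inverse matrix in the Christoffel symbols: subtracting the equations
  at \<open>x\<close> and \<open>y\<close> gives \<open>G x (w x - w y) = (b x - b y) - (G x - G y) w y\<close>, and \<open>G x\<close> stays uniformly
  injective for \<open>x\<close> close to \<open>z\<close>.\<close>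

lemma lipschitz_near_solution:
  fixes G :: "'a::metric_space \<Rightarrow> real^'n^'n"
  assumes G: "lipschitz_near z G" and b: "lipschitz_near z b"
    and eq: "\<forall>\<^sub>F x in nhds z. G x *v w x = b x" and inj: "\<And>u. G z *v u = 0 \<Longrightarrow> u = 0"
  shows "lipschitz_near z w"
proof -
  interpret mv: bounded_bilinear "(*v) :: real^'n^'n \<Rightarrow> real^'n \<Rightarrow> real^'n"
    by (rule bounded_bilinear_matrix_vector)
  obtain K where K: "K > 0" "\<And>A u. norm (A *v u :: real^'n) \<le> norm (A :: real^'n^'n) * norm u * K"
    using mv.pos_bounded by blast
  have "inj ((*v) (G z))"
  proof (rule injI)
    fix x y assume "G z *v x = G z *v y"
    then have "G z *v (x - y) = 0" by (simp add: mv.diff_right)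
    then show "x = y" using inj[of "x - y"] by simp
  qed
  then obtain m where m: "m > 0" "\<And>u. m * norm u \<le> norm (G z *v u)"
    using linear_inj_bounded_below_pos[of "(*v) (G z)"] by auto
  obtain d C D where d: "d > 0" "C-lipschitz_on (ball z d) G" "D-lipschitz_on (ball z d) b"
    using lipschitz_near_common[OF G b] .
  have C0: "C \<ge> 0" "D \<ge> 0" using d lipschitz_on_nonneg by blast+
  obtain e1 where e1: "e1 > 0" "\<And>x. dist x z < e1 \<Longrightarrow> G x *v w x = b x"
    using eq unfolding eventually_nhds_metric by blast
  \<comment> \<open>within distance \<open>c\<close> of \<open>z\<close>, the perturbation \<open>G x - G z\<close> costs
  at most half of the lower bound \<open>m\<close>\<close>
  define c where "c = m / (2 * K * (C + 1))"
  define e where "e = min (min d e1) (min c 1)"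
  have c: "c > 0" using m K C0 by (simp add: c_def)
  then have e: "e > 0" "e \<le> d" "e \<le> e1" "e \<le> c" "e \<le> 1" using d e1 by (auto simp: e_def)
  have low: "m / 2 * norm u \<le> norm (G x *v u)" if x: "x \<in> ball z e" for x u
  proof -
    have "norm (G x - G z) \<le> C * dist x z"
      using lipschitz_onD[OF d(2), of x z] x e d by (simp add: dist_norm)
    also have "\<dots> \<le> (C + 1) * c" using x e C0 by (intro mult_mono) (auto simp: dist_commute)
    finally have "norm (G x - G z) * norm u * K \<le> ((C + 1) * c) * norm u * K"
      using K by (intro mult_right_mono) auto
    also have "\<dots> = m / 2 * norm u" using K C0 by (simp add: c_def)
    finally have "norm ((G x - G z) *v u) \<le> m / 2 * norm u" using K(2)[of "G x - G z" u] by linarith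
    moreover have "m * norm u \<le> norm (G x *v u) + norm ((G x - G z) *v u)"
      using m(2)[of u] norm_triangle_ineq4[of "G x *v u" "(G x - G z) *v u"] by (simp add: mv.diff_left)
    ultimately show ?thesis by simp
  qed
  define W where "W = (norm (b z) + D) / (m / 2)"
  have W: "norm (w x) \<le> W" if x: "x \<in> ball z e" for x
  proof -
    have "norm (b x) \<le> norm (b z) + norm (b x - b z)" by (rule norm_triangle_sub)
    also have "norm (b x - b z) \<le> D * dist x z"
      using lipschitz_onD[OF d(3), of x z] x e d by (simp add: dist_norm)
    also have "\<dots> \<le> D * 1" using x e C0 by (intro mult_left_mono) (auto simp: dist_commute)
    finally have "norm (b x) \<le> norm (b z) + D" by simp
    then have "m / 2 * norm (w x) \<le> norm (b z) + D"
      using low[OF x, of "w x"] e1(2)[of x] x e by (auto simp: dist_commute)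
    then show ?thesis using m by (simp add: W_def field_simps)
  qed
  have W0: "W \<ge> 0" using m C0 by (simp add: W_def)
  have "((D + C * W * K) / (m / 2))-lipschitz_on (ball z e) w"
  proof (rule lipschitz_onI)
    fix x y assume xy: "x \<in> ball z e" "y \<in> ball z e"
    have eqs: "G x *v w x = b x" "G y *v w y = b y" using e1(2) xy e by (auto simp: dist_commute)
    have "m / 2 * dist (w x) (w y) \<le> norm (G x *v (w x - w y))" using low[OF xy(1)] by (simp add: dist_norm)
    also have "G x *v (w x - w y) = (b x - b y) - (G x - G y) *v w y"
      by (simp add: mv.diff_left mv.diff_right eqs)
    also have "norm \<dots> \<le> norm (b x - b y) + norm ((G x - G y) *v w y)" by (rule norm_triangle_ineq4)
    also have "\<dots> \<le> D * dist x y + (C * dist x y) * W * K"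
    proof (intro add_mono order_trans[OF K(2)] mult_right_mono mult_mono)
      show "norm (b x - b y) \<le> D * dist x y" "norm (G x - G y) \<le> C * dist x y"
        using lipschitz_onD[OF d(2), of x y] lipschitz_onD[OF d(3), of x y] xy e by (auto simp: dist_norm)
    qed (use W xy C0 K in auto)
    finally have "m / 2 * dist (w x) (w y) \<le> (D + C * W * K) * dist x y" by (simp add: algebra_simps)
    then show "dist (w x) (w y) \<le> ((D + C * W * K) / (m / 2)) * dist x y"
      using m by (simp add: field_simps)
  qed (use C0 W0 K m in simp)
  then show ?thesis using e unfolding lipschitz_near_def by blast
qed

lemma lipschitz_near_cong:
  assumes "lipschitz_near z f" "\<forall>\<^sub>F x in nhds z. f x = h x"
  shows "lipschitz_near z h"
proof -
  obtain d C where d: "d > 0" "C-lipschitz_on (ball z d) f" using assms by (auto simp: lipschitz_near_def)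
  obtain e where e: "e > 0" "\<And>x. dist x z < e \<Longrightarrow> f x = h x"
    using assms(2) unfolding eventually_nhds_metric by blast
  have "C-lipschitz_on (ball z (min d e)) f" using d(2) by (rule lipschitz_on_subset) auto
  then have "C-lipschitz_on (ball z (min d e)) h"
    by (rule lipschitz_on_transform) (auto simp: e(2) dist_commute)
  then show ?thesis using d e unfolding lipschitz_near_def by (intro exI[of _ "min d e"]) auto
qed

lemma lipschitz_near_Pair:
  assumes "lipschitz_near z f" "lipschitz_near z h"
  shows "lipschitz_near z (\<lambda>x. (f x, h x))"
  using lipschitz_near_common[OF assms] unfolding lipschitz_near_def by (metis lipschitz_on_Pair)

text \<open>A curve that runs in the image of an immersion has its velocity in the image of the derivative,
  even when its lift \<open>y\<close> to the parameter space is only known to be continuous. Injectivity of \<open>F'\<close>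
  bounds the increments of \<open>y\<close> linearly in \<open>t\<close>, so \<open>w\<close> is a limit of vectors
  \<open>F' ((y t - y 0) / t)\<close>, and the range of \<open>F'\<close> is closed.\<close>

lemma derivative_in_range:
  fixes F :: "'a::euclidean_space \<Rightarrow> 'b::euclidean_space" and y :: "real \<Rightarrow> 'a"
  assumes F: "(F has_derivative F') (at (y 0))" and inj: "inj F'" and y: "isCont y 0"
    and d: "((\<lambda>t. F (y t)) has_vector_derivative w) (at 0)"
  shows "w \<in> range F'"
proof -
  have lin: "linear F'" using F has_derivative_linear by blast
  obtain m where m: "m > 0" "\<And>h. m * norm h \<le> norm (F' h)"
    using linear_inj_bounded_below_pos[OF lin inj] by blast
  define h where "h t = y t - y 0" for t
  define D where "D t = F (y t) - F (y 0)" for t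
  have D: "\<forall>\<^sub>F t in at 0. norm (D t - t *\<^sub>R w) \<le> e * norm t" if "e > 0" for e
    using d that unfolding has_vector_derivative_def has_derivative_within_alt2 D_def
    by auto
  have H: "\<forall>\<^sub>F t in at 0. norm (D t - F' (h t)) \<le> e * norm (h t)" if "e > 0" for e
  proof -
    have "\<forall>\<^sub>F x in nhds (y 0). norm (F x - F (y 0) - F' (x - y 0)) \<le> e * norm (x - y 0)"
      using F that unfolding has_derivative_within_alt2 eventually_at_filter
      by (auto elim!: eventually_mono dest!: spec[of _ e] simp: linear_0[OF lin])
    then have "\<forall>\<^sub>F t in at 0. norm (F (y t) - F (y 0) - F' (y t - y 0)) \<le> e * norm (y t - y 0)"
      using y unfolding isCont_def by (rule eventually_compose_filterlim)
    then show ?thesis by (simp add: D_def h_def)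
  qed
  have sub: "subspace (range F')" using lin by (simp add: linear_subspace_image)
  define C where "C = 2 * (norm w + 1) / m"
  have C: "C > 0" using m by (simp add: C_def add_nonneg_pos)
  have "w \<in> closure (range F')"
  proof (subst closure_approachable, intro allI impI)
    fix e :: real assume e: "e > 0"
    \<comment> \<open>\<open>e1\<close> and \<open>e2\<close> are the errors allowed in the derivatives of \<open>t \<mapsto> F (y t)\<close> and of \<open>F\<close>;
    \<open>e2 \<le> m / 2\<close> gives the bound \<open>\<bar>h t\<bar> \<le> C \<bar>t\<bar>\<close>, after which both errors are at most \<open>e \<bar>t\<bar> / 3\<close>\<close>
    define e1 where "e1 = min 1 (e / 3)"
    define e2 where "e2 = min (m / 2) (e / (3 * C))"
    have "e1 > 0" "e2 > 0" using e m C by (auto simp: e1_def e2_def)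
    from eventually_conj[OF D[OF this(1)] H[OF this(2)]]
    have "\<forall>\<^sub>F t in at 0. t \<noteq> 0 \<and> norm (D t - t *\<^sub>R w) \<le> e1 * norm t \<and> norm (D t - F' (h t)) \<le> e2 * norm (h t)"
      by (simp add: eventually_at_filter eventually_conj_iff)
    then obtain t :: real where t: "t \<noteq> 0" "norm (D t - t *\<^sub>R w) \<le> e1 * norm t" "norm (D t - F' (h t)) \<le> e2 * norm (h t)"
      using eventually_happens'[OF at_neq_bot] by blast
    have "m * norm (h t) \<le> norm (F' (h t))" by (rule m)
    also have "\<dots> \<le> norm (D t) + e2 * norm (h t)" using t(3) norm_triangle_sub[of "F' (h t)" "D t"]
      by (simp add: norm_minus_commute)
    also have "\<dots> \<le> norm (D t) + (m / 2) * norm (h t)" by (intro add_left_mono mult_right_mono) (auto simp: e2_def)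
    finally have "(m / 2) * norm (h t) \<le> norm (D t)" by simp
    also have "\<dots> \<le> norm (t *\<^sub>R w) + norm (D t - t *\<^sub>R w)" by (rule norm_triangle_sub)
    also have "\<dots> \<le> norm (t *\<^sub>R w) + e1 * norm t" using t(2) by simp
    also have "\<dots> \<le> norm (t *\<^sub>R w) + 1 * norm t"
      by (intro add_left_mono mult_right_mono) (auto simp: e1_def)
    also have "\<dots> = (norm w + 1) * norm t" by (simp add: algebra_simps)
    also have "\<dots> = (m / 2) * (C * norm t)" using m by (simp add: C_def)
    finally have h: "norm (h t) \<le> C * norm t" using m mult_le_cancel_left_pos[of "m / 2"] by simp
    have "norm (t *\<^sub>R w - F' (h t)) \<le> norm (D t - t *\<^sub>R w) + norm (D t - F' (h t))"
      using norm_triangle_ineq4[of "D t - F' (h t)" "D t - t *\<^sub>R w"] by simp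
    also have "\<dots> \<le> e / 3 * norm t + e / (3 * C) * (C * norm t)"
    proof (rule add_mono)
      have "e1 * norm t \<le> e / 3 * norm t" by (intro mult_right_mono) (auto simp: e1_def)
      then show "norm (D t - t *\<^sub>R w) \<le> e / 3 * norm t" using t(2) by linarith
      have "e2 * norm (h t) \<le> e / (3 * C) * (C * norm t)"
        using h C e by (intro mult_mono) (auto simp: e2_def)
      then show "norm (D t - F' (h t)) \<le> e / (3 * C) * (C * norm t)" using t(3) by linarith
    qed
    also have "\<dots> = (2 * e / 3) * norm t" using C by simp
    also have "\<dots> < e * norm t" using t(1) e by simp
    finally have *: "norm (t *\<^sub>R w - F' (h t)) < e * norm t" .
    have "F' ((1 / t) *\<^sub>R h t) - w = - ((1 / t) *\<^sub>R (t *\<^sub>R w - F' (h t)))"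
      using t(1) by (simp add: linear_scale[OF lin] scaleR_diff_right)
    then have "norm (F' ((1 / t) *\<^sub>R h t) - w) = norm (t *\<^sub>R w - F' (h t)) / norm t" by simp
    also have "\<dots> < e" using * t(1) by (simp add: pos_divide_less_eq)
    finally show "\<exists>v\<in>range F'. dist v w < e" by (auto simp: dist_norm)
  qed
  then show ?thesis using closed_subspace[OF sub] by simp
qed

section \<open>Propagation of identities along intervals\<close>

text \<open>With \<open>u = \<bar>y\<bar>\<^sup>2\<close> the bound gives \<open>\<bar>u'\<bar> \<le> 2 C u\<close>, so \<open>u\<close> times a suitable exponential is monotone on
  either side of the zero \<open>t0\<close>; as \<open>u \<ge> 0\<close>, it vanishes.\<close>

lemma gronwall_zero:
  fixes y :: "real \<Rightarrow> 'a::real_inner"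
  assumes d: "\<And>t. t \<in> {a<..<b} \<Longrightarrow> (y has_vector_derivative y' t) (at t)"
    and le: "\<And>t. t \<in> {a<..<b} \<Longrightarrow> norm (y' t) \<le> C * norm (y t)"
    and t0: "t0 \<in> {a<..<b}" "y t0 = 0" and t: "t \<in> {a<..<b}"
  shows "y t = 0"
proof -
  define u where "u s = y s \<bullet> y s" for s
  have u: "(u has_real_derivative 2 * (y s \<bullet> y' s)) (at s)" if "s \<in> {a<..<b}" for s
  proof -
    have "((\<lambda>s. y s \<bullet> y s) has_derivative (\<lambda>h. y s \<bullet> (h *\<^sub>R y' s) + (h *\<^sub>R y' s) \<bullet> y s)) (at s)"
      using d[OF that] unfolding has_vector_derivative_def by (intro has_derivative_inner)
    then show ?thesis unfolding u_def has_field_derivative_def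
      by (rule has_derivative_eq_rhs) (auto simp: inner_commute fun_eq_iff)
  qed
  have bnd: "\<bar>y s \<bullet> y' s\<bar> \<le> C * u s" if "s \<in> {a<..<b}" for s
  proof -
    have "\<bar>y s \<bullet> y' s\<bar> \<le> norm (y s) * norm (y' s)" by (rule Cauchy_Schwarz_ineq2)
    also have "\<dots> \<le> norm (y s) * (C * norm (y s))" using le[OF that] by (intro mult_left_mono) auto
    finally show ?thesis by (simp add: u_def dot_square_norm power2_eq_square mult_ac)
  qed
  have "u t \<le> 0"
  proof (cases "t0 \<le> t")
    case True
    have "u t * exp (- (2 * C) * t) \<le> u t0 * exp (- (2 * C) * t0)"
    proof (rule DERIV_nonpos_imp_nonincreasing[OF True])
      fix s assume "t0 \<le> s" "s \<le> t"
      then have s: "s \<in> {a<..<b}" using t0 t by auto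
      have "((\<lambda>s. u s * exp (- (2 * C) * s)) has_real_derivative
          (2 * (y s \<bullet> y' s) - 2 * C * u s) * exp (- (2 * C) * s)) (at s)"
        by (rule derivative_eq_intros u[OF s] refl)+ (simp add: algebra_simps)
      moreover have "(2 * (y s \<bullet> y' s) - 2 * C * u s) * exp (- (2 * C) * s) \<le> 0"
        using bnd[OF s] by (intro mult_nonpos_nonneg) auto
      ultimately show "\<exists>y. ((\<lambda>s. u s * exp (- (2 * C) * s)) has_real_derivative y) (at s) \<and> y \<le> 0" by blast
    qed
    then have "u t * exp (- (2 * C) * t) \<le> 0" using t0 by (simp add: u_def)
    then show ?thesis by (simp add: mult_le_0_iff)
  next
    case False
    then have True: "t \<le> t0" by simp
    have "u t * exp (2 * C * t) \<le> u t0 * exp (2 * C * t0)"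
    proof (rule DERIV_nonneg_imp_nondecreasing[OF True])
      fix s assume "t \<le> s" "s \<le> t0"
      then have s: "s \<in> {a<..<b}" using t0 t by auto
      have "((\<lambda>s. u s * exp (2 * C * s)) has_real_derivative
          (2 * (y s \<bullet> y' s) + 2 * C * u s) * exp (2 * C * s)) (at s)"
        by (rule derivative_eq_intros u[OF s] refl)+ (simp add: algebra_simps)
      moreover have "(2 * (y s \<bullet> y' s) + 2 * C * u s) * exp (2 * C * s) \<ge> 0"
        using bnd[OF s] by (intro mult_nonneg_nonneg) auto
      ultimately show "\<exists>y. ((\<lambda>s. u s * exp (2 * C * s)) has_real_derivative y) (at s) \<and> y \<ge> 0" by blast
    qed
    then have "u t * exp (2 * C * t) \<le> 0" using t0 by (simp add: u_def)
    then show ?thesis by (simp add: mult_le_0_iff)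
  qed
  then show ?thesis unfolding u_def by (metis inner_eq_zero_iff inner_ge_zero order_antisym)
qed

text \<open>Connectedness of an interval in the form used below: a property that is both open and closed
  spreads from one point to the whole interval.\<close>

lemma interval_continuation:
  fixes I :: "real set"
  assumes I: "open I" "is_interval I" and t0: "t0 \<in> I" "P t0"
    and op: "\<And>t. t \<in> I \<Longrightarrow> P t \<Longrightarrow> \<forall>\<^sub>F s in nhds t. P s"
    and cl: "\<And>t. t \<in> I \<Longrightarrow> \<not> P t \<Longrightarrow> \<forall>\<^sub>F s in nhds t. \<not> P s"
    and t: "t \<in> I"
  shows "P t"
proof -
  define A where "A = {t\<in>I. P t}"
  define B where "B = {t\<in>I. \<not> P t}"
  have "open A" unfolding open_subopen[of A]
  proof
    fix x assume "x \<in> A"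
    then obtain T where "open T" "x \<in> T" "\<forall>s\<in>T. P s"
      using op[of x] unfolding eventually_nhds A_def by auto
    then show "\<exists>T. open T \<and> x \<in> T \<and> T \<subseteq> A" using \<open>x \<in> A\<close> I
      by (intro exI[of _ "T \<inter> I"]) (auto simp: A_def)
  qed
  moreover have "open B" unfolding open_subopen[of B]
  proof
    fix x assume "x \<in> B"
    then obtain T where "open T" "x \<in> T" "\<forall>s\<in>T. \<not> P s"
      using cl[of x] unfolding eventually_nhds B_def by auto
    then show "\<exists>T. open T \<and> x \<in> T \<and> T \<subseteq> B" using \<open>x \<in> B\<close> I
      by (intro exI[of _ "T \<inter> I"]) (auto simp: B_def)
  qed
  moreover have "connected I" using I is_interval_connected by blast
  moreover have "I \<subseteq> A \<union> B" "A \<inter> B \<inter> I = {}" "A \<inter> I \<noteq> {}" using t0 by (auto simp: A_def B_def)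
  ultimately have "B \<inter> I = {}" by (metis connectedD)
  then show ?thesis using t by (auto simp: B_def)
qed

section \<open>Bilinear forms and determinants\<close>

text \<open>In a Lorentzian vector space of dimension \<open>m + 2\<close>, a null direction \<open>l\<close> orthogonal to a spacelike
  subspace of dimension \<open>m\<close> has exactly one null partner \<open>k\<close> with \<open>B k l = - 1\<close>. The subspace together
  with \<open>k\<close> and \<open>l\<close> spans everything, so a second candidate differs from \<open>k\<close> by a multiple of \<open>l\<close>, and
  the condition of being null kills this multiple.\<close>

lemma null_normal_unique:
  fixes B :: "'a::euclidean_space \<Rightarrow> 'a \<Rightarrow> real" and F :: "'b::euclidean_space \<Rightarrow> 'a"
  assumes B: "bilinear B" and sym: "\<And>u v. B u v = B v u"
    and nondeg: "\<And>u. (\<And>v. B u v = 0) \<Longrightarrow> u = 0"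
    and F: "linear F" and dim: "DIM('b) + 2 = DIM('a)"
    and pos: "\<And>u. u \<noteq> 0 \<Longrightarrow> B (F u) (F u) > 0"
    and l: "\<And>u. B l (F u) = 0" "B l l = 0"
    and k: "\<And>u. B k (F u) = 0" "B k l = - 1" "B k k = 0"
    and k': "\<And>u. B k' (F u) = 0" "B k' l = - 1" "B k' k' = 0"
  shows "k' = k"
proof -
  note bil = bilinear_ladd[OF B] bilinear_radd[OF B] bilinear_lmul[OF B] bilinear_rmul[OF B]
     bilinear_lsub[OF B] bilinear_rsub[OF B]
  define \<Phi> where "\<Phi> = (\<lambda>(u::'b, s::real, t::real). F u + s *\<^sub>R k + t *\<^sub>R l)"
  have lin: "linear \<Phi>"
    by (rule linearI) (auto simp: \<Phi>_def linear_add[OF F] linear_scale[OF F] algebra_simps)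
  have "inj \<Phi>"
  proof (subst linear_injective_0[OF lin], intro allI impI)
    fix x assume x: "\<Phi> x = 0"
    obtain u s t where xx: "x = (u, s, t)" by (cases x)
    have "B (\<Phi> x) l = - s" "B (\<Phi> x) k = - t"
      by (simp_all add: \<Phi>_def xx bil l k sym[of "F u"] sym[of l k])
    then have "s = 0" "t = 0" using x bilinear_lzero[OF B] by auto
    then have "B (F u) (F u) = 0" using x bilinear_lzero[OF B] by (simp add: \<Phi>_def xx)
    then have "u = 0" using pos[of u] by force
    then show "x = 0" using xx \<open>s = 0\<close> \<open>t = 0\<close> by (simp add: zero_prod_def)
  qed
  then have "dim (range \<Phi>) = DIM('b \<times> real \<times> real)"
    using eucl.dim_image_eq[OF lin, of UNIV] by (simp add: inj_on_subset)
  then have "dim (range \<Phi>) = DIM('a)" using dim by simp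
  moreover have "subspace (range \<Phi>)" using lin by (simp add: linear_subspace_image)
  ultimately have surj: "range \<Phi> = UNIV" by (metis dim_eq_full span_eq_iff)
  define Z where "Z = k' - k"
  have "B (Z + B Z k *\<^sub>R l) v = 0" for v
  proof -
    obtain u s t where "v = F u + s *\<^sub>R k + t *\<^sub>R l" using surj
      by (metis (mono_tags, lifting) \<Phi>_def case_prod_conv rangeE surj_pair UNIV_I)
    then show ?thesis by (simp add: Z_def bil l k k' sym[of l k])
  qed
  then have Z: "Z = - (B Z k *\<^sub>R l)" using nondeg[of "Z + B Z k *\<^sub>R l"] by (simp add: eq_neg_iff_add_eq_0)
  define a where "a = B Z k"
  have k'eq: "k' = k - a *\<^sub>R l" using Z by (simp add: Z_def a_def algebra_simps)
  have "B k' k' = 2 * a" unfolding k'eq by (simp add: bil l k sym[of l k])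
  then show ?thesis using k' k'eq by simp
qed

text \<open>The determinant of \<open>M + s a a\<^sup>T\<close> is \<open>det M + s a\<^sup>T adj(M) a\<close>, which is linear in \<open>s\<close> for
  singular \<open>M\<close>. The proof replaces the adjugate by an explicit factorisation: the combination \<open>u\<close> of
  the rows annihilates \<open>M\<close>, so it turns row \<open>k\<close> into a multiple of \<open>s a\<close>, and the other rows can then
  be freed of \<open>s\<close> by row operations.\<close>

lemma det_rank_one_update:
  fixes M :: "real^'n^'n"
  assumes u: "u \<noteq> 0" "u v* M = 0"
  shows "det (\<chi> i j. M $ i $ j + s * (a $ i * a $ j)) = s * det (\<chi> i j. M $ i $ j + a $ i * a $ j)"
proof -
  define X where "X s = (\<chi> i j. M $ i $ j + s * (a $ i * a $ j))" for s
  obtain k where k: "u $ k \<noteq> 0" using u by (auto simp: vec_eq_iff)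
  have uM: "(\<Sum>i\<in>UNIV. u $ i * M $ i $ j) = 0" for j
    using u(2) by (simp add: vector_matrix_mult_def vec_eq_iff mult.commute)
  define c where "c = u \<bullet> a"
  \<comment> \<open>\<open>Q\<close> replaces row \<open>k\<close> by the combination of the rows with coefficients \<open>u\<close>\<close>
  define Q where "Q = (\<chi> i j. if i = k then u $ j else (mat 1 :: real^'n^'n) $ i $ j)"
  have detQ: "det Q = u $ k"
  proof -
    have "transpose Q = (\<chi> i j. if j = k then ((mat 1 :: real^'n^'n) *v u) $ i else (mat 1 :: real^'n^'n) $ i $ j)"
      by (simp add: Q_def transpose_def vec_eq_iff) (auto simp: mat_def)
    then have "det (transpose Q) = u $ k * det (mat 1 :: real^'n^'n)" by (simp only: cramer_lemma)
    then show ?thesis by (simp only: det_transpose det_I mult_1_right)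
  qed
  have QX: "(Q ** X s) $ i $ j = (if i = k then s * c * a $ j else M $ i $ j + s * a $ i * a $ j)" for s i j
  proof (cases "i = k")
    case True
    have "(Q ** X s) $ i $ j = (\<Sum>l\<in>UNIV. u $ l * (M $ l $ j + s * (a $ l * a $ j)))"
      by (simp add: True Q_def X_def matrix_matrix_mult_def)
    also have "\<dots> = (\<Sum>l\<in>UNIV. u $ l * M $ l $ j + s * a $ j * (u $ l * a $ l))"
      by (intro sum.cong) (auto simp: algebra_simps)
    also have "\<dots> = (\<Sum>l\<in>UNIV. u $ l * M $ l $ j) + (\<Sum>l\<in>UNIV. s * a $ j * (u $ l * a $ l))"
      by (rule sum.distrib)
    also have "\<dots> = s * a $ j * c" by (simp add: uM c_def inner_vec_def sum_distrib_left)
    finally show ?thesis using True by simp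
  next
    case False
    then have "(Q ** X s) $ i $ j = (\<Sum>l\<in>UNIV. (if l = i then 1 else 0) * X s $ l $ j)"
      unfolding matrix_matrix_mult_def by (auto simp: Q_def mat_def intro!: sum.cong)
    also have "\<dots> = X s $ i $ j" by (simp add: mult_delta_left)
    finally show ?thesis using False by (simp add: X_def)
  qed
  show ?thesis
  proof (cases "c = 0")
    case True
    have "det (X s) = 0" for s
    proof -
      have "row k (Q ** X s) = 0" by (simp add: row_def vec_eq_iff QX True)
      then have "det (Q ** X s) = 0" by (rule det_zero_row)
      then show ?thesis using detQ k by (simp add: det_mul)
    qed
    from this[of s] this[of 1] show ?thesis by (simp add: X_def)
  next
    case False
    \<comment> \<open>\<open>N\<close> is independent of \<open>s\<close>; \<open>R s\<close> multiplies its row \<open>k\<close> by \<open>s\<close>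
    and adds \<open>s * a $ i / c\<close> times row \<open>k\<close> to row \<open>i\<close>\<close>
    define N where "N = (\<chi> i j. if i = k then c * a $ j else M $ i $ j)"
    define w where "w s = (\<chi> i. if i = k then s else s * a $ i / c)" for s
    define R where "R s = (\<chi> i j. if j = k then w s $ i else (mat 1 :: real^'n^'n) $ i $ j)" for s
    have detR: "det (R s) = s" for s
    proof -
      have "R s = (\<chi> i j. if j = k then ((mat 1 :: real^'n^'n) *v w s) $ i else (mat 1 :: real^'n^'n) $ i $ j)"
        unfolding R_def matrix_vector_mul_lid ..
      then have "det (R s) = w s $ k * det (mat 1 :: real^'n^'n)" by (simp only: cramer_lemma)
      then show ?thesis by (simp add: w_def)
    qed
    have RN: "(R s ** N) $ i $ j = (Q ** X s) $ i $ j" for s i j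
    proof -
      have "(R s ** N) $ i $ j = (\<Sum>l\<in>UNIV. R s $ i $ l * N $ l $ j)" by (simp add: matrix_matrix_mult_def)
      also have "\<dots> = R s $ i $ k * N $ k $ j + (\<Sum>l\<in>UNIV - {k}. R s $ i $ l * N $ l $ j)"
        by (simp add: sum.remove)
      also have "(\<Sum>l\<in>UNIV - {k}. R s $ i $ l * N $ l $ j) = (\<Sum>l\<in>UNIV - {k}. if l = i then M $ i $ j else 0)"
        by (intro sum.cong) (auto simp: R_def N_def mat_def)
      also have "\<dots> = (if i = k then 0 else M $ i $ j)" by auto
      finally show ?thesis using False by (auto simp: QX R_def N_def w_def)
    qed
    have "u $ k * det (X s) = s * det N" for s
    proof -
      have "R s ** N = Q ** X s" by (simp add: vec_eq_iff RN)
      then have "det (R s) * det N = det Q * det (X s)" by (simp only: det_mul[symmetric])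
      then show ?thesis by (simp only: detQ detR)
    qed
    from this[of s] this[of 1] have "u $ k * det (X s) = u $ k * (s * det (X 1))" by simp
    then show ?thesis using k by (simp add: X_def)
  qed
qed

lemma bilinear_cart_expansion:
  fixes B :: "real^'n \<Rightarrow> real^'m \<Rightarrow> 'b::real_vector"
  assumes "bilinear B"
  shows "B u v = (\<Sum>i\<in>UNIV. \<Sum>j\<in>UNIV. (u $ i * v $ j) *\<^sub>R B (axis i 1) (axis j 1))"
proof -
  have e: "u = (\<Sum>i\<in>UNIV. (u $ i) *\<^sub>R axis i 1)" for u :: "real^'k"
    by (simp add: vec_eq_iff axis_def if_distrib cong: if_cong)
  have l: "linear (\<lambda>u. B u v)" for v using assms by (auto simp: bilinear_def)
  have r: "linear (B u)" for u using assms by (auto simp: bilinear_def)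
  have "B u v = (\<Sum>i\<in>UNIV. u $ i *\<^sub>R B (axis i 1) v)"
    by (subst e[of u]) (simp add: linear_sum[OF l] linear_scale[OF l])
  also have "\<dots> = (\<Sum>i\<in>UNIV. u $ i *\<^sub>R (\<Sum>j\<in>UNIV. v $ j *\<^sub>R B (axis i 1) (axis j 1)))"
    by (subst e[of v]) (simp add: linear_sum[OF r] linear_scale[OF r])
  finally show ?thesis by (simp add: scaleR_sum_right)
qed

section \<open>Tangent vectors in charts\<close>

lemma Ck_into_subset: "Ck_into A k f W \<Longrightarrow> open V \<Longrightarrow> V \<subseteq> W \<Longrightarrow> Ck_into A k f V"
  unfolding Ck_into_def by (auto intro: continuous_on_subset Ck_on_subset)

lemma Ck_into_Suc_imp: "Ck_into A (Suc k) f W \<Longrightarrow> Ck_into A k f W"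
  unfolding Ck_into_def using Ck_on_Suc_imp by blast

locale atlas =
  fixes A :: "('m::{t2_space, second_countable_topology}, 'n::finite) chart set"
  assumes smooth: "smooth_atlas A"
begin

lemma
  assumes "c \<in> A"
  shows chart_open: "open (fst c)" and chart_image_open: "open (snd c ` fst c)"
    and chart_homeomorphism: "homeomorphism (fst c) (snd c ` fst c) (snd c) (chart_inv c)"
  using smooth assms by (auto simp: smooth_atlas_def)

lemma chart_inv_chart [simp]: "c \<in> A \<Longrightarrow> p \<in> fst c \<Longrightarrow> chart_inv c (snd c p) = p"
  using chart_homeomorphism by (metis homeomorphism_apply1)

lemma chart_change_differentiable:
  assumes "c \<in> A" "d \<in> A" "p \<in> fst c" "p \<in> fst d"
  shows "(snd d \<circ> chart_inv c) differentiable (at (snd c p))"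
proof -
  have "Ck_on (Suc 0) (snd d \<circ> chart_inv c) (snd c ` (fst c \<inter> fst d))"
    using smooth assms unfolding smooth_atlas_def by blast
  then show ?thesis by (rule Ck_on_frechet(2)) (use assms in auto)
qed

lemma tangent_change:
  assumes "v \<in> tangent_space A p" "c \<in> A" "d \<in> A" "p \<in> fst c" "p \<in> fst d"
  shows "v d = frechet_derivative (snd d \<circ> chart_inv c) (at (snd c p)) (v c)"
  using assms unfolding tangent_space_def by blast

lemma tangent_outside:
  assumes "v \<in> tangent_space A p" "\<not> (d \<in> A \<and> p \<in> fst d)"
  shows "v d = 0"
  using assms unfolding tangent_space_def by blast

text \<open>A tangent vector is the whole family of its components, but one chart determines it.\<close>

lemma tangent_eqI:
  assumes "v \<in> tangent_space A p" "w \<in> tangent_space A p" "c \<in> A" "p \<in> fst c" "v c = w c"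
  shows "v = w"
proof
  fix d show "v d = w d"
    using tangent_change[OF assms(1,3) _ assms(4), of d] tangent_change[OF assms(2,3) _ assms(4), of d]
      tangent_outside[OF assms(1), of d] tangent_outside[OF assms(2), of d] assms(5)
    by (cases "d \<in> A \<and> p \<in> fst d") simp_all
qed

lemma tangent_eq_coord_vec:
  assumes "v \<in> tangent_space A p" "c \<in> A" "p \<in> fst c"
  shows "v = coord_vec A c (snd c p) (v c)"
proof
  fix d show "v d = coord_vec A c (snd c p) (v c) d"
    using tangent_change[OF assms(1,2) _ assms(3), of d] tangent_outside[OF assms(1), of d] assms(2,3)
    unfolding coord_vec_def dmap_def by (cases "d \<in> A \<and> p \<in> fst d") auto
qed

lemma tangent_combination:
  assumes v: "v \<in> tangent_space A p" and w: "w \<in> tangent_space A p"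
  shows "(\<lambda>c. a *\<^sub>R v c + b *\<^sub>R w c) \<in> tangent_space A p"
  unfolding tangent_space_def
proof (intro CollectI conjI ballI allI impI)
  fix c d assume cd: "c \<in> A" "d \<in> A" "p \<in> fst c" "p \<in> fst d"
  let ?F = "frechet_derivative (snd d \<circ> chart_inv c) (at (snd c p))"
  have lin: "linear ?F"
    using chart_change_differentiable[OF cd] by (rule linear_frechet_derivative)
  show "a *\<^sub>R v d + b *\<^sub>R w d = ?F (a *\<^sub>R v c + b *\<^sub>R w c)"
    by (simp only: linear_add[OF lin] linear_scale[OF lin] tangent_change[OF v cd, symmetric]
        tangent_change[OF w cd, symmetric])
next
  fix c assume "c \<notin> A \<or> p \<notin> fst c"
  then show "a *\<^sub>R v c + b *\<^sub>R w c = 0"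
    using tangent_outside[OF v, of c] tangent_outside[OF w, of c] by auto
qed

lemma tangent_tscale: "v \<in> tangent_space A p \<Longrightarrow> tscale a v \<in> tangent_space A p"
  using tangent_combination[of v p v a 0] by (simp add: tscale_def)

lemma dmap_in_tangent_space:
  assumes cont: "isCont f x"
    and diff: "\<And>c. c \<in> A \<Longrightarrow> f x \<in> fst c \<Longrightarrow> (snd c \<circ> f) differentiable (at x)"
  shows "dmap A f x u \<in> tangent_space A (f x)"
  unfolding tangent_space_def
proof (intro CollectI conjI ballI allI impI)
  fix c d assume cd: "c \<in> A" "d \<in> A" "f x \<in> fst c" "f x \<in> fst d"
  have "open (fst c)" using cd chart_open by blast
  then have "\<forall>\<^sub>F y in nhds x. f y \<in> fst c"
    using cont[THEN isCont_tendsto_compose, OF filterlim_ident] cd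
    by (simp add: topological_tendstoD)
  then obtain X where X: "open X" "x \<in> X" "\<And>y. y \<in> X \<Longrightarrow> f y \<in> fst c"
    unfolding eventually_nhds by blast
  have "frechet_derivative (snd d \<circ> f) (at x) = frechet_derivative ((snd d \<circ> chart_inv c) \<circ> (snd c \<circ> f)) (at x)"
    by (rule frechet_derivative_transform_within_open[OF diff X(1,2)]) (use cd X in auto)
  also have "\<dots> = frechet_derivative (snd d \<circ> chart_inv c) (at ((snd c \<circ> f) x)) \<circ> frechet_derivative (snd c \<circ> f) (at x)"
    using chart_change_differentiable[OF cd] diff cd by (intro frechet_derivative_compose) auto
  finally show "dmap A f x u d = frechet_derivative (snd d \<circ> chart_inv c) (at (snd c (f x))) (dmap A f x u c)"
    using cd by (simp add: dmap_def)
qed (auto simp: dmap_def)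

lemma Ck_into_isCont: "Ck_into A k f W \<Longrightarrow> x \<in> W \<Longrightarrow> isCont f x"
  unfolding Ck_into_def using continuous_on_eq_continuous_at by blast

lemma Ck_into_chart: "Ck_into A k f W \<Longrightarrow> c \<in> A \<Longrightarrow> Ck_on k (snd c \<circ> f) (W \<inter> f -` fst c)"
  unfolding Ck_into_def by blast

lemma Ck_into_preimage_open: "Ck_into A k f W \<Longrightarrow> c \<in> A \<Longrightarrow> open (W \<inter> f -` fst c)"
  using continuous_on_open_vimage[of W f] chart_open[of c] unfolding Ck_into_def by (simp add: Int_commute)

lemma Ck_into_differentiable:
  assumes "Ck_into A (Suc k) f W" "x \<in> W" "c \<in> A" "f x \<in> fst c"
  shows "(snd c \<circ> f) differentiable (at x)"
  using Ck_on_frechet(2)[OF Ck_into_chart[OF assms(1,3)], of x] assms by auto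

lemma Ck_into_dmap_tangent:
  assumes "Ck_into A (Suc k) f W" "x \<in> W"
  shows "dmap A f x u \<in> tangent_space A (f x)"
  using assms by (intro dmap_in_tangent_space Ck_into_isCont Ck_into_differentiable) auto

text \<open>The velocity of a curve, read in a chart, is the ordinary derivative of its coordinates.\<close>

lemma curve_chart_derivative:
  assumes "Ck_into A (Suc k) \<gamma> I" "s \<in> I" "c \<in> A" "\<gamma> s \<in> fst c"
  shows "((\<lambda>s. snd c (\<gamma> s)) has_vector_derivative velocity A \<gamma> s c) (at s)"
proof -
  have "(snd c \<circ> \<gamma> has_derivative frechet_derivative (snd c \<circ> \<gamma>) (at s)) (at s)"
    using Ck_into_differentiable[OF assms] by (simp add: frechet_derivative_works)
  moreover from this have "linear (frechet_derivative (snd c \<circ> \<gamma>) (at s))" by (rule has_derivative_linear)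
  then have "frechet_derivative (snd c \<circ> \<gamma>) (at s) = (\<lambda>h. h *\<^sub>R frechet_derivative (snd c \<circ> \<gamma>) (at s) 1)"
    by (metis linear_scale mult.right_neutral real_scaleR_def)
  ultimately show ?thesis unfolding has_vector_derivative_def velocity_def dmap_def o_def
    using assms by (simp add: o_def)
qed

lemma velocity_eqI:
  assumes "c \<in> A" "\<gamma> s \<in> fst c" "((\<lambda>s. snd c (\<gamma> s)) has_vector_derivative v) (at s)"
  shows "velocity A \<gamma> s c = v"
proof -
  have "frechet_derivative (snd c \<circ> \<gamma>) (at s) = (\<lambda>h. h *\<^sub>R v)"
    using frechet_derivative_at[OF assms(3)[unfolded has_vector_derivative_def]] by (simp add: o_def)
  then show ?thesis using assms by (simp add: velocity_def dmap_def)
qed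

lemma velocity_outside: "\<not> (c \<in> A \<and> \<gamma> s \<in> fst c) \<Longrightarrow> velocity A \<gamma> s c = 0"
  by (auto simp: velocity_def dmap_def)

lemma velocity_isCont:
  assumes "Ck_into A 1 \<gamma> I" "s \<in> I" "c \<in> A" "\<gamma> s \<in> fst c"
  shows "isCont (\<lambda>s. velocity A \<gamma> s c) s"
proof -
  let ?I = "I \<inter> \<gamma> -` fst c"
  have "continuous_on ?I (\<lambda>s. frechet_derivative (snd c \<circ> \<gamma>) (at s) 1)"
    using Ck_into_chart[OF assms(1,3)] by (rule Ck_on_1_continuous_frechet)
  then have "continuous_on ?I (\<lambda>s. velocity A \<gamma> s c)"
    by (rule continuous_on_eq) (use assms in \<open>auto simp: velocity_def dmap_def\<close>)
  then show ?thesis using Ck_into_preimage_open[OF assms(1,3)] assms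
    by (simp add: continuous_on_eq_continuous_at)
qed

lemma velocity_tangent: "Ck_into A (Suc k) \<gamma> I \<Longrightarrow> s \<in> I \<Longrightarrow> velocity A \<gamma> s \<in> tangent_space A (\<gamma> s)"
  unfolding velocity_def by (rule Ck_into_dmap_tangent)

lemma curve_eventually_in_chart:
  assumes "Ck_into A k \<gamma> I" "s \<in> I" "c \<in> A" "\<gamma> s \<in> fst c"
  shows "\<forall>\<^sub>F r in nhds s. r \<in> I \<and> \<gamma> r \<in> fst c"
proof -
  have "\<forall>\<^sub>F r in nhds s. r \<in> I \<inter> \<gamma> -` fst c"
    using Ck_into_preimage_open[OF assms(1,3)] assms by (intro eventually_nhds_in_open) auto
  then show ?thesis by simp
qed

lemma Ck_into_carrier: "Ck_into A k f W \<Longrightarrow> x \<in> W \<Longrightarrow> \<exists>c\<in>A. f x \<in> fst c"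
  unfolding Ck_into_def carrier_def by blast

end

section \<open>The Lorentzian metric\<close>

locale lorentzian =
  fixes A :: "('m::{t2_space, second_countable_topology}, 'n::finite) chart set"
    and g :: "('m, 'n) metric"
  assumes lorentzian: "lorentzian_manifold A g"
begin

sublocale atlas A
  using lorentzian by unfold_locales (simp add: lorentzian_manifold_def)

lemma metric_eq_gcomp:
  assumes "v \<in> tangent_space A p" "w \<in> tangent_space A p" "c \<in> A" "p \<in> fst c"
  shows "g p v w = gcomp A g c (snd c p) (v c) (w c)"
  unfolding gcomp_def using assms tangent_eq_coord_vec[of _ p c] by (metis chart_inv_chart)

text \<open>The signature condition, solved for the metric: \<open>h\<close> passes to coordinates in which the metric is
  the Minkowski form. All algebraic properties of the metric below are read off from it.\<close>

lemma minkowski_coordinates: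
  assumes "c \<in> A" "x \<in> snd c ` fst c"
  obtains h :: "real^'n \<Rightarrow> real^'n" and i0 where "linear h" "bij h"
    "\<And>u v. gcomp A g c x u v = (\<Sum>i\<in>UNIV. (if i = i0 then - 1 else 1) * (h u $ i) * (h v $ i))"
proof -
  obtain f :: "real^'n \<Rightarrow> real^'n" and i0 where f: "linear f" "bij f"
    "\<And>u v. gcomp A g c x (f u) (f v) = (\<Sum>i\<in>UNIV. (if i = i0 then - 1 else 1) * (u $ i) * (v $ i))"
    using lorentzian assms unfolding lorentzian_manifold_def by meson
  have "f (inv f u) = u" for u using f(2) by (simp add: bij_is_surj surj_f_inv_f)
  moreover have "linear (inv f)"
    using f(1,2) inj_linear_imp_inv_linear bij_is_inj by blast
  ultimately show ?thesis using that[of "inv f" i0] f(2,3) bij_imp_bij_inv by metis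
qed

lemma bilinear_gcomp:
  assumes "c \<in> A" "x \<in> snd c ` fst c"
  shows "bilinear (gcomp A g c x)"
proof -
  obtain h :: "real^'n \<Rightarrow> real^'n" and i0 where h: "linear h" "bij h"
    "\<And>u v. gcomp A g c x u v = (\<Sum>i\<in>UNIV. (if i = i0 then - 1 else 1) * (h u $ i) * (h v $ i))"
    by (rule minkowski_coordinates[OF assms]) blast
  show ?thesis unfolding bilinear_def h(3)
    by (intro conjI allI linearI)
       (simp_all only: linear_add[OF h(1)] linear_scale[OF h(1)] vector_add_component vector_scaleR_component
          real_scaleR_def distrib_left distrib_right sum.distrib sum_distrib_left mult.assoc mult.left_commute)
qed

lemma gcomp_sym:
  assumes "c \<in> A" "x \<in> snd c ` fst c"
  shows "gcomp A g c x u v = gcomp A g c x v u"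
proof -
  obtain h :: "real^'n \<Rightarrow> real^'n" and i0 where h: "linear h" "bij h"
    "\<And>u v. gcomp A g c x u v = (\<Sum>i\<in>UNIV. (if i = i0 then - 1 else 1) * (h u $ i) * (h v $ i))"
    by (rule minkowski_coordinates[OF assms]) blast
  show ?thesis unfolding h(3) by (intro sum.cong) (simp_all add: mult.commute mult.left_commute)
qed

lemma gcomp_nondegenerate:
  assumes "c \<in> A" "x \<in> snd c ` fst c" "\<And>v. gcomp A g c x u v = 0"
  shows "u = 0"
proof -
  obtain h :: "real^'n \<Rightarrow> real^'n" and i0 where h: "linear h" "bij h"
    "\<And>u v. gcomp A g c x u v = (\<Sum>i\<in>UNIV. (if i = i0 then - 1 else 1) * (h u $ i) * (h v $ i))"
    by (rule minkowski_coordinates[OF assms(1,2)]) blast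
  have "h u $ j = 0" for j
  proof -
    obtain v where v: "h v = axis j 1" using h(2) by (metis bij_pointE)
    have "gcomp A g c x u v = (\<Sum>i\<in>UNIV. if i = j then (if i = i0 then - 1 else 1) * (h u $ i) else 0)"
      unfolding h(3) v by (intro sum.cong) (auto simp: axis_def)
    then show ?thesis using assms(3)[of v] by (auto split: if_splits)
  qed
  then have "h u = h 0" using linear_0[OF h(1)] by (simp add: vec_eq_iff)
  then show ?thesis using h(2) by (metis bij_pointE)
qed

text \<open>The Cauchy-Schwarz inequality for the spatial parts of \<open>u\<close> and \<open>v\<close>.\<close>

lemma orthogonal_to_timelike_is_spacelike:
  assumes "c \<in> A" "x \<in> snd c ` fst c" "gcomp A g c x u u < 0" "gcomp A g c x u v = 0" "v \<noteq> 0"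
  shows "gcomp A g c x v v > 0"
proof -
  obtain h :: "real^'n \<Rightarrow> real^'n" and i0 where h: "linear h" "bij h"
    "\<And>u v. gcomp A g c x u v = (\<Sum>i\<in>UNIV. (if i = i0 then - 1 else 1) * (h u $ i) * (h v $ i))"
    by (rule minkowski_coordinates[OF assms(1,2)]) blast
  define sp where "sp a b = (\<Sum>i\<in>UNIV - {i0}. (h a $ i) * (h b $ i))" for a b
  have split: "gcomp A g c x a b = - (h a $ i0) * (h b $ i0) + sp a b" for a b
    unfolding h(3) sp_def by (subst sum.remove[of _ i0]) (auto intro!: sum.cong)
  have cs: "(sp u v)\<^sup>2 \<le> sp u u * sp v v"
    unfolding sp_def using Cauchy_Schwarz_ineq_sum[of "\<lambda>i. h u $ i" "\<lambda>i. h v $ i" "UNIV - {i0}"]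
    by (simp add: power2_eq_square)
  have nn: "sp v v \<ge> 0" "sp u u \<ge> 0" by (auto simp: sp_def intro!: sum_nonneg)
  have uu: "sp u u < (h u $ i0)\<^sup>2" using assms(3) split[of u u] by (simp add: power2_eq_square)
  have uv: "sp u v = (h u $ i0) * (h v $ i0)" using assms(4) split[of u v] by simp
  have "sp v v \<noteq> 0"
  proof
    assume z: "sp v v = 0"
    then have "\<forall>i\<in>UNIV - {i0}. h v $ i * h v $ i = 0"
      unfolding sp_def by (subst (asm) sum_nonneg_eq_0_iff) auto
    moreover have "h v $ i0 = 0" using cs z uv uu nn by auto
    ultimately have "h v = h 0" using linear_0[OF h(1)] by (auto simp: vec_eq_iff)
    then show False using h(2) assms(5) by (metis bij_pointE)
  qed
  then have "sp v v > 0" using nn by simp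
  then have "sp u u * sp v v < (h u $ i0)\<^sup>2 * sp v v" using uu by simp
  then have "(h u $ i0)\<^sup>2 * (h v $ i0)\<^sup>2 < (h u $ i0)\<^sup>2 * sp v v" using cs uv by (simp add: power_mult_distrib)
  then have "(h v $ i0)\<^sup>2 < sp v v" by (simp add: mult_less_cancel_left)
  then show ?thesis using split[of v v] by (simp add: power2_eq_square)
qed

section \<open>The Levi-Civita connection\<close>

lemma gcomp_C2: "c \<in> A \<Longrightarrow> Ck_on 2 (\<lambda>x. gcomp A g c x u v) (snd c ` fst c)"
  using lorentzian unfolding lorentzian_manifold_def by blast

lemma gcomp_has_derivative:
  assumes "c \<in> A" "x \<in> snd c ` fst c"
  shows "((\<lambda>y. gcomp A g c y u v) has_derivative frechet_derivative (\<lambda>y. gcomp A g c y u v) (at x)) (at x)"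
  using Ck_on_frechet(1)[of 1 "\<lambda>y. gcomp A g c y u v", OF _ assms(2)] gcomp_C2[OF assms(1), of u v]
  by (simp add: numeral_2_eq_2)

lemma frechet_gcomp_eqI:
  assumes "c \<in> A" "x \<in> snd c ` fst c" "(F has_derivative F') (at x)"
    "\<And>y. y \<in> snd c ` fst c \<Longrightarrow> gcomp A g c y u v = F y"
  shows "frechet_derivative (\<lambda>y. gcomp A g c y u v) (at x) = F'"
proof -
  have "((\<lambda>y. gcomp A g c y u v) has_derivative F') (at x)"
    by (rule has_derivative_transform_within_open[OF assms(3) chart_image_open[OF assms(1)] assms(2)])
       (simp add: assms(4))
  then show ?thesis by (rule frechet_derivative_at[symmetric])
qed

text \<open>The formula defines \<open>christoffel\<close> on fixed vectors by differentiating functions of the base point;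
  bilinearity comes from that of the metric at all nearby points.\<close>

lemma christoffel_bilinear:
  assumes c: "c \<in> A" "x \<in> snd c ` fst c"
  shows "bilinear (christoffel A g c x)"
proof -
  define D where "D u v w = frechet_derivative (\<lambda>y. gcomp A g c y v w) (at x) u" for u v w
  have lin: "linear (\<lambda>u. D u v w)" for v w
    using has_derivative_linear[OF gcomp_has_derivative[OF c, of v w]] by (simp add: D_def)
  have D1: "D (u + u') v w = D u v w + D u' v w" "D (a *\<^sub>R u) v w = a * D u v w" for u u' v w a
    using linear_add[OF lin, of u u' v w] linear_scale[OF lin, of a u v w] by auto
  note bil = bilinear_ladd[OF bilinear_gcomp] bilinear_radd[OF bilinear_gcomp]
     bilinear_lmul[OF bilinear_gcomp] bilinear_rmul[OF bilinear_gcomp]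
  have D2: "D u (v + v') w = D u v w + D u v' w" "D u (a *\<^sub>R v) w = a * D u v w" for u v v' w a
    unfolding D_def
    by (subst frechet_gcomp_eqI[OF c has_derivative_add[OF gcomp_has_derivative[OF c] gcomp_has_derivative[OF c]]],
          auto simp: bil c)
       (subst frechet_gcomp_eqI[OF c has_derivative_mult_right[OF gcomp_has_derivative[OF c]]],
          auto simp: bil c)
  have D3: "D u v (w + w') = D u v w + D u v w'" "D u v (a *\<^sub>R w) = a * D u v w" for u v w w' a
    unfolding D_def
    by (subst frechet_gcomp_eqI[OF c has_derivative_add[OF gcomp_has_derivative[OF c] gcomp_has_derivative[OF c]]],
          auto simp: bil c)
       (subst frechet_gcomp_eqI[OF c has_derivative_mult_right[OF gcomp_has_derivative[OF c]]],
          auto simp: bil c)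
  define G where "G = matrix_inv (\<chi> k l. gcomp A g c x (axis k 1) (axis l 1))"
  define b where "b u v = (\<chi> l. (D u v (axis l 1) + D v u (axis l 1) - D (axis l 1) u v) / 2)" for u v
  have chr: "christoffel A g c x u v = G *v b u v" for u v
    by (simp add: christoffel_def G_def b_def D_def)
  have b1: "b (u + u') v = b u v + b u' v" "b u (v + v') = b u v + b u v'"
    "b (a *\<^sub>R u) v = a *\<^sub>R b u v" "b u (a *\<^sub>R v) = a *\<^sub>R b u v" for u v u' v' a
    by (simp_all add: b_def vec_eq_iff D1 D2 D3 field_simps)
  have "christoffel A g c x = (\<lambda>u v. G *v b u v)" using chr by (intro ext)
  then show ?thesis
    unfolding bilinear_def
    by (auto intro!: linearI simp: b1 matrix_vector_right_distrib matrix_vector_mult_scaleR)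
qed

lemma gram_matrix_mult:
  assumes "c \<in> A" "x \<in> snd c ` fst c"
  shows "((\<chi> k l. gcomp A g c x (axis k 1) (axis l 1)) *v u) $ k = gcomp A g c x (axis k 1) u"
proof -
  have lin: "linear (gcomp A g c x v)" for v using bilinear_gcomp[OF assms] by (simp add: bilinear_def)
  have u: "u = (\<Sum>l\<in>UNIV. (u $ l) *\<^sub>R axis l 1)"
    by (simp add: vec_eq_iff axis_def if_distrib cong: if_cong)
  have "gcomp A g c x (axis k 1) u = (\<Sum>l\<in>UNIV. u $ l * gcomp A g c x (axis k 1) (axis l 1))"
    by (subst u) (simp add: linear_sum[OF lin] linear_scale[OF lin])
  then show ?thesis by (simp add: matrix_vector_mult_def mult.commute)
qed

lemma gram_matrix_kernel:
  assumes "c \<in> A" "x \<in> snd c ` fst c" "(\<chi> k l. gcomp A g c x (axis k 1) (axis l 1)) *v u = 0"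
  shows "u = 0"
proof (rule gcomp_nondegenerate[OF assms(1,2)])
  fix v
  have "gcomp A g c x (axis k 1) u = 0" for k
    using gram_matrix_mult[OF assms(1,2), of u k] assms(3) by simp
  moreover have "gcomp A g c x v u = (\<Sum>k\<in>UNIV. v $ k *\<^sub>R gcomp A g c x (axis k 1) u)"
  proof -
    have lin: "linear (\<lambda>v. gcomp A g c x v u)" using bilinear_gcomp[OF assms(1,2)] by (simp add: bilinear_def)
    have v: "v = (\<Sum>l\<in>UNIV. (v $ l) *\<^sub>R axis l 1)"
      by (simp add: vec_eq_iff axis_def if_distrib cong: if_cong)
    show ?thesis by (subst v) (simp add: linear_sum[OF lin] linear_scale[OF lin])
  qed
  ultimately show "gcomp A g c x u v = 0" using gcomp_sym[OF assms(1,2), of u v] by simp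
qed

text \<open>The Christoffel symbols solve the linear system \<open>G (christoffel u v) = b\<close>, in which the Gram matrix
  \<open>G\<close> and the first derivatives \<open>b\<close> of the \<open>C\<^sup>2\<close> metric are locally Lipschitz.\<close>

lemma lipschitz_near_christoffel:
  assumes c: "c \<in> A" "x \<in> snd c ` fst c"
  shows "lipschitz_near x (\<lambda>y. christoffel A g c y u v)"
proof -
  let ?X = "snd c ` fst c"
  let ?G = "\<lambda>y. (\<chi> k l. gcomp A g c y (axis k 1) (axis l 1)) :: real^'n^'n"
  have nhd: "\<forall>\<^sub>F y in nhds x. y \<in> ?X" using chart_image_open c by (intro eventually_nhds_in_open) auto
  have lg: "lipschitz_near x (\<lambda>y. gcomp A g c y v w)" for v w
    by (rule Ck_on_1_lipschitz_near[OF Ck_on_Suc_imp chart_image_open[OF c(1)] c(2)])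
       (simp only: Suc_1 gcomp_C2[OF c(1)])
  have ld: "lipschitz_near x (\<lambda>y. frechet_derivative (\<lambda>y. gcomp A g c y v w) (at y) u)" for u v w
  proof -
    have "Ck_on (Suc 1) (\<lambda>y. gcomp A g c y v w) ?X" by (simp only: Suc_1 gcomp_C2[OF c(1)])
    from Ck_on_frechet(3)[OF this] obtain f' where
      f': "\<forall>y\<in>?X. f' y = frechet_derivative (\<lambda>y. gcomp A g c y v w) (at y)" "Ck_on 1 (\<lambda>y. f' y u) ?X" by blast
    have "lipschitz_near x (\<lambda>y. f' y u)"
      using f'(2) chart_image_open[OF c(1)] c(2) by (rule Ck_on_1_lipschitz_near)
    then show ?thesis by (rule lipschitz_near_cong) (use nhd f'(1) in \<open>auto elim: eventually_mono\<close>)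
  qed
  define b where "b y = (\<chi> l. (frechet_derivative (\<lambda>y. gcomp A g c y v (axis l 1)) (at y) u
           + frechet_derivative (\<lambda>y. gcomp A g c y u (axis l 1)) (at y) v
           - frechet_derivative (\<lambda>y. gcomp A g c y u v) (at y) (axis l 1)) / 2)" for y
  have half: "lipschitz_near x (\<lambda>y. p y / 2)" if "lipschitz_near x p" for p :: "_ \<Rightarrow> real"
    by (rule lipschitz_near_compose[OF that, of "\<lambda>t. t / 2"]) (intro lipschitz_near_linear bounded_linear_divide)
  show ?thesis
  proof (rule lipschitz_near_solution)
    show "lipschitz_near x ?G" by (intro lipschitz_near_cart) (simp add: lg)
    have "lipschitz_near x (\<lambda>y. (frechet_derivative (\<lambda>y. gcomp A g c y v (axis l 1)) (at y) u
           + frechet_derivative (\<lambda>y. gcomp A g c y u (axis l 1)) (at y) v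
           + - frechet_derivative (\<lambda>y. gcomp A g c y u v) (at y) (axis l 1)) / 2)" for l
      by (intro half lipschitz_near_add lipschitz_near_minus ld)
    then show "lipschitz_near x b" by (intro lipschitz_near_cart) (simp add: b_def)
    show "\<forall>\<^sub>F y in nhds x. ?G y *v christoffel A g c y u v = b y"
    proof (rule eventually_mono[OF nhd])
      fix y assume y: "y \<in> ?X"
      have "\<exists>B. B ** ?G y = mat 1" using gram_matrix_kernel[OF c(1) y] by (auto simp: matrix_left_invertible_ker)
      then have "invertible (?G y)" by (simp add: invertible_left_inverse)
      then have "?G y ** matrix_inv (?G y) = mat 1"
        unfolding invertible_def matrix_inv_def by (rule someI2_ex) simp
      then show "?G y *v christoffel A g c y u v = b y"
        by (simp add: christoffel_def b_def matrix_vector_mul_assoc)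
    qed
    show "\<And>u. ?G x *v u = 0 \<Longrightarrow> u = 0" using gram_matrix_kernel[OF c] .
  qed
qed

section \<open>Parallel transport and geodesics\<close>

text \<open>Parallel transport as a linear ordinary differential equation in every chart.\<close>

lemma parallel_along_iff:
  "parallel_along A g \<gamma> X I \<longleftrightarrow> (\<forall>t\<in>I. X t \<in> tangent_space A (\<gamma> t) \<and>
     (\<forall>c\<in>A. \<gamma> t \<in> fst c \<longrightarrow> ((\<lambda>s. X s c) has_vector_derivative
        - christoffel A g c (snd c (\<gamma> t)) (velocity A \<gamma> t c) (X t c)) (at t)))"
proof -
  have "cov_deriv A g \<gamma> X t = (\<lambda>_. 0) \<longleftrightarrow> (\<forall>c\<in>A. \<gamma> t \<in> fst c \<longrightarrow>
     vector_derivative (\<lambda>s. X s c) (at t) = - christoffel A g c (snd c (\<gamma> t)) (velocity A \<gamma> t c) (X t c))" for t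
    by (auto simp: cov_deriv_def fun_eq_iff eq_neg_iff_add_eq_0)
  then show ?thesis unfolding parallel_along_def
    by (smt (verit, ccfv_threshold) vector_derivative_works has_vector_derivative_def differentiableI vector_derivative_at)
qed

lemma christoffel_expansion:
  assumes "c \<in> A" "x \<in> snd c ` fst c"
  shows "christoffel A g c x u v = (\<Sum>i\<in>UNIV. \<Sum>j\<in>UNIV. (u $ i * v $ j) *\<^sub>R christoffel A g c x (axis i 1) (axis j 1))"
  by (rule bilinear_cart_expansion[OF christoffel_bilinear[OF assms]])

text \<open>The difference of two parallel fields solves a linear equation with continuous coefficients in each
  chart, so the Gronwall estimate shows that the set where the fields agree is open; it is closed since
  they are continuous in charts. The curve may pass through many charts, whence the argument by
  continuation.\<close>

lemma parallel_unique:
  assumes \<gamma>: "Ck_into A 1 \<gamma> I" and I: "is_interval I"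
    and X: "parallel_along A g \<gamma> X I" and Y: "parallel_along A g \<gamma> Y I"
    and t0: "t0 \<in> I" "X t0 = Y t0" and t: "t \<in> I"
  shows "X t = Y t"
proof -
  have oI: "open I" using \<gamma> by (simp add: Ck_into_def)
  have tang: "X s \<in> tangent_space A (\<gamma> s)" "Y s \<in> tangent_space A (\<gamma> s)" if "s \<in> I" for s
    using X Y that by (auto simp: parallel_along_def)
  have dX: "((\<lambda>s. Z s c) has_vector_derivative
        - christoffel A g c (snd c (\<gamma> s)) (velocity A \<gamma> s c) (Z s c)) (at s)"
    if "Z \<in> {X, Y}" "s \<in> I" "c \<in> A" "\<gamma> s \<in> fst c" for Z s c
    using X Y that unfolding parallel_along_iff by blast
  show ?thesis
  proof (rule interval_continuation[OF oI I, where P = "\<lambda>t. X t = Y t", OF t0 _ _ t])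
    fix s assume s: "s \<in> I" "X s = Y s"
    obtain c where c: "c \<in> A" "\<gamma> s \<in> fst c" using Ck_into_carrier[OF \<gamma> s(1)] by blast
    \<comment> \<open>\<open>h r\<close> bounds the norm of the linear map \<open>w \<mapsto> \<Gamma> (\<gamma>' r, w)\<close>\<close>
    define h where "h r = (\<Sum>i\<in>UNIV. \<Sum>j\<in>UNIV. norm (velocity A \<gamma> r c $ i)
        * norm (christoffel A g c (snd c (\<gamma> r)) (axis i 1) (axis j 1)))" for r
    have "isCont h s" unfolding h_def
    proof (intro continuous_intros)
      show "isCont (\<lambda>r. velocity A \<gamma> r c) s" using velocity_isCont[OF \<gamma> s(1) c] .
      fix i j
      have "isCont (\<lambda>r. snd c (\<gamma> r)) s"
        using curve_chart_derivative[where k = 0 and \<gamma> = \<gamma>, OF _ s(1) c] \<gamma> has_vector_derivative_continuous by auto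
      then show "isCont (\<lambda>r. christoffel A g c (snd c (\<gamma> r)) (axis i 1) (axis j 1)) s"
        by (rule isCont_o2) (rule lipschitz_near_imp_isCont[OF lipschitz_near_christoffel[OF c(1) imageI[OF c(2)]]])
    qed
    then have "\<forall>\<^sub>F r in nhds s. h r < h s + 1"
      by (intro order_tendstoD(2)[of h "h s"]) (auto simp: isCont_def tendsto_nhds_iff)
    from eventually_conj[OF this curve_eventually_in_chart[OF \<gamma> s(1) c]]
    obtain e where e: "e > 0" "\<And>r. dist r s < e \<Longrightarrow> h r < h s + 1 \<and> r \<in> I \<and> \<gamma> r \<in> fst c"
      unfolding eventually_nhds_metric by blast
    have "X r = Y r" if r: "dist r s < e" for r
    proof -
      have e': "h r < h s + 1" "r \<in> I" "\<gamma> r \<in> fst c" if "r \<in> {s - e<..<s + e}" for r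
        using e(2)[of r] that by (auto simp: dist_real_def)
      define y where "y r = X r c - Y r c" for r
      have "y r = 0"
      proof (rule gronwall_zero[where a = "s - e" and b = "s + e" and C = "h s + 1" and ?t0.0 = s and y = y and
           y' = "\<lambda>r. - christoffel A g c (snd c (\<gamma> r)) (velocity A \<gamma> r c) (y r)"])
        fix r assume r: "r \<in> {s - e<..<s + e}"
        note r' = e'[OF r]
        have x: "snd c (\<gamma> r) \<in> snd c ` fst c" using r' by auto
        have bil: "bilinear (christoffel A g c (snd c (\<gamma> r)))" by (rule christoffel_bilinear[OF c(1) x])
        have "(y has_vector_derivative
            - christoffel A g c (snd c (\<gamma> r)) (velocity A \<gamma> r c) (X r c)
            - - christoffel A g c (snd c (\<gamma> r)) (velocity A \<gamma> r c) (Y r c)) (at r)"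
          unfolding y_def using dX[OF _ r'(2) c(1) r'(3)] by (intro has_vector_derivative_diff) auto
        then show "(y has_vector_derivative - christoffel A g c (snd c (\<gamma> r)) (velocity A \<gamma> r c) (y r)) (at r)"
          by (simp add: y_def bilinear_rsub[OF bil])
        have "norm (christoffel A g c (snd c (\<gamma> r)) (velocity A \<gamma> r c) (y r))
           \<le> (\<Sum>i\<in>UNIV. \<Sum>j\<in>UNIV. norm (velocity A \<gamma> r c $ i)
               * norm (christoffel A g c (snd c (\<gamma> r)) (axis i 1) (axis j 1)) * norm (y r))"
        proof (subst christoffel_expansion[OF c(1) x], intro sum_norm_le)
          fix i j
          let ?C = "christoffel A g c (snd c (\<gamma> r)) (axis i 1) (axis j 1)" and ?v = "velocity A \<gamma> r c $ i"
          have "\<bar>y r $ j\<bar> \<le> norm (y r)" by (rule component_le_norm_cart)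
          then have "norm ?C * norm ?v * \<bar>y r $ j\<bar> \<le> norm ?C * norm ?v * norm (y r)"
            by (intro mult_left_mono) auto
          then show "norm ((?v * y r $ j) *\<^sub>R ?C) \<le> norm ?v * norm ?C * norm (y r)"
            by (simp add: abs_mult mult_ac)
        qed
        also have "\<dots> = h r * norm (y r)" by (simp add: h_def sum_distrib_right)
        also have "\<dots> \<le> (h s + 1) * norm (y r)" using r' by (intro mult_right_mono) auto
        finally show "norm (- christoffel A g c (snd c (\<gamma> r)) (velocity A \<gamma> r c) (y r)) \<le> (h s + 1) * norm (y r)"
          by simp
      qed (use e s r in \<open>auto simp: y_def dist_real_def\<close>)
      then show ?thesis using tang[of r] e(2)[OF r] c
        by (intro tangent_eqI[where c = c and p = "\<gamma> r"]) (auto simp: y_def)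
    qed
    then show "\<forall>\<^sub>F r in nhds s. X r = Y r" unfolding eventually_nhds_metric using e(1) by blast
  next
    fix s assume s: "s \<in> I" "X s \<noteq> Y s"
    obtain c where c: "c \<in> A" "\<gamma> s \<in> fst c" using Ck_into_carrier[OF \<gamma> s(1)] by blast
    then have ne: "X s c - Y s c \<noteq> 0" using tangent_eqI[OF tang[OF s(1)] c] s by auto
    have "isCont (\<lambda>s. Z s c) s" if "Z \<in> {X, Y}" for Z
      by (rule has_vector_derivative_continuous[OF dX[OF that s(1) c]])
    then have "isCont (\<lambda>s. X s c - Y s c) s" by (intro continuous_intros) auto
    then have "\<forall>\<^sub>F r in nhds s. X r c - Y r c \<noteq> 0"
      using ne by (intro tendsto_imp_eventually_ne) (auto simp: isCont_def tendsto_nhds_iff)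
    then show "\<forall>\<^sub>F r in nhds s. X r \<noteq> Y r" by (rule eventually_mono) auto
  qed
qed

text \<open>Position and velocity together solve a first-order system with locally Lipschitz right-hand side
  \<open>F (x, v) = (v, - \<Gamma>\<^sub>x (v, v))\<close>, so the set where both agree is open. It is closed because the manifold
  is Hausdorff.\<close>

lemma geodesic_unique:
  assumes \<gamma>: "geodesic A g \<gamma> I" and \<delta>: "geodesic A g \<delta> J"
    and t0: "t0 \<in> I \<inter> J" "\<gamma> t0 = \<delta> t0" "velocity A \<gamma> t0 = velocity A \<delta> t0" and t: "t \<in> I \<inter> J"
  shows "\<gamma> t = \<delta> t"
proof -
  have open_int: "open (I \<inter> J)" "is_interval (I \<inter> J)"
    using \<gamma> \<delta> by (auto simp: geodesic_def intro: is_interval_Int)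
  have C1: "Ck_into A 1 \<gamma> I" "Ck_into A 1 \<delta> J" using \<gamma> \<delta> by (auto simp: geodesic_def)
  have ode: "((\<lambda>s. velocity A \<zeta> s c) has_vector_derivative
        - christoffel A g c (snd c (\<zeta> s)) (velocity A \<zeta> s c) (velocity A \<zeta> s c)) (at s)"
      "((\<lambda>s. snd c (\<zeta> s)) has_vector_derivative velocity A \<zeta> s c) (at s)"
    if "geodesic A g \<zeta> K" "s \<in> K" "c \<in> A" "\<zeta> s \<in> fst c" for \<zeta> K s c
    using that curve_chart_derivative[of 0 \<zeta> K s c]
    unfolding geodesic_def parallel_along_iff by auto
  have "\<gamma> t = \<delta> t \<and> velocity A \<gamma> t = velocity A \<delta> t"
  proof (rule interval_continuation[OF open_int, where P = "\<lambda>t. \<gamma> t = \<delta> t \<and> velocity A \<gamma> t = velocity A \<delta> t", OF t0(1) _ _ _ t])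
    show "\<gamma> t0 = \<delta> t0 \<and> velocity A \<gamma> t0 = velocity A \<delta> t0" using t0 by simp
  next
    fix s assume s: "s \<in> I \<inter> J" "\<gamma> s = \<delta> s \<and> velocity A \<gamma> s = velocity A \<delta> s"
    obtain c where c: "c \<in> A" "\<gamma> s \<in> fst c" using Ck_into_carrier[OF C1(1), of s] s by blast
    let ?X = "snd c ` fst c"
    define F where "F = (\<lambda>(x, v). (v, - christoffel A g c x v v))"
    \<comment> \<open>\<open>F1\<close> is \<open>F\<close> with the Christoffel term expanded in components, where local Lipschitz
    continuity is visible; the two agree over the image of the chart\<close>
    define F1 where "F1 xv = (snd xv, - (\<Sum>i\<in>UNIV. \<Sum>j\<in>UNIV. (snd xv $ i * snd xv $ j) *\<^sub>R
        christoffel A g c (fst xv) (axis i 1) (axis j 1)))" for xv :: "(real^'n) \<times> (real^'n)"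
    define Y where "Y \<zeta> r = (snd c (\<zeta> r), velocity A \<zeta> r c)" for \<zeta> r
    have x0: "fst (Y \<gamma> s) \<in> ?X" using c by (auto simp: Y_def)
    have lc: "lipschitz_near (Y \<gamma> s) (\<lambda>xv. christoffel A g c (fst xv) u v)" for u v
      by (rule lipschitz_near_compose[OF lipschitz_near_linear[OF bounded_linear_fst]
            lipschitz_near_christoffel[OF c(1) x0]])
    have lv: "lipschitz_near z (\<lambda>xv :: (real^'n) \<times> (real^'n). snd xv $ i)" for z i
      by (intro lipschitz_near_linear bounded_linear_compose[OF bounded_linear_vec_nth bounded_linear_snd])
    have "lipschitz_near (Y \<gamma> s) F1"
      unfolding F1_def
      by (intro lipschitz_near_Pair lipschitz_near_minus lipschitz_near_sum lc
          lipschitz_near_bilinear[OF bounded_bilinear_scaleR] lipschitz_near_bilinear[OF bounded_bilinear_mult] lv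
          lipschitz_near_linear bounded_linear_snd)
    moreover have "\<forall>\<^sub>F xv in nhds (Y \<gamma> s). F1 xv = F xv"
    proof -
      have "open (fst -` ?X :: ((real^'n) \<times> (real^'n)) set)"
        using chart_image_open[OF c(1)] by (rule open_vimage_fst)
      then have "\<forall>\<^sub>F xv in nhds (Y \<gamma> s). xv \<in> fst -` ?X" using x0 by (intro eventually_nhds_in_open) auto
      then show ?thesis
      proof (rule eventually_mono)
        fix xv :: "(real^'n) \<times> (real^'n)" assume "xv \<in> fst -` ?X"
        then have "fst xv \<in> ?X" by simp
        then show "F1 xv = F xv" unfolding F1_def F_def
          by (simp add: christoffel_expansion[OF c(1), of "fst xv" "snd xv" "snd xv"] case_prod_beta)
      qed
    qed
    ultimately have "lipschitz_near (Y \<gamma> s) F" by (rule lipschitz_near_cong)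
    then obtain d C where d: "d > 0" "C-lipschitz_on (ball (Y \<gamma> s) d) F" by (auto simp: lipschitz_near_def)
    have near: "\<forall>\<^sub>F r in nhds s. r \<in> K \<and> \<zeta> r \<in> fst c \<and> dist (Y \<zeta> r) (Y \<gamma> s) < d"
      if \<zeta>: "geodesic A g \<zeta> K" "s \<in> K" "\<zeta> s = \<gamma> s" "velocity A \<zeta> s = velocity A \<gamma> s" for \<zeta> K
    proof -
      have C1': "Ck_into A 1 \<zeta> K" and cs: "\<zeta> s \<in> fst c" using \<zeta> c by (auto simp: geodesic_def)
      have "isCont (\<lambda>r. snd c (\<zeta> r)) s"
        using ode(2)[OF \<zeta>(1,2) c(1) cs] by (rule has_vector_derivative_continuous)
      moreover have "isCont (\<lambda>r. velocity A \<zeta> r c) s"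
        using ode(1)[OF \<zeta>(1,2) c(1) cs] by (rule has_vector_derivative_continuous)
      ultimately have "isCont (Y \<zeta>) s" unfolding Y_def by (intro isCont_Pair)
      moreover have "Y \<zeta> s = Y \<gamma> s" using \<zeta> by (simp add: Y_def)
      ultimately have "(Y \<zeta> \<longlongrightarrow> Y \<gamma> s) (nhds s)" by (simp add: isCont_def tendsto_nhds_iff)
      then have "\<forall>\<^sub>F r in nhds s. dist (Y \<zeta> r) (Y \<gamma> s) < d" using d(1) by (rule tendstoD)
      from eventually_conj[OF curve_eventually_in_chart[OF C1' \<zeta>(2) c(1) cs] this]
      show ?thesis by (simp add: conj_assoc)
    qed
    have "\<forall>\<^sub>F r in nhds s. (r \<in> I \<and> \<gamma> r \<in> fst c \<and> dist (Y \<gamma> r) (Y \<gamma> s) < d) \<and>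
        (r \<in> J \<and> \<delta> r \<in> fst c \<and> dist (Y \<delta> r) (Y \<gamma> s) < d)"
      using s by (intro eventually_conj near \<gamma> \<delta>) auto
    then obtain e where e: "e > 0"
      "\<And>r. dist r s < e \<Longrightarrow> r \<in> I \<and> \<gamma> r \<in> fst c \<and> dist (Y \<gamma> r) (Y \<gamma> s) < d"
      "\<And>r. dist r s < e \<Longrightarrow> r \<in> J \<and> \<delta> r \<in> fst c \<and> dist (Y \<delta> r) (Y \<gamma> s) < d"
      unfolding eventually_nhds_metric by blast
    have "\<gamma> r = \<delta> r \<and> velocity A \<gamma> r = velocity A \<delta> r" if r: "dist r s < e" for r
    proof -
      define y where "y r = Y \<gamma> r - Y \<delta> r" for r
      have dY: "(Y \<zeta> has_vector_derivative F (Y \<zeta> r)) (at r)"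
        if "geodesic A g \<zeta> K" "r \<in> K" "\<zeta> r \<in> fst c" for \<zeta> K r
        using ode[OF that(1,2) c(1) that(3)] unfolding Y_def F_def by (auto intro: has_vector_derivative_Pair)
      have "y r = 0"
      proof (rule gronwall_zero[where a = "s - e" and b = "s + e" and C = C and ?t0.0 = s and y = y and
           y' = "\<lambda>r. F (Y \<gamma> r) - F (Y \<delta> r)"])
        fix r assume "r \<in> {s - e<..<s + e}"
        then have r: "dist r s < e" by (auto simp: dist_real_def)
        show "(y has_vector_derivative F (Y \<gamma> r) - F (Y \<delta> r)) (at r)"
          unfolding y_def using e(2)[OF r] e(3)[OF r] \<gamma> \<delta>
          by (intro has_vector_derivative_diff dY) auto
        show "norm (F (Y \<gamma> r) - F (Y \<delta> r)) \<le> C * norm (y r)"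
        proof -
          have "Y \<gamma> r \<in> ball (Y \<gamma> s) d" "Y \<delta> r \<in> ball (Y \<gamma> s) d"
            using e(2)[OF r] e(3)[OF r] by (simp_all add: dist_commute)
          from lipschitz_onD[OF d(2) this] show ?thesis by (simp add: dist_norm y_def)
        qed
      qed (use e s r in \<open>auto simp: y_def Y_def dist_real_def\<close>)
      then have eq: "snd c (\<gamma> r) = snd c (\<delta> r)" "velocity A \<gamma> r c = velocity A \<delta> r c"
        by (auto simp: y_def Y_def zero_prod_def)
      then have 1: "\<gamma> r = \<delta> r"
        using e(2)[OF r] e(3)[OF r] chart_inv_chart[OF c(1)] by metis
      moreover have "velocity A \<gamma> r = velocity A \<delta> r"
      proof (rule tangent_eqI[where p = "\<gamma> r" and c = c and v = "velocity A \<gamma> r" and w = "velocity A \<delta> r", OF _ _ c(1) _ eq(2)])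
        show "velocity A \<gamma> r \<in> tangent_space A (\<gamma> r)"
          using velocity_tangent[of 0 \<gamma> I r] C1 e(2)[OF r] by simp
        show "velocity A \<delta> r \<in> tangent_space A (\<gamma> r)"
          using velocity_tangent[of 0 \<delta> J r] C1 e(3)[OF r] 1 by simp
      qed (use e(2)[OF r] in simp)
      ultimately show ?thesis by simp
    qed
    then show "\<forall>\<^sub>F r in nhds s. \<gamma> r = \<delta> r \<and> velocity A \<gamma> r = velocity A \<delta> r"
      unfolding eventually_nhds_metric using e(1) by blast
  next
    fix s assume s: "s \<in> I \<inter> J" "\<not> (\<gamma> s = \<delta> s \<and> velocity A \<gamma> s = velocity A \<delta> s)"
    show "\<forall>\<^sub>F r in nhds s. \<not> (\<gamma> r = \<delta> r \<and> velocity A \<gamma> r = velocity A \<delta> r)"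
    proof (cases "\<gamma> s = \<delta> s")
      case False
      obtain U V where UV: "open U" "open V" "\<gamma> s \<in> U" "\<delta> s \<in> V" "U \<inter> V = {}"
        using hausdorff[OF False] by blast
      have "(\<gamma> \<longlongrightarrow> \<gamma> s) (nhds s)" "(\<delta> \<longlongrightarrow> \<delta> s) (nhds s)"
        using Ck_into_isCont[OF C1(1), of s] Ck_into_isCont[OF C1(2), of s] s
        by (auto simp: isCont_def tendsto_nhds_iff)
      then have "\<forall>\<^sub>F r in nhds s. \<gamma> r \<in> U" "\<forall>\<^sub>F r in nhds s. \<delta> r \<in> V"
        using UV topological_tendstoD by blast+
      from eventually_conj[OF this] show ?thesis by (rule eventually_mono) (use UV(5) in auto)
    next
      case True
      obtain c where c: "c \<in> A" "\<gamma> s \<in> fst c" using Ck_into_carrier[OF C1(1), of s] s by blast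
      have "velocity A \<gamma> s c - velocity A \<delta> s c \<noteq> 0"
        using tangent_eqI[of "velocity A \<gamma> s" "\<gamma> s" "velocity A \<delta> s" c] c s True
          velocity_tangent[of 0 \<gamma> I s] velocity_tangent[of 0 \<delta> J s] C1 by auto
      moreover have "isCont (\<lambda>r. velocity A \<gamma> r c - velocity A \<delta> r c) s"
        using velocity_isCont[OF C1(1) _ c(1)] velocity_isCont[OF C1(2) _ c(1)] s True c
        by (intro continuous_intros) auto
      ultimately have "\<forall>\<^sub>F r in nhds s. velocity A \<gamma> r c - velocity A \<delta> r c \<noteq> 0"
        by (intro tendsto_imp_eventually_ne[where c = "velocity A \<gamma> s c - velocity A \<delta> s c"])
           (auto simp: isCont_def tendsto_nhds_iff)
      then show ?thesis by (rule eventually_mono) auto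
    qed
  qed
  then show ?thesis by simp
qed

lemma parallel_along_cong:
  assumes "parallel_along A g \<gamma> X I" "open J" "J \<subseteq> I" "Ck_into A 1 \<delta> J"
    "\<And>t. t \<in> J \<Longrightarrow> \<delta> t = \<gamma> t" "\<And>t. t \<in> J \<Longrightarrow> Y t = X t"
  shows "parallel_along A g \<delta> Y J"
  unfolding parallel_along_iff
proof (intro ballI conjI impI)
  fix t assume t: "t \<in> J"
  show "Y t \<in> tangent_space A (\<delta> t)" using assms t by (auto simp: parallel_along_def)
  fix c assume c: "c \<in> A" "\<delta> t \<in> fst c"
  have "((\<lambda>s. snd c (\<gamma> s)) has_vector_derivative velocity A \<delta> t c) (at t)"
    by (rule has_vector_derivative_transform_within_open[OF curve_chart_derivative[of 0 \<delta> J] assms(2) t])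
       (use assms t c in auto)
  then have v: "velocity A \<delta> t c = velocity A \<gamma> t c" using c assms(5)[OF t] by (intro velocity_eqI[symmetric]) auto
  have "((\<lambda>s. X s c) has_vector_derivative
        - christoffel A g c (snd c (\<gamma> t)) (velocity A \<gamma> t c) (X t c)) (at t)"
    using assms(1,3,5) t c unfolding parallel_along_iff by auto
  then have "((\<lambda>s. Y s c) has_vector_derivative
        - christoffel A g c (snd c (\<gamma> t)) (velocity A \<gamma> t c) (X t c)) (at t)"
    by (rule has_vector_derivative_transform_within_open[OF _ assms(2) t]) (simp add: assms(6))
  then show "((\<lambda>s. Y s c) has_vector_derivative
        - christoffel A g c (snd c (\<delta> t)) (velocity A \<delta> t c) (Y t c)) (at t)"
    using assms t v by simp
qed

lemma parallel_along_tscale: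
  assumes "parallel_along A g \<gamma> X I"
  shows "parallel_along A g \<gamma> (\<lambda>t. tscale b (X t)) I"
  unfolding parallel_along_iff
proof (intro ballI conjI impI)
  fix t assume t: "t \<in> I"
  show "tscale b (X t) \<in> tangent_space A (\<gamma> t)" using assms t by (auto simp: parallel_along_def tangent_tscale)
  fix c assume c: "c \<in> A" "\<gamma> t \<in> fst c"
  have bil: "bilinear (christoffel A g c (snd c (\<gamma> t)))" using c by (intro christoffel_bilinear) auto
  have "((\<lambda>s. b *\<^sub>R X s c) has_vector_derivative
        b *\<^sub>R - christoffel A g c (snd c (\<gamma> t)) (velocity A \<gamma> t c) (X t c)) (at t)"
    using assms t c unfolding parallel_along_iff
    by (intro bounded_linear.has_vector_derivative[OF bounded_linear_scaleR_right]) auto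
  then show "((\<lambda>s. tscale b (X s) c) has_vector_derivative
        - christoffel A g c (snd c (\<gamma> t)) (velocity A \<gamma> t c) (tscale b (X t) c)) (at t)"
    by (simp add: tscale_def bilinear_rmul[OF bil])
qed

lemma has_vector_derivative_rescale:
  assumes "(f has_vector_derivative f') (at (a * r))"
  shows "((\<lambda>r. f (a * r)) has_vector_derivative a *\<^sub>R f') (at r)"
proof -
  have "((*) a has_vector_derivative a) (at r)"
    unfolding has_real_derivative_iff_has_vector_derivative[symmetric] by (auto intro!: derivative_eq_intros)
  from vector_diff_chain_at[OF this assms] show ?thesis by (simp add: o_def)
qed

lemma velocity_rescale:
  assumes "Ck_into A 1 \<gamma> I" "a * r \<in> I"
  shows "velocity A (\<lambda>r. \<gamma> (a * r)) r = tscale a (velocity A \<gamma> (a * r))"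
proof
  fix c show "velocity A (\<lambda>r. \<gamma> (a * r)) r c = tscale a (velocity A \<gamma> (a * r)) c"
  proof (cases "c \<in> A \<and> \<gamma> (a * r) \<in> fst c")
    case True
    then show ?thesis
      using curve_chart_derivative[of 0 \<gamma> I "a * r" c] assms
      by (intro velocity_eqI) (auto simp: tscale_def intro!: has_vector_derivative_rescale[of "\<lambda>s. snd c (\<gamma> s)"])
  next
    case False
    then show ?thesis by (simp add: velocity_outside tscale_def)
  qed
qed

text \<open>A constant change of speed multiplies the velocity, and hence the Christoffel term, by the same
  factor as the derivative of the field.\<close>

lemma parallel_along_rescale:
  assumes X: "parallel_along A g \<gamma> X I" and \<gamma>: "Ck_into A 1 \<gamma> I"
  shows "parallel_along A g (\<lambda>r. \<gamma> (a * r)) (\<lambda>r. X (a * r)) {r. a * r \<in> I}"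
  unfolding parallel_along_iff
proof (intro ballI conjI impI)
  fix t assume "t \<in> {r. a * r \<in> I}"
  then have t: "a * t \<in> I" by simp
  show "X (a * t) \<in> tangent_space A (\<gamma> (a * t))" using X t by (auto simp: parallel_along_def)
  fix c assume c: "c \<in> A" "\<gamma> (a * t) \<in> fst c"
  have bil: "bilinear (christoffel A g c (snd c (\<gamma> (a * t))))" using c by (intro christoffel_bilinear) auto
  have "((\<lambda>s. X s c) has_vector_derivative
        - christoffel A g c (snd c (\<gamma> (a * t))) (velocity A \<gamma> (a * t) c) (X (a * t) c)) (at (a * t))"
    using X t c unfolding parallel_along_iff by auto
  from has_vector_derivative_rescale[OF this]
  show "((\<lambda>s. X (a * s) c) has_vector_derivative
        - christoffel A g c (snd c (\<gamma> (a * t))) (velocity A (\<lambda>r. \<gamma> (a * r)) t c) (X (a * t) c)) (at t)"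
    by (simp add: velocity_rescale[OF \<gamma> t] tscale_def bilinear_lmul[OF bil])
qed

lemma Ck_into_rescale:
  fixes \<gamma> :: "real \<Rightarrow> 'm"
  assumes "Ck_into A 1 \<gamma> I"
  shows "Ck_into A 1 (\<lambda>r. \<gamma> (a * r)) {r. a * r \<in> I}"
  unfolding Ck_into_def
proof (intro conjI ballI)
  have c: "continuous_on UNIV (\<lambda>r. a * r)" by (intro continuous_intros)
  have oI: "open I" using assms by (simp add: Ck_into_def)
  show "open {r. a * r \<in> I}" using open_vimage[OF oI c] by (simp add: vimage_def)
  show "continuous_on {r. a * r \<in> I} (\<lambda>r. \<gamma> (a * r))"
    using assms by (intro continuous_on_compose2[of I \<gamma> _ "\<lambda>r. a * r"] continuous_intros) (auto simp: Ck_into_def)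
  show "(\<lambda>r. \<gamma> (a * r)) ` {r. a * r \<in> I} \<subseteq> carrier A" using assms by (auto simp: Ck_into_def)
  fix c assume c: "c \<in> A"
  let ?W = "{r. a * r \<in> I} \<inter> (\<lambda>r. \<gamma> (a * r)) -` fst c"
  show "Ck_on 1 (snd c \<circ> (\<lambda>r. \<gamma> (a * r))) ?W"
  proof (rule Ck_on_1_I[where f' = "\<lambda>r h. h *\<^sub>R a *\<^sub>R velocity A \<gamma> (a * r) c"])
    fix r assume r: "r \<in> ?W"
    have "((\<lambda>r. snd c (\<gamma> (a * r))) has_vector_derivative a *\<^sub>R velocity A \<gamma> (a * r) c) (at r)"
      using r assms c curve_chart_derivative[of 0 \<gamma> I "a * r" c]
      by (intro has_vector_derivative_rescale[of "\<lambda>s. snd c (\<gamma> s)"]) auto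
    then show "(snd c \<circ> (\<lambda>r. \<gamma> (a * r)) has_derivative (\<lambda>h. h *\<^sub>R a *\<^sub>R velocity A \<gamma> (a * r) c)) (at r)"
      by (simp add: has_vector_derivative_def o_def)
  next
    fix v :: real
    show "continuous_on ?W (\<lambda>r. v *\<^sub>R a *\<^sub>R velocity A \<gamma> (a * r) c)"
    proof (intro continuous_intros continuous_at_imp_continuous_on ballI)
      fix r assume r: "r \<in> ?W"
      have "isCont (\<lambda>s. velocity A \<gamma> s c) (a * r)" using velocity_isCont[OF assms _ c] r by auto
      then show "isCont (\<lambda>r. velocity A \<gamma> (a * r) c) r"
        by (intro isCont_o2[where f = "\<lambda>r. a * r" and g = "\<lambda>s. velocity A \<gamma> s c"] continuous_intros) auto
    qed
  qed
qed

lemma geodesic_subset: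
  assumes "geodesic A g \<gamma> I" "open J" "is_interval J" "J \<subseteq> I"
  shows "geodesic A g \<gamma> J"
  using assms unfolding geodesic_def by (auto intro: Ck_into_subset simp: parallel_along_def)

text \<open>For \<open>a = 0\<close> and \<open>0 \<in> I\<close> this is the constant geodesic, which is the one that computes the
  exponential of the zero vector.\<close>

lemma geodesic_rescale:
  assumes "geodesic A g \<gamma> I"
  shows "geodesic A g (\<lambda>r. \<gamma> (a * r)) {r. a * r \<in> I}"
proof -
  have \<gamma>: "Ck_into A 1 \<gamma> I" and I: "is_interval I" and p: "parallel_along A g \<gamma> (velocity A \<gamma>) I"
    using assms by (auto simp: geodesic_def)
  note C1 = Ck_into_rescale[OF \<gamma>, of a]
  have op: "open {r. a * r \<in> I}" using C1 by (simp add: Ck_into_def)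
  have "convex {r. a * r \<in> I}"
    using convex_linear_vimage[of "(*) a" I] I by (simp add: vimage_def is_interval_convex_1)
  then have int: "is_interval {r. a * r \<in> I}" by (simp add: is_interval_convex_1)
  have "parallel_along A g (\<lambda>r. \<gamma> (a * r)) (\<lambda>r. tscale a (velocity A \<gamma> (a * r))) {r. a * r \<in> I}"
    using parallel_along_rescale[OF parallel_along_tscale[OF p] \<gamma>] .
  then have "parallel_along A g (\<lambda>r. \<gamma> (a * r)) (velocity A (\<lambda>r. \<gamma> (a * r))) {r. a * r \<in> I}"
    by (rule parallel_along_cong[OF _ op order_refl C1]) (simp_all add: velocity_rescale[OF \<gamma>])
  then show ?thesis using op int C1 by (simp add: geodesic_def)
qed

text \<open>Uniqueness of geodesics makes the description in the definition of the exponential map proper.\<close>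

lemma exp_map_eqI:
  assumes "exp_witness A g z v q"
  shows "exp_map A g z v = q"
  unfolding exp_map_def
proof (rule the_equality)
  show "exp_witness A g z v q" by fact
next
  fix q' assume "exp_witness A g z v q'"
  then obtain \<delta> J where \<delta>: "geodesic A g \<delta> J" "{0..1} \<subseteq> J" "\<delta> 0 = z" "velocity A \<delta> 0 = v" "\<delta> 1 = q'"
    by (auto simp: exp_witness_def)
  obtain \<gamma> I where \<gamma>: "geodesic A g \<gamma> I" "{0..1} \<subseteq> I" "\<gamma> 0 = z" "velocity A \<gamma> 0 = v" "\<gamma> 1 = q"
    using assms by (auto simp: exp_witness_def)
  have "\<delta> 1 = \<gamma> 1" by (rule geodesic_unique[OF \<delta>(1) \<gamma>(1), of 0]) (use \<delta> \<gamma> in auto)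
  then show "q' = q" using \<delta> \<gamma> by simp
qed

text \<open>If the exponential map is defined at one multiple \<open>t v\<close>, then \<open>s \<mapsto> exp (s v)\<close> is a geodesic on an open
  interval that reaches \<open>t\<close>. The value \<open>t = 0\<close> has to be excluded, as the zero vector remembers
  nothing of \<open>v\<close>.\<close>

lemma exp_map_along_geodesic:
  assumes "exp_defined A g z (tscale t v)" "t \<noteq> 0"
  obtains \<delta> J where "geodesic A g \<delta> J" "0 \<in> J" "t \<in> J" "\<delta> 0 = z" "velocity A \<delta> 0 = v"
    "\<And>s. s \<in> J \<Longrightarrow> exp_map A g z (tscale s v) = \<delta> s"
proof -
  obtain \<gamma> I where \<gamma>: "geodesic A g \<gamma> I" "{0..1} \<subseteq> I" "\<gamma> 0 = z" "velocity A \<gamma> 0 = tscale t v"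
    using assms(1) by (auto simp: exp_defined_def exp_witness_def)
  have CI: "Ck_into A 1 \<gamma> I" using \<gamma> by (simp add: geodesic_def)
  define \<delta> where "\<delta> r = \<gamma> (1 / t * r)" for r
  define J where "J = {r. 1 / t * r \<in> I}"
  have \<delta>: "geodesic A g \<delta> J" using geodesic_rescale[OF \<gamma>(1), of "1 / t"] by (simp add: \<delta>_def[abs_def] J_def)
  then have CJ: "Ck_into A 1 \<delta> J" and J: "convex J" by (auto simp: geodesic_def is_interval_convex_1)
  have m: "0 \<in> J" "t \<in> J" "\<delta> 0 = z" using \<gamma> assms(2) by (auto simp: J_def \<delta>_def)
  have vel: "velocity A \<delta> 0 = v"
  proof -
    have "1 / t * 0 \<in> I" using \<gamma>(2) by auto
    then have "velocity A \<delta> 0 = tscale (1 / t) (tscale t v)"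
      using velocity_rescale[OF CI, of "1 / t" 0] \<gamma>(4) by (simp add: \<delta>_def[abs_def])
    then show ?thesis using assms(2) by (simp add: tscale_def)
  qed
  have "exp_map A g z (tscale s v) = \<delta> s" if s: "s \<in> J" for s
  proof (rule exp_map_eqI)
    have "{0..1} \<subseteq> {r. s * r \<in> J}"
      using convexD_alt[OF J m(1) s] by (auto simp: mult.commute)
    moreover have "velocity A (\<lambda>r. \<delta> (s * r)) 0 = tscale s v"
      using velocity_rescale[OF CJ, of s 0] m vel by simp
    ultimately show "exp_witness A g z (tscale s v) (\<delta> s)"
      unfolding exp_witness_def using geodesic_rescale[OF \<delta>, of s] m
      by (intro exI[of _ "\<lambda>r. \<delta> (s * r)"] exI[of _ "{r. s * r \<in> J}"]) auto
  qed
  then show ?thesis using that \<delta> m vel by blast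
qed

end

section \<open>Parametrised submanifolds\<close>

lemma local_param_subset:
  assumes "local_param A N W \<psi>" shows "\<psi> ` W \<subseteq> N"
  using assms unfolding local_param_def by (auto dest: openin_imp_subset)

lemma local_param_of_open_subset:
  assumes "openin (top_of_set N) \<Omega>" "local_param A \<Omega> W \<psi>"
  shows "local_param A N W \<psi>"
  using assms openin_trans unfolding local_param_def by blast

lemma local_param_restrict:
  assumes \<Omega>: "openin (top_of_set N) \<Omega>" and \<psi>: "local_param A N W \<psi>"
  shows "local_param A \<Omega> (W \<inter> \<psi> -` \<Omega>) \<psi>"
proof -
  obtain Q where Q: "open Q" "\<Omega> = N \<inter> Q" using \<Omega> by (auto simp: openin_open)
  obtain Q' where Q': "open Q'" "\<psi> ` W = N \<inter> Q'" using \<psi> by (auto simp: local_param_def openin_open)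
  have C: "Ck_into A 2 \<psi> W" and W: "open W" "continuous_on W \<psi>"
    using \<psi> by (auto simp: local_param_def Ck_into_def)
  have WQ: "W \<inter> \<psi> -` \<Omega> = \<psi> -` Q \<inter> W" using Q(2) local_param_subset[OF \<psi>] by auto
  have op: "open (W \<inter> \<psi> -` \<Omega>)" unfolding WQ using continuous_on_open_vimage[OF W(1)] W(2) Q(1) by auto
  have "\<psi> ` (W \<inter> \<psi> -` \<Omega>) = \<psi> ` W \<inter> \<Omega>" by auto
  also have "\<dots> = \<Omega> \<inter> Q'" using Q(2) Q'(2) by auto
  finally have im: "\<psi> ` (W \<inter> \<psi> -` \<Omega>) = \<Omega> \<inter> Q'" .
  obtain \<kappa> where "homeomorphism W (\<psi> ` W) \<psi> \<kappa>" using \<psi> by (auto simp: local_param_def)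
  then have "homeomorphism (W \<inter> \<psi> -` \<Omega>) (\<psi> ` (W \<inter> \<psi> -` \<Omega>)) \<psi> \<kappa>"
    by (rule homeomorphism_of_subsets) auto
  moreover have "openin (top_of_set \<Omega>) (\<psi> ` (W \<inter> \<psi> -` \<Omega>))"
    unfolding im using Q'(1) by (auto simp: openin_open)
  ultimately show ?thesis using \<psi> Ck_into_subset[OF C op] unfolding local_param_def by blast
qed

lemma submanifold_param:
  fixes A :: "('m::topological_space, 'n::finite) chart set"
  assumes "submanifold TYPE('a::euclidean_space) A N" "openin (top_of_set N) \<Omega>" "p \<in> \<Omega>"
  obtains W and \<psi> :: "'a::euclidean_space \<Rightarrow> 'm" and x where "local_param A \<Omega> W \<psi>" "x \<in> W" "p = \<psi> x"
proof -
  have "p \<in> N" using assms openin_imp_subset by blast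
  then obtain W and \<psi> :: "'a \<Rightarrow> 'm" where \<psi>: "local_param A N W \<psi>" "p \<in> \<psi> ` W"
    using assms(1) unfolding submanifold_def by blast
  then obtain x where "x \<in> W" "p = \<psi> x" by blast
  then show ?thesis using that[OF local_param_restrict[OF assms(2) \<psi>(1)], of x] assms(3) by blast
qed

text \<open>The image of a parametrisation is open in \<open>N\<close>, so a curve in \<open>N\<close> stays in it for a while and can be
  lifted continuously to the parameter space.\<close>

lemma param_inverse_along_curve:
  fixes \<gamma> :: "real \<Rightarrow> 'm::topological_space"
  assumes hom: "homeomorphism W (\<psi> ` W) \<psi> \<kappa>" and op: "openin (top_of_set N) (\<psi> ` W)"
    and I: "open I" "continuous_on I \<gamma>" "\<gamma> ` I \<subseteq> N" and s: "s \<in> I" "\<gamma> s \<in> \<psi> ` W"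
  shows "isCont (\<lambda>r. \<kappa> (\<gamma> r)) s" and "\<forall>\<^sub>F r in nhds s. r \<in> I \<and> \<gamma> r \<in> \<psi> ` W"
proof -
  obtain Q where Q: "open Q" "\<psi> ` W = N \<inter> Q" using op by (auto simp: openin_open)
  have o: "open (\<gamma> -` Q \<inter> I)" using continuous_on_open_vimage[OF I(1)] I(2) Q(1) by auto
  have sQ: "s \<in> \<gamma> -` Q \<inter> I" using s Q by auto
  have sub: "\<gamma> ` (\<gamma> -` Q \<inter> I) \<subseteq> \<psi> ` W" using I(3) Q by auto
  have "continuous_on (\<gamma> -` Q \<inter> I) (\<lambda>r. \<kappa> (\<gamma> r))"
    by (rule continuous_on_compose2[OF homeomorphism_cont2[OF hom] continuous_on_subset[OF I(2)] sub]) auto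
  then show "isCont (\<lambda>r. \<kappa> (\<gamma> r)) s" using o sQ continuous_on_eq_continuous_at by blast
  show "\<forall>\<^sub>F r in nhds s. r \<in> I \<and> \<gamma> r \<in> \<psi> ` W"
    using eventually_nhds_in_open[OF o sQ] by (rule eventually_mono) (use sub in auto)
qed

lemma tscale_apply: "tscale a v c = a *\<^sub>R v c"
  by (simp add: tscale_def)

context atlas
begin

lemma tangent_sub_subset_tangent_space:
  assumes "v \<in> tangent_sub A N p" shows "v \<in> tangent_space A p"
proof -
  obtain \<gamma> \<epsilon> where "v = velocity A \<gamma> 0" "\<epsilon> > 0" "Ck_into A 1 \<gamma> {- \<epsilon><..<\<epsilon>}" "\<gamma> 0 = p"
    using assms by (auto simp: tangent_sub_def curve_in_from_def)
  then show ?thesis using velocity_tangent[of 0 \<gamma> "{- \<epsilon><..<\<epsilon>}" 0] by auto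
qed

lemma param_C1: "local_param A N W \<psi> \<Longrightarrow> Ck_into A 1 \<psi> W"
  unfolding local_param_def using Ck_into_Suc_imp[of A 1 \<psi> W] by (simp only: Suc_1)

lemma dmap_param_tangent:
  "local_param A N W \<psi> \<Longrightarrow> x \<in> W \<Longrightarrow> dmap A \<psi> x u \<in> tangent_space A (\<psi> x)"
  using Ck_into_dmap_tangent[of 0 \<psi> W x u] param_C1[of N W \<psi>] by simp

lemma dmap_param_linear:
  assumes "local_param A N W \<psi>" "x \<in> W" "c \<in> A" "\<psi> x \<in> fst c"
  shows "linear (\<lambda>u. dmap A \<psi> x u c)" and "inj (\<lambda>u. dmap A \<psi> x u c)"
    and "((\<lambda>y. snd c (\<psi> y)) has_derivative (\<lambda>u. dmap A \<psi> x u c)) (at x)"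
proof -
  have d: "(snd c \<circ> \<psi>) differentiable (at x)"
    using Ck_into_differentiable[of 0 \<psi> W x c] param_C1[OF assms(1)] assms by simp
  have eq: "(\<lambda>u. dmap A \<psi> x u c) = frechet_derivative (snd c \<circ> \<psi>) (at x)"
    using assms by (auto simp: dmap_def)
  show "linear (\<lambda>u. dmap A \<psi> x u c)" unfolding eq using d by (rule linear_frechet_derivative)
  show "((\<lambda>y. snd c (\<psi> y)) has_derivative (\<lambda>u. dmap A \<psi> x u c)) (at x)"
    unfolding eq using d by (simp add: frechet_derivative_works o_def)
  show "inj (\<lambda>u. dmap A \<psi> x u c)"
  proof (rule injI)
    fix u v assume "dmap A \<psi> x u c = dmap A \<psi> x v c"
    then have "dmap A \<psi> x u = dmap A \<psi> x v"
      using tangent_eqI[OF dmap_param_tangent[OF assms(1,2), of u] dmap_param_tangent[OF assms(1,2), of v] assms(3,4)]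
      by simp
    then show "u = v" using assms(1,2) unfolding local_param_def inj_def by blast
  qed
qed

text \<open>The image under \<open>\<psi>\<close> of a line in the parameter space is a curve in \<open>N\<close>.\<close>

lemma dmap_in_tangent_sub:
  fixes \<psi> :: "'a::euclidean_space \<Rightarrow> 'm"
  assumes \<psi>: "local_param A N W \<psi>" and x: "x \<in> W"
  shows "dmap A \<psi> x u \<in> tangent_sub A N (\<psi> x)"
proof -
  have C: "Ck_into A 1 \<psi> W" by (rule param_C1[OF \<psi>])
  then have W: "open W" "continuous_on W \<psi>" by (auto simp: Ck_into_def)
  define l where "l t = x + t *\<^sub>R u" for t :: real
  have "open (l -` W)" using W(1) by (intro open_vimage) (auto simp: l_def[abs_def] intro!: continuous_intros)
  moreover have "0 \<in> l -` W" using x by (simp add: l_def)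
  ultimately obtain \<epsilon> where \<epsilon>: "\<epsilon> > 0" "ball 0 \<epsilon> \<subseteq> l -` W" using open_contains_ball by blast
  let ?I = "{- \<epsilon><..<\<epsilon>}"
  have I: "l t \<in> W" if "t \<in> ?I" for t using that \<epsilon>(2) by (auto simp: dist_real_def subset_iff)
  define \<gamma> where "\<gamma> t = \<psi> (l t)" for t
  have der: "((\<lambda>t. snd c (\<gamma> t)) has_vector_derivative frechet_derivative (snd c \<circ> \<psi>) (at (l t)) u) (at t)"
    if "t \<in> ?I" "c \<in> A" "\<gamma> t \<in> fst c" for t c
  proof -
    have d: "(snd c \<circ> \<psi>) differentiable (at (l t))"
      using Ck_into_differentiable[of 0 \<psi> W "l t" c] C that I by (simp add: \<gamma>_def)
    have "(l has_derivative (\<lambda>h. h *\<^sub>R u)) (at t)"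
      unfolding l_def by (auto intro!: derivative_eq_intros)
    from diff_chain_at[OF this d[unfolded frechet_derivative_works]]
    have "((snd c \<circ> \<psi>) \<circ> l has_derivative (\<lambda>h. h *\<^sub>R frechet_derivative (snd c \<circ> \<psi>) (at (l t)) u)) (at t)"
      by (simp add: o_def linear_scale[OF linear_frechet_derivative[OF d], unfolded o_def])
    then show ?thesis by (simp add: has_vector_derivative_def o_def \<gamma>_def)
  qed
  have C\<gamma>: "Ck_into A 1 \<gamma> ?I"
    unfolding Ck_into_def
  proof (intro conjI ballI)
    show "continuous_on ?I \<gamma>" unfolding \<gamma>_def using I
      by (intro continuous_on_compose2[OF W(2)]) (auto simp: l_def intro!: continuous_intros)
    show "\<gamma> ` ?I \<subseteq> carrier A" using C I by (auto simp: Ck_into_def \<gamma>_def)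
    fix c assume c: "c \<in> A"
    show "Ck_on 1 (snd c \<circ> \<gamma>) (?I \<inter> \<gamma> -` fst c)"
    proof (rule Ck_on_1_I[where f' = "\<lambda>t h. h *\<^sub>R frechet_derivative (snd c \<circ> \<psi>) (at (l t)) u"])
      fix t assume "t \<in> ?I \<inter> \<gamma> -` fst c"
      then show "(snd c \<circ> \<gamma> has_derivative (\<lambda>h. h *\<^sub>R frechet_derivative (snd c \<circ> \<psi>) (at (l t)) u)) (at t)"
        using der[of t c] c by (auto simp: has_vector_derivative_def o_def)
    next
      fix v
      have "continuous_on (W \<inter> \<psi> -` fst c) (\<lambda>x. frechet_derivative (snd c \<circ> \<psi>) (at x) u)"
        by (rule Ck_on_1_continuous_frechet[OF Ck_into_chart[OF C c]])
      then have "continuous_on (?I \<inter> \<gamma> -` fst c) (\<lambda>t. frechet_derivative (snd c \<circ> \<psi>) (at (l t)) u)"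
        by (rule continuous_on_compose2) (use I in \<open>auto simp: \<gamma>_def l_def intro!: continuous_intros\<close>)
      then show "continuous_on (?I \<inter> \<gamma> -` fst c) (\<lambda>t. v *\<^sub>R frechet_derivative (snd c \<circ> \<psi>) (at (l t)) u)"
        by (intro continuous_intros)
    qed
  qed simp
  have "velocity A \<gamma> 0 = dmap A \<psi> x u"
  proof
    fix c show "velocity A \<gamma> 0 c = dmap A \<psi> x u c"
    proof (cases "c \<in> A \<and> \<psi> x \<in> fst c")
      case True
      then show ?thesis using der[of 0 c] \<epsilon> velocity_eqI[of c \<gamma> 0]
        by (auto simp: dmap_def \<gamma>_def l_def)
    next
      case False
      then show ?thesis by (auto simp: velocity_def dmap_def \<gamma>_def l_def)
    qed
  qed
  moreover have "curve_in_from A N (\<psi> x) \<gamma>"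
    unfolding curve_in_from_def using C\<gamma> \<epsilon>(1) I local_param_subset[OF \<psi>]
    by (auto simp: \<gamma>_def l_def intro!: exI[of _ \<epsilon>])
  ultimately show ?thesis unfolding tangent_sub_def by (auto intro!: exI[of _ \<gamma>])
qed

text \<open>Together with \<open>dmap_in_tangent_sub\<close> this identifies the tangent space of \<open>N\<close>, defined through curves,
  with the image of the differential of any parametrisation.\<close>

lemma tangent_sub_in_range:
  fixes \<psi> :: "'a::euclidean_space \<Rightarrow> 'm"
  assumes \<psi>: "local_param A N W \<psi>" and x: "x \<in> W" and v: "v \<in> tangent_sub A N (\<psi> x)"
  shows "\<exists>u. v = dmap A \<psi> x u"
proof -
  obtain \<gamma> \<epsilon> where \<gamma>: "v = velocity A \<gamma> 0" "\<epsilon> > 0" "Ck_into A 1 \<gamma> {- \<epsilon><..<\<epsilon>}" "\<gamma> ` {- \<epsilon><..<\<epsilon>} \<subseteq> N" "\<gamma> 0 = \<psi> x"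
    using v by (auto simp: tangent_sub_def curve_in_from_def)
  obtain \<kappa> where \<kappa>: "homeomorphism W (\<psi> ` W) \<psi> \<kappa>" and op: "openin (top_of_set N) (\<psi> ` W)"
    using \<psi> by (auto simp: local_param_def)
  have cont: "continuous_on {- \<epsilon><..<\<epsilon>} \<gamma>" using \<gamma>(3) by (simp add: Ck_into_def)
  note lift = param_inverse_along_curve[OF \<kappa> op _ cont \<gamma>(4), of 0]
  have y: "isCont (\<lambda>r. \<kappa> (\<gamma> r)) 0" "\<forall>\<^sub>F r in nhds 0. r \<in> {- \<epsilon><..<\<epsilon>} \<and> \<gamma> r \<in> \<psi> ` W"
    using lift \<gamma> x by auto
  have y0: "\<kappa> (\<gamma> 0) = x" using \<kappa> x \<gamma>(5) by (simp add: homeomorphism_apply1)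
  obtain c where c: "c \<in> A" "\<psi> x \<in> fst c" using Ck_into_carrier[OF param_C1[OF \<psi>] x] by blast
  obtain X where X: "open X" "0 \<in> X" "\<And>r. r \<in> X \<Longrightarrow> \<gamma> r \<in> \<psi> ` W"
    using y(2) unfolding eventually_nhds by blast
  have "((\<lambda>t. snd c (\<gamma> t)) has_vector_derivative v c) (at 0)"
    using curve_chart_derivative[of 0 \<gamma> "{- \<epsilon><..<\<epsilon>}" 0 c] \<gamma> c by simp
  then have "((\<lambda>t. snd c (\<psi> (\<kappa> (\<gamma> t)))) has_vector_derivative v c) (at 0)"
    by (rule has_vector_derivative_transform_within_open[OF _ X(1,2)])
       (simp add: homeomorphism_apply2[OF \<kappa>] X(3))
  then have "v c \<in> range (\<lambda>u. dmap A \<psi> x u c)"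
    using dmap_param_linear[OF \<psi> x c] y(1) y0
    by (intro derivative_in_range[of "\<lambda>y. snd c (\<psi> y)" _ "\<lambda>t. \<kappa> (\<gamma> t)"]) auto
  then obtain u where u: "v c = dmap A \<psi> x u c" by blast
  have "v = dmap A \<psi> x u"
    by (rule tangent_eqI[OF tangent_sub_subset_tangent_space[OF v] dmap_param_tangent[OF \<psi> x] c u])
  then show ?thesis by blast
qed

lemma tangent_sub_mono: "N \<subseteq> N' \<Longrightarrow> tangent_sub A N p \<subseteq> tangent_sub A N' p"
  unfolding tangent_sub_def curve_in_from_def by blast

end

section \<open>The transversal null vectors along a cross-section\<close>

context lorentzian
begin

lemma metric_tscale:
  assumes "v \<in> tangent_space A p" "w \<in> tangent_space A p" "p \<in> carrier A"
  shows "g p (tscale a v) w = a * g p v w" and "g p v (tscale a w) = a * g p v w"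
proof -
  obtain c where c: "c \<in> A" "p \<in> fst c" using assms(3) by (auto simp: carrier_def)
  have b: "bilinear (gcomp A g c (snd c p))" using c by (intro bilinear_gcomp) auto
  show "g p (tscale a v) w = a * g p v w" "g p v (tscale a w) = a * g p v w"
    using assms c by (simp_all add: metric_eq_gcomp[OF _ _ c] tangent_tscale tscale_apply
      bilinear_lmul[OF b] bilinear_rmul[OF b])
qed

text \<open>A timelike normal vector of \<open>H\<close> would be orthogonal to the null vector that makes \<open>H\<close> degenerate; but
  vectors orthogonal to a timelike one are spacelike.\<close>

lemma null_bundle_is_null:
  assumes H: "null_hypersurface TYPE('h::finite) A g H" and p: "p \<in> H"
    and l: "l \<in> null_bundle A g H p" "g p l l \<le> 0"
  shows "g p l l = 0"
proof (rule ccontr)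
  assume "g p l l \<noteq> 0"
  then have neg: "g p l l < 0" using l by simp
  obtain v where v: "v \<in> tangent_sub A H p" "v \<noteq> (\<lambda>_. 0)" "\<forall>w\<in>tangent_sub A H p. g p v w = 0"
    using H p by (auto simp: null_hypersurface_def)
  have vT: "v \<in> tangent_space A p" using v tangent_sub_subset_tangent_space by blast
  have lT: "l \<in> tangent_space A p" and lv: "g p l v = 0" using l v by (auto simp: null_bundle_def)
  have "p \<in> carrier A" using H p by (auto simp: null_hypersurface_def submanifold_def)
  then obtain c where c: "c \<in> A" "p \<in> fst c" by (auto simp: carrier_def)
  have "v c \<noteq> 0"
  proof
    assume "v c = 0"
    then have "v = tscale 0 v"
      using tangent_eqI[OF vT tangent_tscale[OF vT, of 0] c] by (simp add: tscale_apply)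
    then show False using v(2) by (auto simp: tscale_def fun_eq_iff)
  qed
  then have "g p v v > 0"
    using orthogonal_to_timelike_is_spacelike[OF c(1), of "snd c p" "l c" "v c"] neg lv c
    by (simp add: metric_eq_gcomp[OF _ _ c] vT lT)
  then show False using v by auto
qed

lemma transversal_vector_unique:
  assumes H: "null_hypersurface TYPE('h::finite) A g H"
    and S: "spacelike_cross_section TYPE('s::finite) A g H S" and z: "z \<in> S"
    and l: "l \<in> null_bundle A g H z" "g z l l \<le> 0"
    and k: "k \<in> tangent_space A z" "\<forall>X\<in>tangent_sub A S z. g z k X = 0" "g z k l = - 1" "g z k k = 0"
    and k': "k' \<in> tangent_space A z" "\<forall>X\<in>tangent_sub A S z. g z k' X = 0" "g z k' l = - 1" "g z k' k' = 0"
  shows "k' = k"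
proof -
  have zH: "z \<in> H" and SH: "S \<subseteq> H" and dim: "CARD('s) + 2 = CARD('n)"
    and pos: "\<And>v. v \<in> tangent_sub A S z \<Longrightarrow> v \<noteq> (\<lambda>_. 0) \<Longrightarrow> g z v v > 0"
    using S z by (auto simp: spacelike_cross_section_def)
  obtain W and \<sigma> :: "real^'s \<Rightarrow> 'm" and x where \<sigma>: "local_param A S W \<sigma>" "x \<in> W" "z = \<sigma> x"
    using submanifold_param[of A S S z] S z by (auto simp: spacelike_cross_section_def)
  obtain c where c: "c \<in> A" "\<sigma> x \<in> fst c" using Ck_into_carrier[OF param_C1[OF \<sigma>(1)] \<sigma>(2)] by blast
  then have cz: "c \<in> A" "z \<in> fst c" using \<sigma> by auto
  have x: "snd c z \<in> snd c ` fst c" using cz by auto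
  define F where "F u = dmap A \<sigma> x u c" for u
  have F: "linear F" "inj F" unfolding F_def using dmap_param_linear[OF \<sigma>(1,2) c] by auto
  have d: "dmap A \<sigma> x u \<in> tangent_sub A S z" "dmap A \<sigma> x u \<in> tangent_space A z" for u
    using dmap_in_tangent_sub[OF \<sigma>(1,2)] dmap_param_tangent[OF \<sigma>(1,2)] \<sigma>(3) by auto
  have lT: "l \<in> tangent_space A z" and lo: "\<And>w. w \<in> tangent_sub A H z \<Longrightarrow> g z l w = 0"
    using l by (auto simp: null_bundle_def)
  note G = metric_eq_gcomp[OF _ _ cz]
  have "k' c = k c"
  proof (rule null_normal_unique[where B = "gcomp A g c (snd c z)" and F = F and l = "l c"])
    show "DIM(real^'s) + 2 = DIM(real^'n)" using dim by simp
    show "bilinear (gcomp A g c (snd c z))" by (rule bilinear_gcomp[OF cz(1) x])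
    show "gcomp A g c (snd c z) u v = gcomp A g c (snd c z) v u" for u v by (rule gcomp_sym[OF cz(1) x])
    show "(\<And>v. gcomp A g c (snd c z) u v = 0) \<Longrightarrow> u = 0" for u by (rule gcomp_nondegenerate[OF cz(1) x])
    show "gcomp A g c (snd c z) (F u) (F u) > 0" if "u \<noteq> 0" for u
    proof -
      have "F u \<noteq> 0" using F that by (metis linear_injective_0)
      then have "dmap A \<sigma> x u \<noteq> (\<lambda>_. 0)" by (auto simp: F_def)
      then show ?thesis using pos[OF d(1)] G[OF d(2) d(2)] by (simp add: F_def)
    qed
    show "gcomp A g c (snd c z) (l c) (F u) = 0" for u
    proof -
      have "dmap A \<sigma> x u \<in> tangent_sub A H z" using d(1) tangent_sub_mono[OF SH] by blast
      from lo[OF this] G[OF lT d(2)[of u]] show ?thesis by (simp add: F_def)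
    qed
    show "gcomp A g c (snd c z) (l c) (l c) = 0"
      using null_bundle_is_null[OF H zH l] G[OF lT lT] by simp
    show "gcomp A g c (snd c z) (k c) (F u) = 0" "gcomp A g c (snd c z) (k' c) (F u) = 0" for u
      using k(2) k'(2) d(1)[of u] G[OF k(1) d(2)[of u]] G[OF k'(1) d(2)[of u]] by (auto simp: F_def)
    show "gcomp A g c (snd c z) (k c) (l c) = - 1" "gcomp A g c (snd c z) (k' c) (l c) = - 1"
      "gcomp A g c (snd c z) (k c) (k c) = 0" "gcomp A g c (snd c z) (k' c) (k' c) = 0"
      using k k' lT by (simp_all add: G[symmetric])
  qed (rule F)
  then show ?thesis using tangent_eqI[OF k'(1) k(1) cz] by simp
qed

section \<open>Flow lines of proportional null fields\<close>

lemma null_flow_scaled: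
  "null_flow A g (\<lambda>p. tscale (\<phi> p) (L p)) (z, s) = null_flow A g L (z, \<phi> z * s)"
  by (simp add: null_flow_def tscale_def mult_ac)

text \<open>Through every point of a flow domain runs a geodesic from its foot point \<open>z\<close> in \<open>S\<close>, inside the domain,
  on which the flow is the motion along that geodesic.\<close>

lemma flow_line_geodesic:
  assumes fd: "flow_domain TYPE('h::finite) TYPE('s::finite) A g H L S V \<Omega>" and V: "(z, t) \<in> V"
  obtains \<delta> I where "geodesic A g \<delta> I" "0 \<in> I" "t \<in> I" "\<And>s. s \<in> I \<Longrightarrow> (z, s) \<in> V"
    "\<And>s. s \<in> I \<Longrightarrow> null_flow A g L (z, s) = \<delta> s" "\<delta> 0 = z" "velocity A \<delta> 0 = L z"
proof -
  have "openin (top_of_set (S \<times> UNIV)) V" using fd by (simp add: flow_domain_def)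
  then obtain Q where Q: "open Q" "V = (S \<times> UNIV) \<inter> Q" by (auto simp: openin_open)
  have z: "z \<in> S" using V Q by auto
  define J where "J = {t. (z, t) \<in> V}"
  have J_eq: "J = Pair z -` Q" using Q z by (auto simp: J_def)
  have oJ: "open J" unfolding J_eq using Q(1) by (intro open_vimage continuous_intros)
  have J: "is_interval J" "0 \<in> J" "t \<in> J" using fd z V by (auto simp: flow_domain_def J_def)
  \<comment> \<open>for \<open>t = 0\<close> the exponential map must be evaluated at another time to find the geodesic\<close>
  obtain t1 where t1: "t1 \<in> J" "t1 \<noteq> 0" "t = 0 \<or> t1 = t"
  proof (cases "t = 0")
    case True
    obtain e where "e > 0" "ball 0 e \<subseteq> J" using oJ J(2) open_contains_ball by blast
    then have "e / 2 \<in> J" by (auto simp: dist_real_def subset_iff)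
    then show ?thesis using that[of "e / 2"] \<open>e > 0\<close> True by simp
  qed (use that J in blast)
  have "exp_defined A g z (tscale t1 (L z))" using fd t1(1) by (auto simp: flow_domain_def J_def)
  then obtain \<delta> K where \<delta>: "geodesic A g \<delta> K" "0 \<in> K" "t1 \<in> K" "\<delta> 0 = z" "velocity A \<delta> 0 = L z"
    "\<And>s. s \<in> K \<Longrightarrow> exp_map A g z (tscale s (L z)) = \<delta> s"
    using exp_map_along_geodesic[OF _ t1(2)] by metis
  have "geodesic A g \<delta> (J \<inter> K)"
    using \<delta>(1) oJ J(1) by (intro geodesic_subset[OF \<delta>(1)] is_interval_Int) (auto simp: geodesic_def)
  then show ?thesis
    by (rule that) (use J \<delta> t1 in \<open>auto simp: J_def null_flow_def\<close>)
qed

text \<open>The definition of a flow domain gives smoothness of the two components of the inverse flow in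
  parametrisations of \<open>\<Omega>\<close>; a continuous curve in \<open>\<Omega>\<close> lifts locally to such a parametrisation.\<close>

lemma flow_inverse_isCont:
  fixes \<gamma> :: "real \<Rightarrow> 'm"
  assumes fd: "flow_domain TYPE('h::finite) TYPE('s::finite) A g H L S V \<Omega>"
    and H: "submanifold TYPE(real^'h) A H"
    and I: "open I" "continuous_on I \<gamma>" "\<gamma> ` I \<subseteq> \<Omega>" "s \<in> I"
  shows "isCont (\<lambda>r. inv_into V (null_flow A g L) (\<gamma> r)) s"
proof -
  let ?\<Phi> = "inv_into V (null_flow A g L)"
  have \<Omega>: "openin (top_of_set H) \<Omega>" using fd unfolding flow_domain_def by blast
  obtain W and \<psi> :: "real^'h \<Rightarrow> 'm" and x where \<psi>: "local_param A \<Omega> W \<psi>" "x \<in> W" "\<gamma> s = \<psi> x"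
    using submanifold_param[OF H \<Omega>] I by (metis imageI subsetD)
  obtain \<kappa> where \<kappa>: "homeomorphism W (\<psi> ` W) \<psi> \<kappa>" and op: "openin (top_of_set \<Omega>) (\<psi> ` W)"
    using \<psi>(1) by (auto simp: local_param_def)
  note lift = param_inverse_along_curve[OF \<kappa> op I(1,2,3,4)]
  have \<kappa>s: "\<kappa> (\<gamma> s) = x" using \<kappa> \<psi> by (simp add: homeomorphism_apply1)
  have "Ck_into A 1 (\<lambda>y. fst (?\<Phi> (\<psi> y))) W" "Ck_on 1 (\<lambda>y. snd (?\<Phi> (\<psi> y))) W"
    using fd \<psi>(1) unfolding flow_domain_def by blast+
  then have "isCont (\<lambda>y. fst (?\<Phi> (\<psi> y))) x" "isCont (\<lambda>y. snd (?\<Phi> (\<psi> y))) x"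
    using Ck_into_isCont \<psi>(2)
      differentiable_imp_continuous_within[OF Ck_on_frechet(2)[of 0 "\<lambda>y. snd (?\<Phi> (\<psi> y))" W x]]
    by (metis, metis One_nat_def)
  then have "isCont (\<lambda>y. (fst (?\<Phi> (\<psi> y)), snd (?\<Phi> (\<psi> y)))) x" by (rule isCont_Pair)
  then have "isCont (\<lambda>y. ?\<Phi> (\<psi> y)) x" by simp
  then have a: "isCont (\<lambda>r. ?\<Phi> (\<psi> (\<kappa> (\<gamma> r)))) s"
    using isCont_o2[of s "\<lambda>r. \<kappa> (\<gamma> r)" "\<lambda>y. ?\<Phi> (\<psi> y)"] lift(1) \<psi>(3) \<psi>(2) \<kappa>s \<psi> I by auto
  have e: "\<forall>\<^sub>F r in nhds s. ?\<Phi> (\<psi> (\<kappa> (\<gamma> r))) = ?\<Phi> (\<gamma> r)"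
    using lift(2) \<psi> by (auto elim!: eventually_mono simp: homeomorphism_apply2[OF \<kappa>])
  show ?thesis using isCont_cong[OF e] a by simp
qed

text \<open>Both flows attach the points of a flow line to the same foot point. The set of times \<open>s\<close> at which this
  holds contains \<open>0\<close> and is open because \<open>V'\<close> is. It is closed by continuity: at the times in the set
  the inverse of the second flow takes the value \<open>(z, s / \<phi> z)\<close> along the line, and this persists in
  the limit.\<close>

lemma flow_line_in_scaled_domain:
  fixes L \<phi> z
  defines "L' \<equiv> (\<lambda>p. tscale (\<phi> p) (L p))"
  assumes fd: "flow_domain TYPE('h::finite) TYPE('s::finite) A g H L S V \<Omega>"
    and fd': "flow_domain TYPE('h) TYPE('s) A g H L' S V' \<Omega>"
    and H: "submanifold TYPE(real^'h) A H"
    and z: "z \<in> S" and pos: "\<phi> z > 0"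
    and \<delta>: "geodesic A g \<delta> I" "0 \<in> I" "\<And>s. s \<in> I \<Longrightarrow> (z, s) \<in> V"
      "\<And>s. s \<in> I \<Longrightarrow> null_flow A g L (z, s) = \<delta> s"
    and s: "s \<in> I"
  shows "(z, s / \<phi> z) \<in> V'"
proof -
  have oI: "open I" "is_interval I" and CI: "continuous_on I \<delta>"
    using \<delta>(1) by (auto simp: geodesic_def Ck_into_def)
  obtain Q where Q: "open Q" "V' = (S \<times> UNIV) \<inter> Q"
    using fd' by (auto simp: flow_domain_def openin_open)
  let ?\<Phi> = "inv_into V' (null_flow A g L')"
  have inj: "inj_on (null_flow A g L') V'" and im: "\<Omega> = null_flow A g L' ` V'" "\<Omega> = null_flow A g L ` V"
    using fd fd' by (auto simp: flow_domain_def)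
  have \<delta>\<Omega>: "\<delta> ` I \<subseteq> \<Omega>" unfolding im(2) using \<delta> by (metis image_eqI image_subsetI)
  have flow': "null_flow A g L' (z, r / \<phi> z) = null_flow A g L (z, r)" for r
    unfolding L'_def null_flow_scaled using pos by simp
  have cp: "isCont (\<lambda>r. (z, r / \<phi> z)) s" for s by (intro continuous_intros) (use pos in auto)
  show ?thesis
  proof (rule interval_continuation[OF oI, where P = "\<lambda>s. (z, s / \<phi> z) \<in> V'", OF \<delta>(2) _ _ _ s])
    show "(z, 0 / \<phi> z) \<in> V'" using fd' z by (auto simp: flow_domain_def)
  next
    fix s assume "s \<in> I" "(z, s / \<phi> z) \<in> V'"
    then have "(z, s / \<phi> z) \<in> Q" using Q by auto
    moreover have "((\<lambda>r. (z, r / \<phi> z)) \<longlongrightarrow> (z, s / \<phi> z)) (nhds s)"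
      using cp[of s] by (simp add: isCont_def tendsto_nhds_iff)
    ultimately have "\<forall>\<^sub>F r in nhds s. (z, r / \<phi> z) \<in> Q" using Q(1) topological_tendstoD by blast
    then show "\<forall>\<^sub>F r in nhds s. (z, r / \<phi> z) \<in> V'" using Q(2) z by (auto elim: eventually_mono)
  next
    fix s assume s: "s \<in> I" "(z, s / \<phi> z) \<notin> V'"
    \<comment> \<open>the inverse image of \<open>\<delta> s\<close> lies in \<open>V'\<close>, so it is not \<open>(z, s / \<phi> z)\<close>;
    both depend continuously on \<open>s\<close>\<close>
    have "?\<Phi> (\<delta> s) \<in> V'" using \<delta>\<Omega> s im(1) by (metis image_subset_iff inv_into_into)
    then have ne: "?\<Phi> (\<delta> s) \<noteq> (z, s / \<phi> z)" using s by metis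
    obtain U1 U2 where U: "open U1" "open U2" "?\<Phi> (\<delta> s) \<in> U1" "(z, s / \<phi> z) \<in> U2" "U1 \<inter> U2 = {}"
      using hausdorff[OF ne] by blast
    have "((\<lambda>r. ?\<Phi> (\<delta> r)) \<longlongrightarrow> ?\<Phi> (\<delta> s)) (nhds s)" "((\<lambda>r. (z, r / \<phi> z)) \<longlongrightarrow> (z, s / \<phi> z)) (nhds s)"
      using flow_inverse_isCont[OF fd' H oI(1) CI \<delta>\<Omega> s(1)] cp[of s] by (simp_all add: isCont_def tendsto_nhds_iff)
    then have "\<forall>\<^sub>F r in nhds s. ?\<Phi> (\<delta> r) \<in> U1" "\<forall>\<^sub>F r in nhds s. (z, r / \<phi> z) \<in> U2"
      using U topological_tendstoD by blast+
    moreover have "\<forall>\<^sub>F r in nhds s. r \<in> I" using oI(1) s(1) by (rule eventually_nhds_in_open)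
    ultimately have "\<forall>\<^sub>F r in nhds s. ?\<Phi> (\<delta> r) \<in> U1 \<and> (z, r / \<phi> z) \<in> U2 \<and> r \<in> I"
      by (intro eventually_conj)
    then show "\<forall>\<^sub>F r in nhds s. (z, r / \<phi> z) \<notin> V'"
    proof (rule eventually_mono, intro notI)
      fix r assume r: "?\<Phi> (\<delta> r) \<in> U1 \<and> (z, r / \<phi> z) \<in> U2 \<and> r \<in> I" and V': "(z, r / \<phi> z) \<in> V'"
      have "?\<Phi> (\<delta> r) = (z, r / \<phi> z)" using inv_into_f_f[OF inj V'] r by (simp add: flow' \<delta>(4))
      then show False using r U(5) by (metis IntI empty_iff)
    qed
  qed
qed

text \<open>On a flow line both \<open>K\<close> and \<open>\<phi> z\<close> times \<open>K'\<close> are parallel, the latter after the change of speed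
  between the two flows, and they agree at the foot point \<open>z\<close> by uniqueness of the transversal null
  vector. Transversality identifies \<open>\<phi> z\<close> with the value of \<open>\<phi>\<close> at the point considered.\<close>

lemma transversal_field_scaled:
  fixes L \<phi>
  defines "L' \<equiv> (\<lambda>p. tscale (\<phi> p) (L p))"
  assumes H: "null_hypersurface TYPE('h::finite) A g H"
    and L: "null_geodesic_field TYPE('h) A g T H D L"
    and S: "spacelike_cross_section TYPE('s::finite) A g H S" "S \<subseteq> D"
    and pos: "\<And>p. p \<in> H \<Longrightarrow> \<phi> p > 0" and tr: "transverse A g H \<phi>"
    and fd: "flow_domain TYPE('h) TYPE('s) A g H L S V \<Omega>"
    and fd': "flow_domain TYPE('h) TYPE('s) A g H L' S V' \<Omega>"
    and K: "transversal_field A g L S V K" and K': "transversal_field A g L' S V' K'"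
    and p: "p \<in> \<Omega>"
  shows "K p \<in> tangent_space A p" and "K' p = tscale (1 / \<phi> p) (K p)"
proof -
  have sub: "submanifold TYPE(real^'h) A H" using H by (simp add: null_hypersurface_def)
  obtain z t where zt: "(z, t) \<in> V" "p = null_flow A g L (z, t)" using p fd by (auto simp: flow_domain_def)
  have z: "z \<in> S" using zt fd by (auto simp: flow_domain_def dest: openin_imp_subset)
  then have zH: "z \<in> H" and zD: "z \<in> D" using S by (auto simp: spacelike_cross_section_def)
  define f where "f = \<phi> z"
  have f: "f > 0" using pos[OF zH] by (simp add: f_def)
  obtain \<delta> I where \<delta>: "geodesic A g \<delta> I" "0 \<in> I" "t \<in> I" "\<And>s. s \<in> I \<Longrightarrow> (z, s) \<in> V"
    "\<And>s. s \<in> I \<Longrightarrow> null_flow A g L (z, s) = \<delta> s" "\<delta> 0 = z" "velocity A \<delta> 0 = L z"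
    using flow_line_geodesic[OF fd zt(1)] by metis
  have pt: "p = \<delta> t" using zt \<delta> by simp
  have oI: "open I" and CI: "Ck_into A 1 \<delta> I" and int: "is_interval I" using \<delta>(1) by (auto simp: geodesic_def Ck_into_def)
  have Lz: "L z \<in> null_bundle A g H z" "L z \<noteq> (\<lambda>_. 0)" "g z (L z) (L z) \<le> 0"
    using L zD by (auto simp: null_geodesic_field_def future_directed_def)
  have "\<delta> ` I \<subseteq> H" using fd \<delta>(4,5) unfolding flow_domain_def by (metis (mono_tags, lifting) case_prodD image_subsetI)
  then have \<phi>p: "\<phi> p = f"
    using tr zH Lz \<delta> unfolding transverse_def f_def pt by blast
  have V': "(z, s / f) \<in> V'" if "s \<in> I" for s
    unfolding f_def using flow_line_in_scaled_domain[OF fd fd'[unfolded L'_def] sub z pos[OF zH] \<delta>(1,2,4,5) that] .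
  have parK: "parallel_along A g \<delta> (\<lambda>s. K (\<delta> s)) I"
  proof (rule parallel_along_cong[OF _ oI _ CI])
    show "parallel_along A g (\<lambda>t. null_flow A g L (z, t)) (\<lambda>t. K (null_flow A g L (z, t))) {t. (z, t) \<in> V}"
      using K z by (simp add: transversal_field_def)
  qed (use \<delta> in auto)
  have parK': "parallel_along A g \<delta> (\<lambda>s. K' (\<delta> s)) I"
  proof -
    let ?I = "{s. f * s \<in> I}"
    have fl: "null_flow A g L' (z, s) = \<delta> (f * s)" if "s \<in> ?I" for s
      using that \<delta>(5) by (simp add: L'_def null_flow_scaled f_def)
    note CI' = Ck_into_rescale[OF CI, of f]
    have "parallel_along A g (\<lambda>s. \<delta> (f * s)) (\<lambda>s. K' (\<delta> (f * s))) ?I"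
    proof (rule parallel_along_cong[OF _ _ _ CI'])
      show "parallel_along A g (\<lambda>t. null_flow A g L' (z, t)) (\<lambda>t. K' (null_flow A g L' (z, t))) {t. (z, t) \<in> V'}"
        using K' z by (simp add: transversal_field_def)
      show "open ?I" using CI' by (simp add: Ck_into_def)
      show "?I \<subseteq> {t. (z, t) \<in> V'}" using V' f by force
    qed (simp_all add: fl)
    from parallel_along_rescale[OF this CI', of "1 / f"] show ?thesis using f by simp
  qed
  have Kz: "K z \<in> tangent_space A z" "\<forall>X\<in>tangent_sub A S z. g z (K z) X = 0" "g z (K z) (L z) = - 1" "g z (K z) (K z) = 0"
    and K'z: "K' z \<in> tangent_space A z" "\<forall>X\<in>tangent_sub A S z. g z (K' z) X = 0" "g z (K' z) (L' z) = - 1" "g z (K' z) (K' z) = 0"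
    using K K' z by (auto simp: transversal_field_def)
  have zA: "z \<in> carrier A" using sub zH by (auto simp: submanifold_def)
  have LT: "L z \<in> tangent_space A z" using Lz by (simp add: null_bundle_def)
  have "tscale f (K' z) = K z"
  proof (rule transversal_vector_unique[OF H S(1) z Lz(1,3) Kz])
    show "tscale f (K' z) \<in> tangent_space A z" using K'z by (simp add: tangent_tscale)
    show "\<forall>X\<in>tangent_sub A S z. g z (tscale f (K' z)) X = 0"
      using K'z metric_tscale(1)[OF K'z(1) tangent_sub_subset_tangent_space zA] by simp
    show "g z (tscale f (K' z)) (L z) = - 1"
      using K'z(3) metric_tscale[OF K'z(1) LT zA] by (simp add: L'_def f_def)
    show "g z (tscale f (K' z)) (tscale f (K' z)) = 0"
      using K'z(1,4) metric_tscale[OF _ _ zA] by (simp add: tangent_tscale)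
  qed
  then have "K (\<delta> t) = tscale f (K' (\<delta> t))"
    using parallel_unique[OF CI int parK parallel_along_tscale[OF parK', of f] \<delta>(2) _ \<delta>(3)] \<delta>(6) by simp
  then show "K' p = tscale (1 / \<phi> p) (K p)" using f \<phi>p by (simp add: pt[symmetric] tscale_def)
  show "K p \<in> tangent_space A p" using parK \<delta>(3) by (simp add: parallel_along_def pt)
qed

end

section \<open>Measures with proportional densities\<close>

text \<open>The function \<open>w\<close> is arbitrary: the integral is the supremum over the simple functions below the
  integrand, and scaling by \<open>1 / c\<close> maps those below \<open>c w\<close> to those below \<open>w\<close>.\<close>

lemma nn_integral_cmult_le:
  assumes c: "c > 0"
  shows "(\<integral>\<^sup>+ x. ennreal c * w x \<partial>M) \<le> ennreal c * (\<integral>\<^sup>+ x. w x \<partial>M)"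
  unfolding nn_integral_def[of M "\<lambda>x. ennreal c * w x"]
proof (rule SUP_least)
  fix h assume "h \<in> {g. simple_function M g \<and> g \<le> (\<lambda>x. ennreal c * w x)}"
  then have h: "simple_function M h" "\<And>x. h x \<le> ennreal c * w x" by (auto simp: le_fun_def)
  have inv: "ennreal c * (ennreal (1 / c) * a) = a" "ennreal (1 / c) * (ennreal c * a) = a" for a
    using c by (simp_all add: mult.assoc[symmetric] ennreal_mult[symmetric])
  have s: "simple_function M (\<lambda>x. ennreal (1 / c) * h x)"
    using h(1) by (intro simple_function_mult) auto
  have "integral\<^sup>S M h = (\<integral>\<^sup>+ x. h x \<partial>M)" using h by (simp add: nn_integral_eq_simple_integral)
  also have "\<dots> = (\<integral>\<^sup>+ x. ennreal c * (ennreal (1 / c) * h x) \<partial>M)" by (simp add: inv)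
  also have "\<dots> = ennreal c * (\<integral>\<^sup>+ x. ennreal (1 / c) * h x \<partial>M)"
    using s by (intro nn_integral_cmult borel_measurable_simple_function)
  also have "\<dots> \<le> ennreal c * (\<integral>\<^sup>+ x. w x \<partial>M)"
  proof (intro mult_left_mono nn_integral_mono)
    fix x show "ennreal (1 / c) * h x \<le> w x"
      using mult_left_mono[OF h(2)[of x], of "ennreal (1 / c)"] by (simp add: inv)
  qed auto
  finally show "integral\<^sup>S M h \<le> ennreal c * (\<integral>\<^sup>+ x. w x \<partial>M)" .
qed

lemma emeasure_le_countable_partition:
  assumes sets: "sets M = sets N" and I: "countable I" and disj: "disjoint_family_on Q I"
    and Q: "\<And>i. i \<in> I \<Longrightarrow> Q i \<in> sets N" and cov: "space N \<subseteq> (\<Union>i\<in>I. Q i)"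
    and le: "\<And>i Y. i \<in> I \<Longrightarrow> Y \<in> sets N \<Longrightarrow> Y \<subseteq> Q i \<Longrightarrow> emeasure M Y \<le> r * emeasure N Y"
    and X: "X \<in> sets N"
  shows "emeasure M X \<le> r * emeasure N X"
proof -
  have eq: "X = (\<Union>i\<in>I. X \<inter> Q i)" using cov sets.sets_into_space[OF X] by auto
  have d: "disjoint_family_on (\<lambda>i. X \<inter> Q i) I" using disj by (auto simp: disjoint_family_on_def)
  have m: "X \<inter> Q i \<in> sets N" if "i \<in> I" for i using X Q[OF that] by auto
  have "emeasure M X = (\<integral>\<^sup>+ i. emeasure M (X \<inter> Q i) \<partial>count_space I)"
    by (subst eq, rule emeasure_UN_countable) (use I d m sets in auto)
  also have "\<dots> \<le> (\<integral>\<^sup>+ i. r * emeasure N (X \<inter> Q i) \<partial>count_space I)"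
    using m by (intro nn_integral_mono le) auto
  also have "\<dots> = r * (\<integral>\<^sup>+ i. emeasure N (X \<inter> Q i) \<partial>count_space I)" by (intro nn_integral_cmult) auto
  also have "(\<integral>\<^sup>+ i. emeasure N (X \<inter> Q i) \<partial>count_space I) = emeasure N X"
    by (subst (2) eq, rule emeasure_UN_countable[symmetric]) (use I d m in auto)
  finally show ?thesis .
qed

lemma ennreal_le_if_le_all_factors:
  fixes a b :: ennreal
  assumes "\<And>r::real. r > 1 \<Longrightarrow> a \<le> ennreal r * b"
  shows "a \<le> b"
proof -
  have "(\<lambda>n. ennreal (1 + 1 / real (Suc n)) * b) \<longlonglongrightarrow> ennreal 1 * b"
  proof (rule tendsto_mult_ennreal)
    have "(\<lambda>n. 1 + 1 / real (Suc n)) \<longlonglongrightarrow> 1 + 0"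
      by (intro tendsto_add tendsto_const LIMSEQ_Suc[OF lim_1_over_n])
    then show "(\<lambda>n. ennreal (1 + 1 / real (Suc n))) \<longlonglongrightarrow> ennreal 1" by (intro tendsto_ennrealI) simp
  qed auto
  then have "(\<lambda>n. ennreal (1 + 1 / real (Suc n)) * b) \<longlonglongrightarrow> b" by simp
  then show ?thesis
  proof (rule LIMSEQ_le_const)
    have "a \<le> ennreal (1 + 1 / real (Suc n)) * b" for n by (intro assms) simp
    then show "\<exists>N. \<forall>n\<ge>N. a \<le> ennreal (1 + 1 / real (Suc n)) * b" by blast
  qed
qed

text \<open>A measure \<open>\<nu>\<close> is recognised as the density of \<open>f\<close> with respect to \<open>\<mu>\<close> by comparing it with
  constant multiples of \<open>\<mu>\<close> on small sets. For \<open>r > 1\<close> cut the space into the slices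
  \<open>r\<^sup>k \<le> f < r\<^sup>k\<^sup>+\<^sup>1\<close>; on each of them \<open>\<nu>\<close> and the density agree up to a factor \<open>r\<close>, so they do so on every
  set, and \<open>r\<close> tends to \<open>1\<close>.\<close>

lemma density_eq_of_local_bounds:
  fixes f :: "'a \<Rightarrow> real" and U :: "nat \<Rightarrow> 'a set"
  assumes sets: "sets \<nu> = sets \<mu>" and f: "f \<in> borel_measurable \<mu>" and pos: "\<And>x. x \<in> space \<mu> \<Longrightarrow> f x > 0"
    and U: "\<And>n. U n \<in> sets \<mu>" "space \<mu> \<subseteq> (\<Union>n. U n)"
    and upper: "\<And>n X b. X \<in> sets \<mu> \<Longrightarrow> X \<subseteq> U n \<Longrightarrow> b > 0 \<Longrightarrow> (\<And>x. x \<in> X \<Longrightarrow> f x \<le> b) \<Longrightarrow>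
        emeasure \<nu> X \<le> ennreal b * emeasure \<mu> X"
    and lower: "\<And>n X a. X \<in> sets \<mu> \<Longrightarrow> X \<subseteq> U n \<Longrightarrow> a > 0 \<Longrightarrow> (\<And>x. x \<in> X \<Longrightarrow> a \<le> f x) \<Longrightarrow>
        ennreal a * emeasure \<mu> X \<le> emeasure \<nu> X"
  shows "\<nu> = density \<mu> (\<lambda>x. ennreal (f x))"
proof (rule measure_eqI)
  show "sets \<nu> = sets (density \<mu> (\<lambda>x. ennreal (f x)))" using sets by simp
  define D where "D = density \<mu> (\<lambda>x. ennreal (f x))"
  have setsD: "sets D = sets \<mu>" by (simp add: D_def)
  have D: "emeasure D X = (\<integral>\<^sup>+ x\<in>X. ennreal (f x) \<partial>\<mu>)" if "X \<in> sets \<mu>" for X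
    using that f by (simp add: D_def emeasure_density)
  have Dupper: "emeasure D X \<le> ennreal b * emeasure \<mu> X"
    if "X \<in> sets \<mu>" "\<And>x. x \<in> X \<Longrightarrow> f x \<le> b" for X b
  proof -
    have "emeasure D X \<le> (\<integral>\<^sup>+ x. ennreal b * indicator X x \<partial>\<mu>)"
      unfolding D[OF that(1)] by (intro nn_integral_mono) (auto simp: indicator_def that intro: ennreal_leI)
    then show ?thesis using that by (simp add: nn_integral_cmult_indicator)
  qed
  have Dlower: "ennreal a * emeasure \<mu> X \<le> emeasure D X"
    if "X \<in> sets \<mu>" "\<And>x. x \<in> X \<Longrightarrow> a \<le> f x" for X a
  proof -
    have "(\<integral>\<^sup>+ x. ennreal a * indicator X x \<partial>\<mu>) \<le> emeasure D X"
      unfolding D[OF that(1)] by (intro nn_integral_mono) (auto simp: indicator_def that intro: ennreal_leI)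
    then show ?thesis using that by (simp add: nn_integral_cmult_indicator)
  qed
  fix X assume "X \<in> sets \<nu>"
  then have X: "X \<in> sets \<mu>" using sets by simp
  have key: "emeasure \<nu> X \<le> ennreal r * emeasure D X \<and> emeasure D X \<le> ennreal r * emeasure \<nu> X"
    if r: "r > 1" for r :: real
  proof -
    \<comment> \<open>slices of \<open>f\<close>, refined by the cover \<open>U\<close> made disjoint\<close>
    define Q where "Q = (\<lambda>(k::int, n). {x\<in>space \<mu>. r powi k \<le> f x \<and> f x < r powi (k + 1)} \<inter> disjointed U n)"
    have Qm: "Q i \<in> sets \<mu>" for i
    proof -
      have "disjointed U n \<in> sets \<mu>" for n using sets.range_disjointed_sets[of U \<mu>] U(1) by blast
      moreover have "{x\<in>space \<mu>. r powi k \<le> f x \<and> f x < r powi (k + 1)} \<in> sets \<mu>" for k :: int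
        using f by measurable
      ultimately show ?thesis by (cases i) (auto simp: Q_def)
    qed
    have Qd: "disjoint_family Q"
    proof (unfold disjoint_family_on_def, intro ballI impI)
      fix i j :: "int \<times> nat" assume ij: "i \<noteq> j"
      have "i = j" if x: "x \<in> Q i" "x \<in> Q j" for x
      proof -
        obtain k n l m where [simp]: "i = (k, n)" "j = (l, m)" by (cases i, cases j) auto
        have "n = m" using x disjoint_family_disjointed[of U] by (auto simp: Q_def disjoint_family_on_def)
        have "r powi k < r powi (l + 1)" "r powi l < r powi (k + 1)" using x by (auto simp: Q_def)
        then have "k < l + 1" "l < k + 1"
          using r power_int_increasing[of "l + 1" k r] power_int_increasing[of "k + 1" l r]
          by (force simp: not_less[symmetric])+
        then show ?thesis using \<open>n = m\<close> by simp
      qed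
      then show "Q i \<inter> Q j = {}" using ij by blast
    qed
    have Qc: "space \<mu> \<subseteq> (\<Union>i\<in>UNIV. Q i)"
    proof
      fix x assume x: "x \<in> space \<mu>"
      obtain n where n: "x \<in> disjointed U n" using x U(2) UN_disjointed_eq[of U] by blast
      define k where "k = \<lfloor>log r (f x)\<rfloor>"
      have fx: "f x = r powr log r (f x)" using r pos[OF x] by simp
      have "r powi k \<le> f x"
        using r by (subst fx) (simp add: k_def powr_real_of_int'[symmetric] powr_mono)
      moreover have "f x < r powi (k + 1)"
      proof -
        have "log r (f x) < of_int (k + 1)" unfolding k_def by linarith
        then show ?thesis
          using r by (subst fx) (simp add: powr_real_of_int'[symmetric] del: powr_log_cancel of_int_add)
      qed
      ultimately show "x \<in> (\<Union>i\<in>UNIV. Q i)" using n x by (auto simp: Q_def)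
    qed
    have step: "ennreal (r powi (k + 1)) * a = ennreal r * (ennreal (r powi k) * a)" for k a
      using r by (simp add: power_int_add ennreal_mult mult_ac)
    have pieces: "emeasure \<nu> Y \<le> ennreal r * emeasure D Y \<and> emeasure D Y \<le> ennreal r * emeasure \<nu> Y"
      if Y: "Y \<in> sets \<mu>" "Y \<subseteq> Q i" for Y i
    proof -
      obtain k n where i: "i = (k, n)" by (cases i)
      have YU: "Y \<subseteq> U n" using Y disjointed_subset[of U n] by (auto simp: Q_def i)
      have b: "f x \<le> r powi (k + 1)" "r powi k \<le> f x" if "x \<in> Y" for x using Y that by (auto simp: Q_def i)
      have p: "r powi k > 0" "r powi (k + 1) > 0" using r by auto
      have "emeasure \<nu> Y \<le> ennreal (r powi (k + 1)) * emeasure \<mu> Y" using upper Y YU p b by blast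
      also have "\<dots> \<le> ennreal r * emeasure D Y" unfolding step using Dlower Y b by (intro mult_left_mono) auto
      finally have 1: "emeasure \<nu> Y \<le> ennreal r * emeasure D Y" .
      have "emeasure D Y \<le> ennreal (r powi (k + 1)) * emeasure \<mu> Y" using Dupper Y b by blast
      also have "\<dots> \<le> ennreal r * emeasure \<nu> Y" unfolding step using lower Y YU p b by (intro mult_left_mono) auto
      finally show ?thesis using 1 by simp
    qed
    have c: "countable (UNIV :: (int \<times> nat) set)" by simp
    show ?thesis
    proof
      have sp: "space \<nu> = space \<mu>" "space D = space \<mu>"
        using sets_eq_imp_space_eq[OF sets] sets_eq_imp_space_eq[OF setsD] by auto
      have sD: "sets \<nu> = sets D" and XD: "X \<in> sets D" "X \<in> sets \<nu>" using sets setsD X by auto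
      have QD: "Q i \<in> sets D" "Q i \<in> sets \<nu>" for i using sets setsD Qm by auto
      have cD: "space D \<subseteq> (\<Union>i\<in>UNIV. Q i)" "space \<nu> \<subseteq> (\<Union>i\<in>UNIV. Q i)" unfolding sp by (fact Qc)+
      have 1: "emeasure \<nu> Y \<le> ennreal r * emeasure D Y" if "Y \<in> sets D" "Y \<subseteq> Q i" for Y i
        using pieces[of Y i] that unfolding setsD by blast
      have 2: "emeasure D Y \<le> ennreal r * emeasure \<nu> Y" if "Y \<in> sets \<nu>" "Y \<subseteq> Q i" for Y i
        using pieces[of Y i] that unfolding sets by blast
      show "emeasure \<nu> X \<le> ennreal r * emeasure D X"
        by (rule emeasure_le_countable_partition[OF sD c Qd QD(1) cD(1) 1 XD(1)])
      show "emeasure D X \<le> ennreal r * emeasure \<nu> X"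
        by (rule emeasure_le_countable_partition[OF sD[symmetric] c Qd QD(2) cD(2) 2 XD(2)])
    qed
  qed
  show "emeasure \<nu> X = emeasure (density \<mu> (\<lambda>x. ennreal (f x))) X"
    unfolding D_def[symmetric]
  proof (rule antisym)
    show "emeasure \<nu> X \<le> emeasure D X" by (rule ennreal_le_if_le_all_factors) (use key in blast)
    show "emeasure D X \<le> emeasure \<nu> X" by (rule ennreal_le_if_le_all_factors) (use key in blast)
  qed
qed

section \<open>Volume densities on null hypersurfaces\<close>

context lorentzian
begin

text \<open>The degenerate direction of \<open>H\<close>, pulled back to the parameter space, is in the kernel of the Gram
  matrix.\<close>

lemma null_gram_matrix_kernel:
  fixes \<psi> :: "real^'h \<Rightarrow> 'm"
  assumes H: "null_hypersurface TYPE('h::finite) A g H" and \<psi>: "local_param A H W \<psi>" "x \<in> W"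
  obtains u where "u \<noteq> 0"
    "u v* (\<chi> i j. g (\<psi> x) (dmap A \<psi> x (axis i 1)) (dmap A \<psi> x (axis j 1))) = 0"
proof -
  have "\<psi> x \<in> H" using local_param_subset[OF \<psi>(1)] \<psi>(2) by auto
  then obtain v where v: "v \<in> tangent_sub A H (\<psi> x)" "v \<noteq> (\<lambda>_. 0)" "\<forall>w\<in>tangent_sub A H (\<psi> x). g (\<psi> x) v w = 0"
    using H by (auto simp: null_hypersurface_def)
  obtain u where u: "v = dmap A \<psi> x u" using tangent_sub_in_range[OF \<psi> v(1)] by blast
  obtain c where c: "c \<in> A" "\<psi> x \<in> fst c" using Ck_into_carrier[OF param_C1[OF \<psi>(1)] \<psi>(2)] by blast
  note lin = dmap_param_linear(1)[OF \<psi> c]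
  note T = dmap_param_tangent[OF \<psi>]
  define B where "B = gcomp A g c (snd c (\<psi> x))"
  have Bl: "linear (\<lambda>v. B v w)" for w
    using bilinear_gcomp[OF c(1), of "snd c (\<psi> x)"] c by (auto simp: bilinear_def B_def)
  have G: "g (\<psi> x) (dmap A \<psi> x a) (dmap A \<psi> x b) = B (dmap A \<psi> x a c) (dmap A \<psi> x b c)" for a b
    unfolding B_def by (rule metric_eq_gcomp[OF T T c])
  have "u \<noteq> 0"
  proof
    assume "u = 0"
    have "dmap A \<psi> x 0 d = 0" for d
    proof (cases "d \<in> A \<and> \<psi> x \<in> fst d")
      case True
      then show ?thesis using linear_0[OF dmap_param_linear(1)[OF \<psi>, of d]] by simp
    qed (auto simp: dmap_def)
    then show False using v(2) u \<open>u = 0\<close> by auto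
  qed
  moreover have "(\<Sum>i\<in>UNIV. u $ i * g (\<psi> x) (dmap A \<psi> x (axis i 1)) (dmap A \<psi> x (axis j 1))) = 0" for j
  proof -
    have e: "u = (\<Sum>i\<in>UNIV. (u $ i) *\<^sub>R axis i 1)"
      by (simp add: vec_eq_iff axis_def if_distrib cong: if_cong)
    have "0 = g (\<psi> x) v (dmap A \<psi> x (axis j 1))"
      using v(3) dmap_in_tangent_sub[OF \<psi>] by simp
    also have "\<dots> = B (dmap A \<psi> x (\<Sum>i\<in>UNIV. (u $ i) *\<^sub>R axis i 1) c) (dmap A \<psi> x (axis j 1) c)"
      using e by (simp add: u G)
    also have "\<dots> = (\<Sum>i\<in>UNIV. u $ i * B (dmap A \<psi> x (axis i 1) c) (dmap A \<psi> x (axis j 1) c))"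
      by (simp add: linear_sum[OF lin] linear_scale[OF lin] linear_sum[OF Bl] linear_scale[OF Bl])
    finally show ?thesis by (simp add: G)
  qed
  ultimately show ?thesis by (intro that[of u]) (simp_all add: vector_matrix_mult_def vec_eq_iff mult.commute)
qed

lemma volume_density_scaled:
  fixes \<psi> :: "real^'h \<Rightarrow> 'm"
  assumes H: "null_hypersurface TYPE('h::finite) A g H" and \<psi>: "local_param A H W \<psi>" "x \<in> W"
    and k: "k \<in> tangent_space A (\<psi> x)" and b: "b > 0"
  defines "e \<equiv> \<lambda>i. dmap A \<psi> x (axis i 1)"
  shows "sqrt (det (\<chi> i j. g (\<psi> x) (e i) (e j) + (- g (\<psi> x) (tscale b k) (e i)) * (- g (\<psi> x) (tscale b k) (e j)))) =
    b * sqrt (det (\<chi> i j. g (\<psi> x) (e i) (e j) + (- g (\<psi> x) k (e i)) * (- g (\<psi> x) k (e j))))"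
proof -
  obtain u where u: "u \<noteq> 0" "u v* (\<chi> i j. g (\<psi> x) (e i) (e j)) = 0"
    unfolding e_def using null_gram_matrix_kernel[OF H \<psi>] by blast
  have "\<psi> x \<in> carrier A" using param_C1[OF \<psi>(1)] \<psi>(2) by (auto simp: Ck_into_def)
  then have sc: "g (\<psi> x) (tscale b k) (e i) = b * g (\<psi> x) k (e i)" for i
    unfolding e_def by (intro metric_tscale(1) k dmap_param_tangent[OF \<psi>])
  define a where "a = (\<chi> i. g (\<psi> x) k (e i))"
  have "det (\<chi> i j. g (\<psi> x) (e i) (e j) + b\<^sup>2 * (a $ i * a $ j)) = b\<^sup>2 * det (\<chi> i j. g (\<psi> x) (e i) (e j) + a $ i * a $ j)"
    using det_rank_one_update[OF u, of "b\<^sup>2" a] by simp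
  then show ?thesis using b by (simp add: sc a_def power2_eq_square mult_ac real_sqrt_mult)
qed

lemma C1_function_continuous:
  assumes H: "submanifold TYPE(real^'h::finite) A H" and \<phi>: "C1_function_on TYPE('h) A H \<phi>"
  shows "continuous_on H \<phi>"
proof (unfold continuous_on_eq_continuous_within, intro ballI)
  fix p assume p: "p \<in> H"
  obtain W and \<psi> :: "real^'h \<Rightarrow> 'm" and x where \<psi>: "local_param A H W \<psi>" "x \<in> W" "p = \<psi> x"
    using submanifold_param[OF H openin_subtopology_self p] by metis
  obtain \<kappa> where \<kappa>: "homeomorphism W (\<psi> ` W) \<psi> \<kappa>" and op: "openin (top_of_set H) (\<psi> ` W)"
    using \<psi>(1) by (auto simp: local_param_def)
  obtain Q where Q: "open Q" "\<psi> ` W = H \<inter> Q" using op by (auto simp: openin_open)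
  have "continuous_on W (\<phi> \<circ> \<psi>)"
    using \<phi> \<psi>(1) Ck_on_Suc_imp[of 0 "\<phi> \<circ> \<psi>" W] by (auto simp: C1_function_on_def)
  then have "continuous_on (\<psi> ` W) ((\<phi> \<circ> \<psi>) \<circ> \<kappa>)"
    by (intro continuous_on_compose[OF homeomorphism_cont2[OF \<kappa>]])
       (simp only: homeomorphism_image2[OF \<kappa>])
  then have "continuous_on (\<psi> ` W) \<phi>"
    by (rule continuous_on_eq) (simp add: homeomorphism_apply2[OF \<kappa>])
  then have "continuous (at p within \<psi> ` W) \<phi>" using \<psi> by (simp add: continuous_on_eq_continuous_within)
  moreover have "at p within \<psi> ` W = at p within H"
    using Q \<psi> by (intro at_within_nhd[of p Q]) auto
  ultimately show "continuous (at p within H) \<phi>" by simp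
qed

text \<open>A pointwise comparison of the densities on the part of the parameter space over \<open>X\<close> integrates to
  one of the measures.\<close>

lemma volume_measure_le:
  fixes q q' :: "('m, 'n) metric" and \<psi> :: "real^'h \<Rightarrow> 'm"
  defines "w \<equiv> \<lambda>q x. sqrt (det (\<chi> i j. q (\<psi> x) (dmap A \<psi> x (axis i 1)) (dmap A \<psi> x (axis j 1))))"
  assumes \<mu>: "is_volume_measure TYPE('h::finite) A \<Omega> q \<mu>" and \<nu>: "is_volume_measure TYPE('h) A \<Omega> q' \<nu>"
    and \<psi>: "local_param A \<Omega> W \<psi>" and X: "X \<in> sets \<mu>" "X \<subseteq> \<psi> ` W" and b: "b > 0"
    and le: "\<And>x. x \<in> W \<Longrightarrow> \<psi> x \<in> X \<Longrightarrow> ennreal (w q' x) \<le> ennreal b * ennreal (w q x)"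
  shows "emeasure \<nu> X \<le> ennreal b * emeasure \<mu> X"
proof -
  have W: "open W" "continuous_on W \<psi>" using \<psi> by (auto simp: local_param_def Ck_into_def)
  obtain Y where Y: "Y \<in> sets borel" "X = \<Omega> \<inter> Y"
    using X(1) \<mu> by (auto simp: is_volume_measure_def sets_restrict_space)
  define B where "B = W \<inter> \<psi> -` X"
  have "\<psi> \<in> borel_measurable (restrict_space borel W)"
    using W(2) by (rule borel_measurable_continuous_on_restrict)
  then have "\<psi> -` Y \<inter> space (restrict_space borel W) \<in> sets (restrict_space borel W)"
    using Y(1) by (rule measurable_sets)
  then have "\<psi> -` Y \<inter> W \<in> sets borel"
    using W(1) by (auto simp: space_restrict_space sets_restrict_space)
  moreover have "B = \<psi> -` Y \<inter> W" using Y(2) local_param_subset[OF \<psi>] by (auto simp: B_def)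
  ultimately have B: "B \<in> sets borel" "B \<subseteq> W" by (auto simp: B_def)
  have XB: "X = \<psi> ` B" using X(2) by (auto simp: B_def)
  have "emeasure \<nu> X = (\<integral>\<^sup>+ x\<in>B. ennreal (w q' x) \<partial>lborel)"
    unfolding XB w_def using \<nu> \<psi> B by (simp add: is_volume_measure_def)
  also have "\<dots> \<le> (\<integral>\<^sup>+ x. ennreal b * (ennreal (w q x) * indicator B x) \<partial>lborel)"
    using le by (intro nn_integral_mono) (auto simp: indicator_def B_def)
  also have "\<dots> \<le> ennreal b * (\<integral>\<^sup>+ x\<in>B. ennreal (w q x) \<partial>lborel)"
    by (rule nn_integral_cmult_le[OF b])
  also have "(\<integral>\<^sup>+ x\<in>B. ennreal (w q x) \<partial>lborel) = emeasure \<mu> X"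
    unfolding XB w_def using \<mu> \<psi> B by (simp add: is_volume_measure_def)
  finally show ?thesis .
qed

end

text \<open>Second countable spaces are Lindelof, so countably many parametrisations suffice. Their enumeration
  by the natural numbers is where \<open>\<Omega>\<close> has to be nonempty.\<close>

lemma countable_param_cover:
  fixes A :: "('m::{t2_space, second_countable_topology}, 'n::finite) chart set"
  assumes "submanifold TYPE('a::euclidean_space) A H" "openin (top_of_set H) \<Omega>" "\<Omega> \<noteq> {}"
  obtains W :: "nat \<Rightarrow> 'a::euclidean_space set" and \<psi> :: "nat \<Rightarrow> 'a \<Rightarrow> 'm" where
    "\<And>n. local_param A \<Omega> (W n) (\<psi> n)" "\<Omega> = (\<Union>n. \<psi> n ` W n)"
proof -
  define F where "F = {U. \<exists>W (\<psi> :: 'a \<Rightarrow> 'm). local_param A \<Omega> W \<psi> \<and> U = \<psi> ` W}"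
  have op: "openin (top_of_set \<Omega>) U" if "U \<in> F" for U using that by (auto simp: F_def local_param_def)
  obtain F' where F': "F' \<subseteq> F" "countable F'" "\<Union>F' = \<Union>F" using Lindelof_openin[OF op] by metis
  have "\<Omega> \<subseteq> \<Union>F"
  proof
    fix p assume p: "p \<in> \<Omega>"
    obtain W and \<psi> :: "'a \<Rightarrow> 'm" and x where "local_param A \<Omega> W \<psi>" "x \<in> W" "p = \<psi> x"
      by (rule submanifold_param[OF assms(1,2) p]) blast
    then show "p \<in> \<Union>F" by (auto simp: F_def)
  qed
  moreover have "\<Union>F \<subseteq> \<Omega>" using op openin_imp_subset by blast
  ultimately have cov: "\<Omega> = \<Union>F'" using F' by simp
  then have ne: "F' \<noteq> {}" using assms(3) by auto
  have "\<exists>W (\<psi> :: 'a \<Rightarrow> 'm). local_param A \<Omega> W \<psi> \<and> from_nat_into F' n = \<psi> ` W" for n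
    using from_nat_into[OF ne, of n] F'(1) by (auto simp: F_def)
  then obtain W \<psi> where W: "\<And>n. local_param A \<Omega> (W n) (\<psi> n :: 'a \<Rightarrow> 'm)" "\<And>n. from_nat_into F' n = \<psi> n ` W n"
    by metis
  have "\<Omega> = (\<Union>n. from_nat_into F' n)" using cov range_from_nat_into[OF ne F'(2)] by simp
  then show ?thesis using that[of W \<psi>] W by simp
qed

section \<open>Scaling of the volume measure\<close>

theorem corollary3p7:
  fixes A :: "('m::{t2_space, second_countable_topology}, 'n::finite) chart set"
    and g :: "('m, 'n) metric"
    and T L :: "'m \<Rightarrow> ('m, 'n) tvec"
    and H D S \<Omega> :: "'m set"
    and \<phi> :: "'m \<Rightarrow> real"
    and \<mu> \<nu> :: "'m measure"
  assumes "lorentzian_manifold A g"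
    and "time_orientation A g T"
    and "null_hypersurface TYPE('h::finite) A g H"
    and "null_geodesic_field TYPE('h) A g T H D L"
    and "spacelike_cross_section TYPE('s::finite) A g H S"
    and "S \<subseteq> D"
    and "C1_function_on TYPE('h) A H \<phi>"
    and "\<forall>p\<in>H. \<phi> p > 0"
    and "transverse A g H \<phi>"
    and "is_tilde_vol TYPE('h) TYPE('s) A g H L S \<Omega> \<mu>"
    and "is_tilde_vol TYPE('h) TYPE('s) A g H (\<lambda>p. tscale (\<phi> p) (L p)) S \<Omega> \<nu>"
  shows "\<nu> = density \<mu> (\<lambda>p. ennreal (1 / \<phi> p))"
proof -
  interpret lorentzian A g by unfold_locales fact
  obtain V K where K: "flow_domain TYPE('h) TYPE('s) A g H L S V \<Omega>" "transversal_field A g L S V K"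
    and \<mu>: "is_volume_measure TYPE('h) A \<Omega> (\<lambda>p v w. g p v w + (- g p (K p) v) * (- g p (K p) w)) \<mu>"
    using assms(10) unfolding is_tilde_vol_def by blast
  obtain V' K' where K': "flow_domain TYPE('h) TYPE('s) A g H (\<lambda>p. tscale (\<phi> p) (L p)) S V' \<Omega>"
      "transversal_field A g (\<lambda>p. tscale (\<phi> p) (L p)) S V' K'"
    and \<nu>: "is_volume_measure TYPE('h) A \<Omega> (\<lambda>p v w. g p v w + (- g p (K' p) v) * (- g p (K' p) w)) \<nu>"
    using assms(11) unfolding is_tilde_vol_def by blast
  have H: "submanifold TYPE(real^'h) A H" using assms(3) by (simp add: null_hypersurface_def)
  have \<Omega>: "openin (top_of_set H) \<Omega>" using K(1) unfolding flow_domain_def by blast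
  then have \<Omega>H: "\<Omega> \<subseteq> H" by (rule openin_imp_subset)
  have posH: "\<And>p. p \<in> H \<Longrightarrow> \<phi> p > 0" using assms(8) by blast
  then have pos: "\<phi> p > 0" if "p \<in> \<Omega>" for p using that \<Omega>H by blast
  have sets: "sets \<nu> = sets \<mu>" "sets \<mu> = sets (restrict_space borel \<Omega>)"
    using \<mu> \<nu> by (simp_all add: is_volume_measure_def)
  have space: "space \<mu> = \<Omega>" using sets_eq_imp_space_eq[OF sets(2)] by (simp add: space_restrict_space)
  show ?thesis
  proof (cases "\<Omega> = {}")
    case True
    then have "sets \<mu> = {{}}" using sets(2) sets.top[of borel] by (auto simp: sets_restrict_space image_constant_conv)
    then show ?thesis using sets by (intro measure_eqI) auto
  next
    case False
    obtain W :: "nat \<Rightarrow> (real^'h) set" and \<psi> where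
      W: "\<And>n. local_param A \<Omega> (W n) (\<psi> n)" "\<Omega> = (\<Union>n. \<psi> n ` W n)"
      using countable_param_cover[OF H \<Omega> False] by blast
    define w where "w K n x = sqrt (det (\<chi> i j.
       g (\<psi> n x) (dmap A (\<psi> n) x (axis i 1)) (dmap A (\<psi> n) x (axis j 1))
       + (- g (\<psi> n x) (K (\<psi> n x)) (dmap A (\<psi> n) x (axis i 1))) * (- g (\<psi> n x) (K (\<psi> n x)) (dmap A (\<psi> n) x (axis j 1)))))"
      for K :: "'m \<Rightarrow> ('m, 'n) tvec" and n x
    have ww: "w K' n x = 1 / \<phi> (\<psi> n x) * w K n x" if "x \<in> W n" for n x
    proof -
      have p: "\<psi> n x \<in> \<Omega>" using W that by blast
      note tf = transversal_field_scaled[OF assms(3-6) _ assms(9) K(1) K'(1) K(2) K'(2) p]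
      have Kp: "K (\<psi> n x) \<in> tangent_space A (\<psi> n x)" using posH by (rule tf(1))
      have K'p: "K' (\<psi> n x) = tscale (1 / \<phi> (\<psi> n x)) (K (\<psi> n x))" using posH by (rule tf(2))
      show ?thesis
        unfolding w_def K'p
        by (rule volume_density_scaled[OF assms(3) local_param_of_open_subset[OF \<Omega> W(1)] that Kp])
           (rule divide_pos_pos[OF zero_less_one pos[OF p]])
    qed
    show ?thesis
    proof (rule density_eq_of_local_bounds[where U = "\<lambda>n. \<psi> n ` W n", OF sets(1)])
      have "continuous_on \<Omega> \<phi>" using C1_function_continuous[OF H assms(7)] \<Omega>H continuous_on_subset by blast
      then have "continuous_on \<Omega> (\<lambda>p. 1 / \<phi> p)" using pos by (intro continuous_intros) force+
      then have "(\<lambda>p. 1 / \<phi> p) \<in> borel_measurable (restrict_space borel \<Omega>)"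
        by (rule borel_measurable_continuous_on_restrict)
      then show "(\<lambda>p. 1 / \<phi> p) \<in> borel_measurable \<mu>" using measurable_cong_sets[OF sets(2) refl] by blast
      show "1 / \<phi> p > 0" if "p \<in> space \<mu>" for p using pos that space by simp
      show "space \<mu> \<subseteq> (\<Union>n. \<psi> n ` W n)" using W(2) space by simp
      show "\<psi> n ` W n \<in> sets \<mu>" for n
        using W(1)[of n] by (auto simp: local_param_def openin_open sets(2) sets_restrict_space)
    next
      fix n X and b :: real
      assume X: "X \<in> sets \<mu>" "X \<subseteq> \<psi> n ` W n" and b: "b > 0" "\<And>p. p \<in> X \<Longrightarrow> 1 / \<phi> p \<le> b"
      show "emeasure \<nu> X \<le> ennreal b * emeasure \<mu> X"
      proof (rule volume_measure_le[OF \<mu> \<nu> W(1) X b(1)], fold w_def)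
        fix x assume x: "x \<in> W n" "\<psi> n x \<in> X"
        have "ennreal (w K' n x) = ennreal (1 / \<phi> (\<psi> n x)) * ennreal (w K n x)"
          using posH \<Omega>H W(2) x(1) unfolding ww[OF x(1)] by (intro ennreal_mult') (auto intro!: less_imp_le pos)
        also have "\<dots> \<le> ennreal b * ennreal (w K n x)"
          using b(2)[OF x(2)] by (intro mult_right_mono ennreal_leI) auto
        finally show "ennreal (w K' n x) \<le> ennreal b * ennreal (w K n x)" .
      qed
    next
      fix n X and a :: real
      assume X: "X \<in> sets \<mu>" "X \<subseteq> \<psi> n ` W n" and a: "a > 0" "\<And>p. p \<in> X \<Longrightarrow> a \<le> 1 / \<phi> p"
      have "emeasure \<mu> X \<le> ennreal (1 / a) * emeasure \<nu> X"
      proof (rule volume_measure_le[OF \<nu> \<mu> W(1) _ X(2)], fold w_def)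
        show "X \<in> sets \<nu>" "1 / a > 0" using X a sets by auto
        fix x assume x: "x \<in> W n" "\<psi> n x \<in> X"
        have f: "\<phi> (\<psi> n x) > 0" using pos W(2) x(1) by blast
        then have le: "\<phi> (\<psi> n x) \<le> 1 / a" using a(2)[OF x(2)] a(1) by (simp add: field_simps)
        have "w K n x = \<phi> (\<psi> n x) * w K' n x" using ww[OF x(1)] f by simp
        then have "ennreal (w K n x) = ennreal (\<phi> (\<psi> n x)) * ennreal (w K' n x)"
          using f by (simp add: ennreal_mult')
        also have "\<dots> \<le> ennreal (1 / a) * ennreal (w K' n x)"
          using le by (intro mult_right_mono ennreal_leI) auto
        finally show "ennreal (w K n x) \<le> ennreal (1 / a) * ennreal (w K' n x)" .
      qed
      then have "ennreal a * emeasure \<mu> X \<le> ennreal a * (ennreal (1 / a) * emeasure \<nu> X)"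
        by (rule mult_left_mono) simp
      also have "\<dots> = emeasure \<nu> X"
        using a(1) by (simp add: mult.assoc[symmetric] ennreal_mult[symmetric])
      finally show "ennreal a * emeasure \<mu> X \<le> emeasure \<nu> X" .
    qed
  qed
qed

end
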